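(* Consider the problem $(\mathsf P)$: $\min_{x_1,\dots,x_N\in\mathbb R^n}\sum_{i=1}^N f_i(x_i)$ subject to $\sum_{i=1}^N B_ix_i=q$, over a connected undirected graph $\mathcal G$ with $N$ nodes (agents), where each $f_i$ is continuously differentiable, each $\nabla f_i$ is Lipschitz continuous with constant $\gamma^+>0$, and $\gamma^-$ is a (possibly negative) constant with $\langle\nabla f_i(x)-\nabla f_i(x'),x-x'\rangle\ge\gamma^-\|x-x'\|^2$ for all $x,x'\in\mathbb R^n$ and all $i$. Let $p>-\gamma^-$ and $\rho>0$. There are constants $\theta_1,\theta_2>0$, depending only on the problem instance, such that the following holds with $a_1,a_2,a_3,\sigma_1,\sigma_2,\sigma_3$ as defined in the context. For sufficiently small step sizes $0<\alpha<\rho$ and $0<\beta<1$, namely $$\alpha\le\min\Big\{\frac{\rho}{5},\frac{\rho}{8a_1\lambda_{\max}^2}\Big\},\qquad \beta<\Big(\frac12+\frac{20p\sigma_2^2a_2\lambda_{\max}^2}{\rho}+\frac{\rho(\sigma_1^2+2\sigma_2^2a_3)}{10p\sigma_2^2a_2\lambda_{\max}^2}\Big)^{-1},$$ the sequences generated by the PDC algorithm (described in the context) satisfy: (a) Every limit point $(z^*,y^* )$ of $\{(z^r,y^r)\}$ is a KKT solution of $(\mathsf P)$, i.e. $y_1^*=\dots=y_N^*=:y_0^*$, $\nabla f_i(z_i^* )+B_i^\top y_0^*=0$ for all $i$, and $\sum_{i=1}^N B_iz_i^*=q$. (b) There exists $t<r$ such that $z^t$ is an $\mathcal O(1/r)$-KKT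 solution of $(\mathsf P)$; that is, there is a constant $C>0$ independent of $r$ such that for every $r\ge 1$ some $z^t$ with $t<r$ is a $(C/r)$-KKT solution.
   Context: Data: $f_i:\mathbb R^n\to\mathbb R$, $B_i\in\mathbb R^{M\times n}$, $q\in\mathbb R^M$. $B_{\max}=\max_i\|B_i\|$ (spectral norm). Graph: $\mathcal G$ has nodes $\{1,\dots,N\}$, edge set $\mathcal E$, neighbour sets $\mathcal N_i=\{j:(i,j)\in\mathcal E\}$, $\tilde D=\mathrm{diag}(|\mathcal N_1|,\dots,|\mathcal N_N|)$. $\tilde A\in\mathbb R^{|\mathcal E|\times N}$ is the incidence matrix: for $e=(i,j)\in\mathcal E$ with $j>i$, $\tilde A_{e,i}=1$, $\tilde A_{e,j}=-1$, other entries $0$. $\tilde L^-=\tilde A^\top\tilde A$, $\tilde L^+=2\tilde D-\tilde L^-$, $L^{+}=\tilde L^{+}\otimes I_M$, and $\lambda_{\max}$ is the largest eigenvalue of $L^+$. For $y=(y_1,\dots,y_N)\in\mathbb R^{NM}$, $(L^+y)_i=\sum_{j\in\mathcal N_i}(y_i+y_j)$. PDC algorithm with parameters $p,\rho,\alpha,\beta$: initial $x_i^0=z_i^0\in\mathbb R^n$, $y_i^0\in\mathbb R^M$, $p_i^0=0\in\mathbb R^M$. For $r=0,1,2,\dots$ and all $i$: $$p_i^{r+1}=p_i^r+\alpha\sum_{j\in\mathcal N_i}(y_i^r-y_j^r),$$ $$x_i^{r+1}=\arg\min_{x_i}\Big\{f_i(x_i)+\frac p2\|x_i-z_i^r\|^2+\frac1{4\rho|\mathcal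 N_i|}\Big\|B_ix_i-\frac qN-p_i^{r+1}+\rho(L^+y^r)_i\Big\|^2\Big\},$$ $$y_i^{r+1}=\frac1{2\rho|\mathcal N_i|}\Big(B_ix_i^{r+1}-\frac qN-p_i^{r+1}+\rho(L^+y^r)_i\Big),\qquad z_i^{r+1}=z_i^r+\beta(x_i^{r+1}-z_i^r).$$ Constants: $\sigma_1=\frac{p(p+\gamma^++1)}{p+\gamma^-}$, $\sigma_2=\frac{B_{\max}(p+\gamma^++1)}{p+\gamma^-}$, $\sigma_3=\frac{p}{p+\gamma^-}$, $K=\frac1{p+\gamma^-}+\rho^2(p+\gamma^+)$, $$a_1=\frac{\frac{\theta_1^2}{2\rho}K^2+\rho}{K},\quad a_2=\frac{\theta_1^4}{\rho^2}K^2+2\theta_1^2,\quad a_3=\theta_2^2\Big((p+\gamma^+)^2\sigma_3^2+\frac{B_{\max}^2\sigma_3^2}{\rho^2}\Big).$$ A vector $x=(x_1,\dots,x_N)\in\mathbb R^{Nn}$ is an $\epsilon$-KKT solution of $(\mathsf P)$ if $\|\sum_iB_ix_i-q\|^2\le\epsilon$ and there is $y\in\mathbb R^M$ with $\sum_i\|\nabla f_i(x_i)+B_i^\top y\|^2\le\epsilon$.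
   Formalization: Part (b) additionally assumes that (P) is feasible and its objective is bounded below on the feasible set; without this (b) fails, e.g. for N=2, n=M=1, B_1=0, B_2=1, f_1(x)=x, f_2=0, q=0, where the gradient residual of agent 1 is always 1. *)

theory Defs
  imports "HOL-Analysis.Analysis"
begin

text \<open>
  Agents are the elements of a finite linearly ordered type \<open>'v\<close> (so \<open>N = CARD('v)\<close>); the order only
  orients the edges in the incidence matrix. An element \<open>x\<close> of \<open>(real^'n)^'v\<close> is a stacked vector
  with blocks \<open>x $ i\<close>. An undirected graph is a symmetric irreflexive relation \<open>E\<close> on \<open>'v\<close>.
\<close>

section \<open>The graph and its Laplacians\<close>

definition connected_graph :: "('v \<times> 'v) set \<Rightarrow> bool" where
  "connected_graph E \<longleftrightarrow> sym E \<and> irrefl E \<and> (\<forall>i j. (i, j) \<in> E\<^sup>*)"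

definition nbrs :: "('v \<times> 'v) set \<Rightarrow> 'v \<Rightarrow> 'v set" where
  "nbrs E i = {j. (i, j) \<in> E}"

text \<open>Each undirected edge occurs twice in \<open>E\<close>; it labels one row of the incidence matrix.\<close>

definition edge_rows :: "('v::linorder \<times> 'v) set \<Rightarrow> ('v \<times> 'v) set" where
  "edge_rows E = {(i, j) \<in> E. i < j}"

definition incidence :: "'v \<times> 'v \<Rightarrow> 'v \<Rightarrow> real" where
  "incidence e k = (if k = fst e then 1 else if k = snd e then -1 else 0)"

definition degree_matrix :: "('v::finite \<times> 'v) set \<Rightarrow> real^'v^'v" where
  "degree_matrix E = (\<chi> i j. if i = j then real (card (nbrs E i)) else 0)"

definition Lminus0 :: "('v::{finite,linorder} \<times> 'v) set \<Rightarrow> real^('v::{finite,linorder})^('v::{finite,linorder})" where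
  "Lminus0 E = (\<chi> i j. \<Sum>e\<in>edge_rows E. incidence e i * incidence e j)"

definition Lplus0 :: "('v::{finite,linorder} \<times> 'v) set \<Rightarrow> real^('v::{finite,linorder})^('v::{finite,linorder})" where
  "Lplus0 E = 2 *\<^sub>R degree_matrix E - Lminus0 E"

definition kron :: "real^'a^'a \<Rightarrow> real^'b^'b \<Rightarrow> real^('a \<times> 'b)^('a \<times> 'b)" where
  "kron A B = (\<chi> s t. A $ fst s $ fst t * B $ snd s $ snd t)"

text \<open>The type argument carries the dimension \<open>M = CARD('m)\<close>.\<close>

definition Lplus :: "'m::finite itself \<Rightarrow> ('v::{finite,linorder} \<times> 'v) set
    \<Rightarrow> real^('v \<times> 'm)^('v \<times> 'm)" where
  "Lplus _ E = kron (Lplus0 E) (mat 1)"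

definition eigenvalues :: "real^'a^'a \<Rightarrow> real set" where
  "eigenvalues A = {l. \<exists>v. v \<noteq> 0 \<and> A *v v = l *\<^sub>R v}"

definition lambda_max :: "'m::finite itself \<Rightarrow> ('v::{finite,linorder} \<times> 'v) set \<Rightarrow> real" where
  "lambda_max M E = Max (eigenvalues (Lplus M E))"

definition Lplus_act :: "('v::finite \<times> 'v) set \<Rightarrow> real^'m^'v \<Rightarrow> real^'m^'v" where
  "Lplus_act E y = (\<chi> i. \<Sum>j\<in>nbrs E i. y $ i + y $ j)"

definition stack :: "real^'m^'v \<Rightarrow> real^('v \<times> 'm)" where
  "stack y = (\<chi> s. y $ fst s $ snd s)"

lemma Lminus0_entry:
  fixes E :: "('v::{finite,linorder} \<times> 'v) set"
  assumes E: "sym E" "irrefl E"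
  shows "Lminus0 E $ i $ j =
    (if i = j then real (card (nbrs E i)) else if (i, j) \<in> E then -1 else 0)"
proof (cases "i = j")
  case True
  let ?R = "edge_rows E"
  have "(\<Sum>e\<in>?R. incidence e i * incidence e i)
      = (\<Sum>e\<in>?R. if fst e = i \<or> snd e = i then 1 else 0)"
    by (rule sum.cong) (auto simp: incidence_def edge_rows_def)
  also have "\<dots> = real (card {e \<in> ?R. fst e = i \<or> snd e = i})"
    by (simp add: sum.If_cases Int_def)
  also have "card {e \<in> ?R. fst e = i \<or> snd e = i} = card (nbrs E i)"
  proof (rule bij_betw_same_card)
    show "bij_betw (\<lambda>e. if fst e = i then snd e else fst e)
        {e \<in> ?R. fst e = i \<or> snd e = i} (nbrs E i)"
      using E unfolding bij_betw_def inj_on_def edge_rows_def nbrs_def image_def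
      by (auto simp: sym_def irrefl_def split: if_splits)
         (metis linorder_cases)+
  qed
  finally show ?thesis using True by (simp add: Lminus0_def)
next
  case False
  let ?R = "edge_rows E"
  have "(\<Sum>e\<in>?R. incidence e i * incidence e j)
      = (\<Sum>e\<in>?R. if e = (min i j, max i j) then -1 else 0)"
    using False
    by (intro sum.cong) (auto simp: incidence_def edge_rows_def min_def max_def)
  also have "\<dots> = (if (min i j, max i j) \<in> ?R then -1 else 0)"
    by (simp add: sum.delta)
  also have "(min i j, max i j) \<in> ?R \<longleftrightarrow> (i, j) \<in> E"
    using False E by (auto simp: edge_rows_def min_def max_def sym_def)
  finally show ?thesis using False by (simp add: Lminus0_def)
qed

lemma Lplus_stack:
  fixes E :: "('v::{finite,linorder} \<times> 'v) set" and y :: "real^'m^('v::{finite,linorder})"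
  assumes E: "sym E" "irrefl E"
  shows "Lplus TYPE('m) E *v stack y = stack (Lplus_act E y)"
proof -
  have ent: "Lplus0 E $ i $ j = (if i = j then real (card (nbrs E i)) else 0)
      + (if j \<in> nbrs E i then 1 else 0)" for i j
    using E by (auto simp: Lplus0_def degree_matrix_def Lminus0_entry nbrs_def irrefl_def)
  have "(Lplus TYPE('m) E *v stack y) $ (i, k) = stack (Lplus_act E y) $ (i, k)" for i k
  proof -
    have "(Lplus TYPE('m) E *v stack y) $ (i, k)
        = (\<Sum>t\<in>UNIV \<times> UNIV. Lplus0 E $ i $ fst t * (mat 1 :: real^'m^'m) $ k $ snd t * y $ fst t $ snd t)"
      by (simp add: matrix_vector_mult_def Lplus_def kron_def stack_def)
    also have "\<dots> = (\<Sum>j\<in>UNIV. \<Sum>l\<in>UNIV. Lplus0 E $ i $ j * (if k = l then 1 else 0) * y $ j $ l)"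
      by (subst sum.cartesian_product) (simp add: mat_def case_prod_unfold)
    also have "\<dots> = (\<Sum>j\<in>UNIV. Lplus0 E $ i $ j * y $ j $ k)"
      by (simp add: if_distrib[of "\<lambda>x. _ * x * _"] cong: if_cong)
    also have "\<dots> = real (card (nbrs E i)) * y $ i $ k + (\<Sum>j\<in>nbrs E i. y $ j $ k)"
      by (simp add: ent distrib_right sum.distrib if_distribR sum.If_cases
          if_distrib[of "\<lambda>x. x * _"] cong: if_cong)
    finally show ?thesis
      by (simp add: stack_def Lplus_act_def sum.distrib sum_constant_scaleR del: sum_constant)
  qed
  then show ?thesis by (simp add: vec_eq_iff)
qed

section \<open>The problem and its KKT conditions\<close>

text \<open>
  The problem is to minimise \<open>\<Sum>i. f i (x $ i)\<close> subject to \<open>\<Sum>i. B i *v x $ i = q\<close>; \<open>g i\<close> stands for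
  the gradient of \<open>f i\<close>.
\<close>

definition B_max :: "('v::finite \<Rightarrow> real^'n^'m) \<Rightarrow> real" where
  "B_max B = Max (range (\<lambda>i. onorm ((*v) (B i))))"

definition feasible_set :: "('v::finite \<Rightarrow> real^'n^'m) \<Rightarrow> real^'m \<Rightarrow> (real^'n^'v) set" where
  "feasible_set B q = {x. (\<Sum>i\<in>UNIV. B i *v x $ i) = q}"

text \<open>
  Without a finite optimal value there need be no approximate KKT points at all (infeasible
  constraints, or a linear \<open>f i\<close> whose \<open>B i\<close> is zero), so no complexity bound can hold.
\<close>

definition finite_optimal_value ::
  "('v::finite \<Rightarrow> real^'n \<Rightarrow> real) \<Rightarrow> ('v \<Rightarrow> real^'n^'m) \<Rightarrow> real^'m \<Rightarrow> bool" where
  "finite_optimal_value f B q \<longleftrightarrow> feasible_set B q \<noteq> {} \<and>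
     bdd_below ((\<lambda>x. \<Sum>i\<in>UNIV. f i (x $ i)) ` feasible_set B q)"

definition KKT :: "('v::finite \<Rightarrow> real^'n \<Rightarrow> real^'n) \<Rightarrow> ('v \<Rightarrow> real^'n^'m) \<Rightarrow> real^'m
    \<Rightarrow> real^'n^'v \<Rightarrow> real^'m^'v \<Rightarrow> bool" where
  "KKT g B q z y \<longleftrightarrow> (\<exists>y0. (\<forall>i. y $ i = y0) \<and>
     (\<forall>i. g i (z $ i) + transpose (B i) *v y0 = 0) \<and>
     (\<Sum>i\<in>UNIV. B i *v z $ i) = q)"

definition eps_KKT :: "('v::finite \<Rightarrow> real^'n \<Rightarrow> real^'n) \<Rightarrow> ('v \<Rightarrow> real^'n^'m) \<Rightarrow> real^'m
    \<Rightarrow> real \<Rightarrow> real^'n^'v \<Rightarrow> bool" where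
  "eps_KKT g B q \<epsilon> x \<longleftrightarrow> (norm ((\<Sum>i\<in>UNIV. B i *v x $ i) - q))\<^sup>2 \<le> \<epsilon> \<and>
     (\<exists>y. (\<Sum>i\<in>UNIV. (norm (g i (x $ i) + transpose (B i) *v y))\<^sup>2) \<le> \<epsilon>)"

definition limit_point :: "(nat \<Rightarrow> 'a::topological_space) \<Rightarrow> 'a \<Rightarrow> bool" where
  "limit_point X l \<longleftrightarrow> (\<exists>s. strict_mono s \<and> (X \<circ> s) \<longlonglongrightarrow> l)"

section \<open>The algorithm\<close>

text \<open>The iterates \<open>p\<^sub>i\<^sup>r\<close> are called \<open>w r $ i\<close>, to keep them apart from the parameter \<open>p\<close>.\<close>

definition PDC_residual :: "('v::finite \<times> 'v) set \<Rightarrow> ('v \<Rightarrow> real^'n^'m) \<Rightarrow> real^'m \<Rightarrow> real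
    \<Rightarrow> real^'m^'v \<Rightarrow> real^'m^'v \<Rightarrow> 'v \<Rightarrow> real^'n \<Rightarrow> real^'m" where
  "PDC_residual E B q \<rho> w y i \<xi> =
     B i *v \<xi> - (1 / real CARD('v)) *\<^sub>R q - w $ i + \<rho> *\<^sub>R (Lplus_act E y $ i)"

definition PDC :: "('v::finite \<times> 'v) set \<Rightarrow> ('v \<Rightarrow> real^'n \<Rightarrow> real) \<Rightarrow> ('v \<Rightarrow> real^'n^'m) \<Rightarrow> real^'m
    \<Rightarrow> real \<Rightarrow> real \<Rightarrow> real \<Rightarrow> real
    \<Rightarrow> (nat \<Rightarrow> real^'n^'v) \<Rightarrow> (nat \<Rightarrow> real^'m^'v) \<Rightarrow> (nat \<Rightarrow> real^'n^'v) \<Rightarrow> (nat \<Rightarrow> real^'m^'v)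
    \<Rightarrow> bool" where
  "PDC E f B q p \<rho> \<alpha> \<beta> x y z w \<longleftrightarrow>
     x 0 = z 0 \<and> w 0 = 0 \<and>
     (\<forall>r i.
        w (Suc r) $ i = w r $ i + \<alpha> *\<^sub>R (\<Sum>j\<in>nbrs E i. y r $ i - y r $ j) \<and>
        is_arg_min (\<lambda>\<xi>. f i \<xi> + p / 2 * (norm (\<xi> - z r $ i))\<^sup>2
            + 1 / (4 * \<rho> * real (card (nbrs E i)))
              * (norm (PDC_residual E B q \<rho> (w (Suc r)) (y r) i \<xi>))\<^sup>2)
          (\<lambda>_. True) (x (Suc r) $ i) \<and>
        y (Suc r) $ i = (1 / (2 * \<rho> * real (card (nbrs E i)))) *\<^sub>R
            PDC_residual E B q \<rho> (w (Suc r)) (y r) i (x (Suc r) $ i) \<and>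
        z (Suc r) $ i = z r $ i + \<beta> *\<^sub>R (x (Suc r) $ i - z r $ i))"

section \<open>Constants and step sizes\<close>

text \<open>\<open>gm\<close> and \<open>gp\<close> are \<open>\<gamma>\<^sup>-\<close> and \<open>\<gamma>\<^sup>+\<close>; \<open>b\<close> and \<open>lam\<close> stand for \<open>B_max\<close> and \<open>lambda_max\<close>.\<close>

definition sigma1 :: "real \<Rightarrow> real \<Rightarrow> real \<Rightarrow> real" where
  "sigma1 p gm gp = p * (p + gp + 1) / (p + gm)"

definition sigma2 :: "real \<Rightarrow> real \<Rightarrow> real \<Rightarrow> real \<Rightarrow> real" where
  "sigma2 b p gm gp = b * (p + gp + 1) / (p + gm)"

definition sigma3 :: "real \<Rightarrow> real \<Rightarrow> real" where
  "sigma3 p gm = p / (p + gm)"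

definition K_const :: "real \<Rightarrow> real \<Rightarrow> real \<Rightarrow> real \<Rightarrow> real" where
  "K_const p \<rho> gm gp = 1 / (p + gm) + \<rho>\<^sup>2 * (p + gp)"

definition a1 :: "real \<Rightarrow> real \<Rightarrow> real \<Rightarrow> real \<Rightarrow> real \<Rightarrow> real" where
  "a1 \<theta>\<^sub>1 p \<rho> gm gp = (\<theta>\<^sub>1\<^sup>2 / (2 * \<rho>) * (K_const p \<rho> gm gp)\<^sup>2 + \<rho>) / K_const p \<rho> gm gp"

definition a2 :: "real \<Rightarrow> real \<Rightarrow> real \<Rightarrow> real \<Rightarrow> real \<Rightarrow> real" where
  "a2 \<theta>\<^sub>1 p \<rho> gm gp = \<theta>\<^sub>1 ^ 4 / \<rho>\<^sup>2 * (K_const p \<rho> gm gp)\<^sup>2 + 2 * \<theta>\<^sub>1\<^sup>2"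

definition a3 :: "real \<Rightarrow> real \<Rightarrow> real \<Rightarrow> real \<Rightarrow> real \<Rightarrow> real \<Rightarrow> real" where
  "a3 \<theta>\<^sub>2 b p \<rho> gm gp =
     \<theta>\<^sub>2\<^sup>2 * ((p + gp)\<^sup>2 * (sigma3 p gm)\<^sup>2 + b\<^sup>2 * (sigma3 p gm)\<^sup>2 / \<rho>\<^sup>2)"

definition alpha_small :: "real \<Rightarrow> real \<Rightarrow> real \<Rightarrow> real \<Rightarrow> real \<Rightarrow> real \<Rightarrow> real \<Rightarrow> bool" where
  "alpha_small \<theta>\<^sub>1 lam p \<rho> gm gp \<alpha> \<longleftrightarrow>
     \<alpha> \<le> min (\<rho> / 5) (\<rho> / (8 * a1 \<theta>\<^sub>1 p \<rho> gm gp * lam\<^sup>2))"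

text \<open>
  The bound on \<open>\<beta>\<close> divides by \<open>10 p \<sigma>\<^sub>2\<^sup>2 a\<^sub>2 \<lambda>\<^sub>m\<^sub>a\<^sub>x\<^sup>2\<close>. As \<open>x / 0 = 0\<close> in HOL would turn a vanishing
  denominator (\<open>p = 0\<close>, \<open>B = 0\<close>, or a single agent) into a meaningless bound, the denominator is
  required to be nonzero.
\<close>

definition beta_small ::
  "real \<Rightarrow> real \<Rightarrow> real \<Rightarrow> real \<Rightarrow> real \<Rightarrow> real \<Rightarrow> real \<Rightarrow> real \<Rightarrow> real \<Rightarrow> bool" where
  "beta_small \<theta>\<^sub>1 \<theta>\<^sub>2 b lam p \<rho> gm gp \<beta> \<longleftrightarrow>
     10 * p * (sigma2 b p gm gp)\<^sup>2 * a2 \<theta>\<^sub>1 p \<rho> gm gp * lam\<^sup>2 \<noteq> 0 \<and>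
     \<beta> < inverse (1 / 2
        + 20 * p * (sigma2 b p gm gp)\<^sup>2 * a2 \<theta>\<^sub>1 p \<rho> gm gp * lam\<^sup>2 / \<rho>
        + \<rho> * ((sigma1 p gm gp)\<^sup>2 + 2 * (sigma2 b p gm gp)\<^sup>2 * a3 \<theta>\<^sub>2 b p \<rho> gm gp)
          / (10 * p * (sigma2 b p gm gp)\<^sup>2 * a2 \<theta>\<^sub>1 p \<rho> gm gp * lam\<^sup>2))"

end

theory Submission
  imports Defs
begin

text \<open>
  Let \<open>A\<close> be the edge difference operator, so that \<open>L\<^sup>- = A\<^sup>T A\<close> and the dual iterates are \<open>w = A\<^sup>T \<mu>\<close> with
  \<open>\<mu>\<^sup>r\<^sup>+\<^sup>1 = \<mu>\<^sup>r + \<alpha> A y\<^sup>r\<close>. Since \<open>L\<^sup>+ = 2 D - L\<^sup>-\<close>, the \<open>y\<close>-update is a proximal step, in the metric \<open>\<rho> L\<^sup>+\<close>, on the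
  dual of the strongly convex problem of minimising
  \<open>\<Sum>\<^sub>i f\<^sub>i (x\<^sub>i) + p/2 \<parallel>x - z\<parallel>\<^sup>2 + \<parallel>\<mu>' - \<mu>\<parallel>\<^sup>2 / (2 \<rho>)\<close> subject to \<open>B\<^sub>i x\<^sub>i - q/N = (A\<^sup>T \<mu>')\<^sub>i\<close>.
  The updates of \<open>z\<close> and \<open>\<mu>\<close> are inexact gradient steps on the value of this problem, its Moreau envelope.
  For \<open>p > 0\<close> the value plus the duality gap of \<open>y\<close> decreases: the error of the inexact solution is bounded by
  \<open>L\<^sup>+ (y\<^sup>r\<^sup>+\<^sup>1 - y\<^sup>r)\<close> through a Hoffman constant of the linear map \<open>(B, A\<^sup>T)\<close>, which is what \<open>\<theta>\<^sub>1\<close> encodes.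
  For \<open>p < 0\<close> the bound on \<open>\<beta>\<close> forces \<open>\<gamma>\<^sup>- \<ge> 6 \<bar>p\<bar>\<close>, and a weighted distance to a saddle point decreases.
  In both cases the residuals are square summable, which gives both claims.
\<close>

section \<open>Convexity and linear algebra\<close>

text \<open>Stacking the agents turns the coupling constraint into membership of
  \<open>B x - c\<close> in the range of \<open>At\<close>, and consensus into the kernel of
  \<open>A\<close>. Connectedness identifies that kernel with the constant vectors and that range
  with the vectors of block sum zero. Two obstacles shape the estimates. L+ may be singular, as for
  bipartite graphs, so a step of \<open>y\<close> is controlled only through its image under L+, and
  the error bound has to be phrased with that image. Moreover \<open>\<theta>\<^sub>1\<close> is
  fixed before \<open>p\<close> and \<open>\<rho>\<close>: it may hold only data of \<open>B\<close>
  and the graph, so every factor \<open>p + gp\<close>, \<open>p + gm\<close> and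
  \<open>\<rho>\<close> must be matched by \<open>a1\<close>, \<open>a2\<close> and
  \<open>sigma2\<close>. The crude bound 2N for L+ is admissible because its ratio to the largest
  eigenvalue is absorbed into \<open>\<theta>\<^sub>1\<close>. Claim (a) has to cope with an
  objective that may be unbounded below. A lower bound is available along a subsequence on which
  \<open>z\<close> converges, and monotonicity of the Lyapunov function spreads it to all iterates.
  Feasibility likewise has to be deduced from a convergent subsequence of \<open>y\<close>.\<close>

lemma gradient_quadratic_lower_bound:
  fixes f :: "'a::euclidean_space \<Rightarrow> real"
  assumes d: "\<And>x. GDERIV f x :> g x"
    and mono: "\<And>x x'. (g x - g x') \<bullet> (x - x') \<ge> k * (norm (x - x'))\<^sup>2"
  shows "f x' \<ge> f x + g x \<bullet> (x' - x) + k / 2 * (norm (x' - x))\<^sup>2"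
proof -
  define h where "h = x' - x"
  \<comment> \<open>\<open>\<phi>\<close> is \<open>f\<close> on the segment minus the claimed
    right-hand side; monotonicity of \<open>g\<close> makes its derivative nonnegative, whatever the
    sign of \<open>k\<close>.\<close>
  define \<phi> where "\<phi> = (\<lambda>t::real. f (x + t *\<^sub>R h) - t * (g x \<bullet> h) - k / 2 * t\<^sup>2 * (norm h)\<^sup>2)"
  have fl: "((\<lambda>t. f (x + t *\<^sub>R h)) has_real_derivative g (x + t *\<^sub>R h) \<bullet> h) (at t)" for t
  proof -
    have "((\<lambda>t. f (x + t *\<^sub>R h)) has_derivative (\<lambda>s. (s *\<^sub>R h) \<bullet> g (x + t *\<^sub>R h))) (at t)"
    proof (rule has_derivative_compose[where g = f])
      show "((\<lambda>t. x + t *\<^sub>R h) has_derivative (\<lambda>s. s *\<^sub>R h)) (at t)"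
        by (auto intro!: derivative_eq_intros)
      show "(f has_derivative (\<lambda>v. v \<bullet> g (x + t *\<^sub>R h))) (at (x + t *\<^sub>R h))"
        using d unfolding gderiv_def by blast
    qed
    then show ?thesis
      unfolding has_field_derivative_def by (simp add: inner_commute mult.commute[of _ "_ \<bullet> _"])
  qed
  have "\<phi> 0 \<le> \<phi> 1"
  proof (rule DERIV_nonneg_imp_nondecreasing[of 0 1])
    fix t :: real assume t: "0 \<le> t" "t \<le> 1"
    have "(\<phi> has_real_derivative g (x + t *\<^sub>R h) \<bullet> h - g x \<bullet> h - k * t * (norm h)\<^sup>2) (at t)"
      unfolding \<phi>_def by (auto intro!: derivative_eq_intros fl)
    moreover have "g (x + t *\<^sub>R h) \<bullet> h - g x \<bullet> h - k * t * (norm h)\<^sup>2 \<ge> 0"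
    proof (cases "t = 0")
      case False
      have "t * ((g (x + t *\<^sub>R h) - g x) \<bullet> h) \<ge> k * (t\<^sup>2 * (norm h)\<^sup>2)"
        using mono[where x="x + t *\<^sub>R h" and x'=x] t by (simp add: power_mult_distrib)
      then have "t * ((g (x + t *\<^sub>R h) - g x) \<bullet> h) \<ge> t * (k * t * (norm h)\<^sup>2)"
        by (simp add: power2_eq_square mult_ac)
      then show ?thesis
        using t False by (simp add: inner_diff_left)
    qed simp
    ultimately show "\<exists>y. (\<phi> has_real_derivative y) (at t) \<and> y \<ge> 0" by blast
  qed simp
  then show ?thesis
    unfolding \<phi>_def h_def by simp
qed

lemma gradient_quadratic_upper_bound:
  fixes f :: "'a::euclidean_space \<Rightarrow> real"
  assumes d: "\<And>x. GDERIV f x :> g x"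
    and lip: "\<And>x x'. norm (g x - g x') \<le> k * norm (x - x')"
  shows "f x' \<le> f x + g x \<bullet> (x' - x) + k / 2 * (norm (x' - x))\<^sup>2"
proof -
  have "- f x' \<ge> - f x + - g x \<bullet> (x' - x) + - k / 2 * (norm (x' - x))\<^sup>2"
  proof (rule gradient_quadratic_lower_bound[where g = "\<lambda>x. - g x" and f = "\<lambda>x. - f x"])
    show "GDERIV (\<lambda>x. - f x) x :> - g x" for x
      by (rule GDERIV_minus[OF d])
    show "- k * (norm (x - x'))\<^sup>2 \<le> (- g x - - g x') \<bullet> (x - x')" for x x'
    proof -
      have "(g x - g x') \<bullet> (x - x') \<le> norm (g x - g x') * norm (x - x')"
        by (rule norm_cauchy_schwarz)
      also have "\<dots> \<le> (k * norm (x - x')) * norm (x - x')"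
        by (intro mult_right_mono lip) simp
      finally show ?thesis by (simp add: power2_eq_square inner_diff_left)
    qed
  qed
  then show ?thesis by simp
qed

text \<open>Baillon--Haddad: each point minimises \<open>h\<close> tilted by its own gradient, and a gradient step of
  length \<open>1/L\<close> from the other point decreases the tilted function by \<open>\<parallel>\<nabla>\<parallel>\<^sup>2 / (2L)\<close>.\<close>

lemma gradient_cocoercive:
  fixes h :: "'a::euclidean_space \<Rightarrow> real"
  assumes lo: "\<And>x x'. h x' \<ge> h x + \<gamma> x \<bullet> (x' - x)"
    and up: "\<And>x x'. h x' \<le> h x + \<gamma> x \<bullet> (x' - x) + L / 2 * (norm (x' - x))\<^sup>2"
    and L: "L > 0"
  shows "(norm (\<gamma> x - \<gamma> x'))\<^sup>2 \<le> L * ((\<gamma> x - \<gamma> x') \<bullet> (x - x'))"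
proof -
  have half: "h x + \<gamma> x \<bullet> (x' - x) + (norm (\<gamma> x' - \<gamma> x))\<^sup>2 / (2 * L) \<le> h x'" for x x'
  proof -
    define d where "d = \<gamma> x' - \<gamma> x"
    define v where "v = x' - (1 / L) *\<^sub>R d"
    have 1: "h x + \<gamma> x \<bullet> (v - x) \<le> h v" by (rule lo)
    have 2: "h v \<le> h x' + \<gamma> x' \<bullet> (v - x') + L / 2 * (norm (v - x'))\<^sup>2" by (rule up)
    have n: "(norm (v - x'))\<^sup>2 = (norm d)\<^sup>2 / L\<^sup>2"
      unfolding v_def using L by (simp add: power_divide)
    have "\<gamma> x \<bullet> (v - x) = \<gamma> x \<bullet> (x' - x) - \<gamma> x \<bullet> d / L"
      by (simp add: v_def inner_simps)
    moreover have "\<gamma> x' \<bullet> (v - x') = - (\<gamma> x' \<bullet> d) / L"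
      by (simp add: v_def inner_simps)
    moreover have "(\<gamma> x' \<bullet> d) / L - (\<gamma> x \<bullet> d) / L = (norm d)\<^sup>2 / L"
      by (simp add: d_def power2_norm_eq_inner inner_simps diff_divide_distrib add_divide_distrib)
    moreover have "L / 2 * ((norm d)\<^sup>2 / L\<^sup>2) = (norm d)\<^sup>2 / L - (norm d)\<^sup>2 / (2 * L)"
      using L by (simp add: field_simps power2_eq_square)
    ultimately show ?thesis using 1 2 n unfolding d_def[symmetric] by simp
  qed
  have "(norm (\<gamma> x - \<gamma> x'))\<^sup>2 / L \<le> (\<gamma> x - \<gamma> x') \<bullet> (x - x')"
    using half[of x x'] half[of x' x] by (simp add: inner_simps norm_minus_commute)
  then show ?thesis using L by (simp add: field_simps)
qed

text \<open>Fredholm alternative: the part of \<open>w\<close> orthogonal to the range lies in the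
  kernel of the adjoint, hence is orthogonal to \<open>w\<close> and vanishes. It supplies Lagrange
  multipliers, the range of the transposed difference operator, and the infeasibility
  certificate.\<close>

lemma range_eq_kernel_adjoint_orthogonal:
  fixes T :: "'a::euclidean_space \<Rightarrow> 'b::euclidean_space"
  assumes "linear T" and adj: "\<And>u v. T u \<bullet> v = u \<bullet> Tt v"
    and orth: "\<And>v. Tt v = 0 \<Longrightarrow> v \<bullet> w = 0"
  shows "\<exists>u. T u = w"
proof -
  have sp: "span (range T) = range T"
    using assms(1) by (simp add: linear_subspace_image span_eq_iff)
  obtain a n where a: "a \<in> span (range T)" and n: "\<And>v. v \<in> span (range T) \<Longrightarrow> orthogonal n v"
    and w: "w = a + n"
    using orthogonal_subspace_decomp_exists[of "range T" w] by blast
  have "u \<bullet> Tt n = 0" for u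
    using n[of "T u"] sp adj[of u n] by (auto simp: orthogonal_def inner_commute)
  then have "Tt n = 0" using inner_eq_zero_iff by blast
  then have "n \<bullet> w = 0" by (rule orth)
  moreover have "n \<bullet> a = 0" using n[OF a] by (simp add: orthogonal_def)
  ultimately have "n = 0" using w by (simp add: inner_add_right)
  then show ?thesis using a sp w by auto
qed

text \<open>Existence of a minimiser on an affine set together with its multiplier \<open>v\<close>.
  Differentiability enters only through \<open>sc\<close> and the continuity of
  \<open>\<gamma>\<close>.\<close>

lemma strongly_convex_constrained_minimum:
  fixes \<phi> :: "'a::euclidean_space \<Rightarrow> real" and T :: "'a \<Rightarrow> 'b::euclidean_space"
  assumes cont: "continuous_on UNIV \<phi>" "continuous_on UNIV \<gamma>"
    and sc: "\<And>x x'. \<phi> x' \<ge> \<phi> x + \<gamma> x \<bullet> (x' - x) + m / 2 * (norm (x' - x))\<^sup>2" and m: "m > 0"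
    and T: "linear T" and Tt: "linear Tt" and adj: "\<And>u v. T u \<bullet> v = u \<bullet> Tt v"
  shows "\<exists>x v. T x = T x0 \<and> \<gamma> x + Tt v = 0"
proof -
  \<comment> \<open>Outside this ball the quadratic term of \<open>sc\<close> at \<open>x0\<close>
    outweighs the linear one, so \<open>\<phi>\<close> is at least \<open>\<phi> x0\<close> there
    and a compact slice suffices.\<close>
  define R where "R = 2 * norm (\<gamma> x0) / m"
  define S where "S = {x. T x = T x0} \<inter> cball x0 R"
  have "closed {x. T x = T x0}"
    by (intro closed_Collect_eq linear_continuous_on continuous_on_const)
       (use T in \<open>simp add: linear_conv_bounded_linear\<close>)
  then have "compact S" unfolding S_def by (intro closed_Int_compact) auto
  moreover have x0S: "x0 \<in> S" using m by (simp add: S_def R_def)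
  ultimately obtain x where xS: "x \<in> S" and xmin: "\<And>v. v \<in> S \<Longrightarrow> \<phi> x \<le> \<phi> v"
    using continuous_attains_inf[of S \<phi>] cont(1) continuous_on_subset by blast
  have min: "\<phi> x \<le> \<phi> v" if "T v = T x0" for v
  proof (cases "v \<in> cball x0 R")
    case True
    then show ?thesis using that xmin S_def by blast
  next
    case False
    then have "norm (v - x0) > R" by (simp add: dist_norm norm_minus_commute)
    then have r: "m / 2 * norm (v - x0) \<ge> norm (\<gamma> x0)"
      using m by (simp add: R_def field_simps)
    have "m / 2 * (norm (v - x0))\<^sup>2 \<ge> norm (\<gamma> x0) * norm (v - x0)"
      using mult_right_mono[OF r, of "norm (v - x0)"] by (simp add: power2_eq_square mult_ac)
    moreover have "\<gamma> x0 \<bullet> (v - x0) \<ge> - (norm (\<gamma> x0) * norm (v - x0))"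
      using Cauchy_Schwarz_ineq2[of "\<gamma> x0" "v - x0"] by linarith
    ultimately have "\<phi> v \<ge> \<phi> x0" using sc[of x0 v] by linarith
    then show ?thesis using xmin[OF x0S] by linarith
  qed
  have Tx: "T x = T x0" using xS by (simp add: S_def)
  \<comment> \<open>\<open>sc\<close> based at \<open>x + t d\<close> and evaluated at the minimiser
    \<open>x\<close> gives the sign for \<open>t > 0\<close>; continuity of \<open>\<gamma>\<close>
    carries it to \<open>t = 0\<close>. Applied to \<open>d\<close> and \<open>- d\<close>, it makes
    \<open>\<gamma> x\<close> orthogonal to the kernel of \<open>T\<close>.\<close>
  have nonneg: "\<gamma> x \<bullet> d \<ge> 0" if d: "T d = 0" for d
  proof -
    have "isCont (\<lambda>t::real. \<gamma> (x + t *\<^sub>R d) \<bullet> d) 0"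
      using continuous_on_compose2[OF cont(2), of UNIV "\<lambda>t::real. x + t *\<^sub>R d"]
      by (intro continuous_intros) (auto simp: continuous_on_eq_continuous_at intro!: continuous_intros)
    then have "((\<lambda>t::real. \<gamma> (x + t *\<^sub>R d) \<bullet> d) \<longlongrightarrow> \<gamma> x \<bullet> d) (at_right 0)"
      by (simp add: isCont_def filterlim_at_split)
    moreover have "\<gamma> (x + t *\<^sub>R d) \<bullet> d \<ge> 0" if t: "t > 0" for t :: real
    proof -
      have "\<phi> x \<le> \<phi> (x + t *\<^sub>R d)"
        using T d by (intro min) (simp add: linear_add linear_scale Tx)
      moreover have "\<phi> x \<ge> \<phi> (x + t *\<^sub>R d) - t * (\<gamma> (x + t *\<^sub>R d) \<bullet> d)"
      proof -
        have "m / 2 * (norm (x - (x + t *\<^sub>R d)))\<^sup>2 \<ge> 0" using m by simp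
        then show ?thesis using sc[where x="x + t *\<^sub>R d" and x'=x] by simp
      qed
      ultimately have "t * (\<gamma> (x + t *\<^sub>R d) \<bullet> d) \<ge> 0" by linarith
      then show ?thesis using t by (simp add: zero_le_mult_iff)
    qed
    ultimately show ?thesis
      by (intro tendsto_lowerbound[where F = "at_right (0::real)"])
         (auto simp: eventually_at_filter)
  qed
  have "\<exists>v. Tt v = \<gamma> x"
  proof (rule range_eq_kernel_adjoint_orthogonal[OF Tt])
    show "Tt u \<bullet> v = u \<bullet> T v" for u v using adj[of v u] by (simp add: inner_commute)
    show "v \<bullet> \<gamma> x = 0" if "T v = 0" for v
      using nonneg[OF that] nonneg[of "- v"] that T by (simp add: linear_neg inner_commute)
  qed
  then obtain v where "Tt v = \<gamma> x" by blast
  then show ?thesis using Tx Tt by (intro exI[of _ x] exI[of _ "- v"]) (simp add: linear_neg)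
qed

text \<open>\<open>\<theta>\<close> is a Hoffman constant: a solvable equation
  \<open>T u = s\<close> has a solution of norm at most \<open>\<theta> * norm s\<close>.\<close>

lemma linear_bounded_right_inverse_on_range:
  fixes T :: "'a::euclidean_space \<Rightarrow> 'b::euclidean_space"
  assumes "linear T"
  obtains h \<theta> where "linear h" "\<theta> > 0" "\<And>u. T (h (T u)) = T u" "\<And>s. norm (h s) \<le> \<theta> * norm s"
proof -
  obtain h where h: "linear h" "\<And>v. v \<in> range T \<Longrightarrow> T (h v) = v"
    using linear_exists_right_inverse_on[OF assms subspace_UNIV] by blast
  obtain \<theta> where "\<theta> > 0" "\<And>s. norm (h s) \<le> \<theta> * norm s"
    using linear_bounded_pos[OF h(1)] by blast
  then show ?thesis using that h by blast
qed

section \<open>Duality for the proximal problem\<close>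

text \<open>All agents in one vector. Of \<open>p\<close>, \<open>gm\<close> and
  \<open>p + gm\<close>, only the sum has a prescribed sign, so \<open>f\<close> may be nonconvex
  and the proximal term concave.\<close>

locale coupled_problem =
  fixes f :: "'a::euclidean_space \<Rightarrow> real" and g :: "'a \<Rightarrow> 'a" and gm gp :: real
    and B :: "'a \<Rightarrow> 'b::euclidean_space" and Bt :: "'b \<Rightarrow> 'a"
    and A :: "'b \<Rightarrow> 'c::euclidean_space" and At :: "'c \<Rightarrow> 'b"
    and c :: 'b and p \<rho> :: real
  assumes f_cont: "continuous_on UNIV f"
    and g_lip: "norm (g x - g x') \<le> gp * norm (x - x')"
    and f_lower: "f x' \<ge> f x + g x \<bullet> (x' - x) + gm / 2 * (norm (x' - x))\<^sup>2"
    and f_upper: "f x' \<le> f x + g x \<bullet> (x' - x) + gp / 2 * (norm (x' - x))\<^sup>2"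
    and lin: "linear B" "linear Bt" "linear A" "linear At"
    and B_adj: "B u \<bullet> v = u \<bullet> Bt v"
    and A_adj: "A v \<bullet> e = v \<bullet> At e"
    and gp_nonneg: "gp \<ge> 0" and curvature: "p + gm > 0" and rho: "\<rho> > 0"
begin

section \<open>Curvature of the proximal objective\<close>

lemma g_cont: "continuous_on UNIV g"
proof -
  have "gp-lipschitz_on UNIV g"
    using g_lip gp_nonneg by (intro lipschitz_onI) (auto simp: dist_norm)
  then show ?thesis by (rule lipschitz_on_continuous_on)
qed

definition prox_obj :: "'a \<Rightarrow> 'a \<Rightarrow> real" where
  "prox_obj z x = f x + p / 2 * (norm (x - z))\<^sup>2"

lemma norm_sq_expand: "(norm (x' - z))\<^sup>2 = (norm (x - z))\<^sup>2 + 2 * ((x - z) \<bullet> (x' - x)) + (norm (x' - x))\<^sup>2"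
  for x :: "'z::real_inner"
  by (simp add: power2_norm_eq_inner inner_simps inner_commute)

lemma prox_obj_lower:
  "prox_obj z x' \<ge> prox_obj z x + (g x + p *\<^sub>R (x - z)) \<bullet> (x' - x) + (p + gm) / 2 * (norm (x' - x))\<^sup>2"
proof -
  have "(p + gm) / 2 * (norm (x' - x))\<^sup>2 = p / 2 * (norm (x' - x))\<^sup>2 + gm / 2 * (norm (x' - x))\<^sup>2"
    by (simp add: field_simps)
  moreover have "p / 2 * (norm (x' - z))\<^sup>2
      = p / 2 * (norm (x - z))\<^sup>2 + p * ((x - z) \<bullet> (x' - x)) + p / 2 * (norm (x' - x))\<^sup>2"
    unfolding norm_sq_expand[of x' z x] by (simp add: field_simps)
  ultimately show ?thesis
    using f_lower[of x x'] unfolding prox_obj_def inner_add_left inner_scaleR_left by linarith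
qed

lemma prox_obj_upper:
  "prox_obj z x' \<le> prox_obj z x + (g x + p *\<^sub>R (x - z)) \<bullet> (x' - x) + (p + gp) / 2 * (norm (x' - x))\<^sup>2"
proof -
  have "(p + gp) / 2 * (norm (x' - x))\<^sup>2 = p / 2 * (norm (x' - x))\<^sup>2 + gp / 2 * (norm (x' - x))\<^sup>2"
    by (simp add: field_simps)
  moreover have "p / 2 * (norm (x' - z))\<^sup>2
      = p / 2 * (norm (x - z))\<^sup>2 + p * ((x - z) \<bullet> (x' - x)) + p / 2 * (norm (x' - x))\<^sup>2"
    unfolding norm_sq_expand[of x' z x] by (simp add: field_simps)
  ultimately show ?thesis
    using f_upper[of x' x] unfolding prox_obj_def inner_add_left inner_scaleR_left by linarith
qed

lemma grad_prox_obj_strongly_monotone: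
  "((g x + p *\<^sub>R (x - z)) - (g x' + p *\<^sub>R (x' - z))) \<bullet> (x - x') \<ge> (p + gm) * (norm (x - x'))\<^sup>2"
proof -
  let ?e = "(g x + p *\<^sub>R (x - z))" and ?e' = "(g x' + p *\<^sub>R (x' - z))"
  have "(?e - ?e') \<bullet> (x - x') = - (?e \<bullet> (x' - x)) - ?e' \<bullet> (x - x')"
    by (simp add: inner_diff_left inner_diff_right)
  moreover have "(norm (x' - x))\<^sup>2 = (norm (x - x'))\<^sup>2" by (simp add: norm_minus_commute)
  ultimately show ?thesis using prox_obj_lower[of z x x'] prox_obj_lower[of z x' x] by (simp add: field_simps)
qed

lemma grad_prox_obj_cocoercive:
  assumes "p + gp > 0"
  shows "(norm ((g x + p *\<^sub>R (x - z)) - (g x' + p *\<^sub>R (x' - z))))\<^sup>2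
    \<le> (p + gp) * (((g x + p *\<^sub>R (x - z)) - (g x' + p *\<^sub>R (x' - z))) \<bullet> (x - x'))"
proof (rule gradient_cocoercive[where h = "prox_obj z" and \<gamma> = "\<lambda>x. g x + p *\<^sub>R (x - z)"])
  show "prox_obj z x + (g x + p *\<^sub>R (x - z)) \<bullet> (x' - x) \<le> prox_obj z x'" for x x'
    using prox_obj_lower[of z x x'] curvature
    by (smt (verit) mult_nonneg_nonneg zero_le_power2 divide_nonneg_pos)
qed (use prox_obj_upper assms in auto)

text \<open>Completing the square. The bound is continuous in \<open>z\<close> alone, which is what
  keeps the potential bounded along convergent subsequences.\<close>

lemma prox_obj_bounded_below: "prox_obj z x \<ge> f z - (norm (g z))\<^sup>2 / (2 * (p + gm))"
proof -
  let ?m = "p + gm"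
  have "0 \<le> (norm (g z + ?m *\<^sub>R (x - z)))\<^sup>2 / (2 * ?m)" using curvature by simp
  also have "\<dots> = ((norm (g z))\<^sup>2 + 2 * ?m * (g z \<bullet> (x - z)) + ?m\<^sup>2 * (norm (x - z))\<^sup>2) / (2 * ?m)"
    unfolding power2_norm_eq_inner by (simp add: inner_add_left inner_add_right inner_commute power2_eq_square)
  also have "\<dots> = (norm (g z))\<^sup>2 / (2 * ?m) + g z \<bullet> (x - z) + ?m / 2 * (norm (x - z))\<^sup>2"
    using curvature by (simp add: field_simps power2_eq_square)
  finally show ?thesis using prox_obj_lower[of z z x] by (simp add: prox_obj_def)
qed

text \<open>Encoded by stationarity, the form in which the algorithm supplies its iterate; positive
  curvature makes the point unique and a minimiser of
  \<open>prox_obj z x + y \<bullet> B x\<close>.\<close>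

definition prox_min :: "'b \<Rightarrow> 'a \<Rightarrow> 'a" where
  "prox_min y z = (SOME x. g x + p *\<^sub>R (x - z) + Bt y = 0)"

lemma prox_min_stationary: "g (prox_min y z) + p *\<^sub>R (prox_min y z - z) + Bt y = 0"
proof -
  \<comment> \<open>The unconstrained case of the existence lemma: the constraint map and its
    adjoint are zero.\<close>
  have "\<exists>x v. (\<lambda>_. 0 :: 'b) x = (\<lambda>_. 0) (0::'a) \<and>
      (g x + p *\<^sub>R (x - z) + Bt y) + (\<lambda>_. 0) (v::'b) = 0"
  proof (rule strongly_convex_constrained_minimum[where \<phi> = "\<lambda>x. prox_obj z x + x \<bullet> Bt y" and m = "p + gm"])
    show "continuous_on UNIV (\<lambda>x. prox_obj z x + x \<bullet> Bt y)"
      unfolding prox_obj_def by (intro continuous_intros f_cont)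
    show "continuous_on UNIV (\<lambda>x. g x + p *\<^sub>R (x - z) + Bt y)"
      by (intro continuous_intros g_cont)
    show "prox_obj z x + x \<bullet> Bt y + (g x + p *\<^sub>R (x - z) + Bt y) \<bullet> (x' - x) + (p + gm) / 2 * (norm (x' - x))\<^sup>2
        \<le> prox_obj z x' + x' \<bullet> Bt y" for x x'
      using prox_obj_lower[of z x x'] inner_commute[of x "Bt y"] inner_commute[of x' "Bt y"]
      by (simp add: inner_add_left inner_diff_right)
  qed (use curvature in \<open>auto intro: linearI\<close>)
  then have "\<exists>x. g x + p *\<^sub>R (x - z) + Bt y = 0" by simp
  then show ?thesis unfolding prox_min_def by (rule someI_ex)
qed

lemma stationary_minimizes:
  assumes "g x + p *\<^sub>R (x - z) + Bt y = 0"
  shows "prox_obj z x + y \<bullet> B x \<le> prox_obj z x' + y \<bullet> B x'"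
proof -
  have e: "g x + p *\<^sub>R (x - z) = - Bt y"
    using assms by (simp add: eq_neg_iff_add_eq_0)
  have "prox_obj z x' \<ge> prox_obj z x + (- Bt y) \<bullet> (x' - x) + (p + gm) / 2 * (norm (x' - x))\<^sup>2"
    using prox_obj_lower[of z x x'] unfolding e .
  moreover have "(p + gm) / 2 * (norm (x' - x))\<^sup>2 \<ge> 0" using curvature by simp
  moreover have "(- Bt y) \<bullet> (x' - x) = y \<bullet> B x - y \<bullet> B x'"
    using B_adj[of x y] B_adj[of x' y] by (simp add: inner_diff_right inner_commute)
  ultimately show ?thesis by linarith
qed

lemma stationary_unique:
  assumes "g x + p *\<^sub>R (x - z) + Bt y = 0" "g x' + p *\<^sub>R (x' - z) + Bt y = 0"
  shows "x = x'"
proof -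
  have e: "g x + p *\<^sub>R (x - z) = g x' + p *\<^sub>R (x' - z)"
    using assms by (metis add_right_cancel)
  have "(p + gm) * (norm (x - x'))\<^sup>2 \<le> 0"
    using grad_prox_obj_strongly_monotone[of x x' z] e by simp
  then show ?thesis using curvature by (simp add: mult_le_0_iff)
qed

text \<open>As a function of \<open>y\<close> this is a maximum of affine functions, hence convex,
  with subgradient \<open>- (B x - c)\<close> at \<open>x = prox_min y z\<close>.\<close>

definition neg_dual :: "'b \<Rightarrow> 'a \<Rightarrow> real" where
  "neg_dual y z = - (prox_obj z (prox_min y z) + y \<bullet> (B (prox_min y z) - c))"

lemma neg_dual_ge: "neg_dual y z \<ge> - (prox_obj z x + y \<bullet> (B x - c))"
  using stationary_minimizes[OF prox_min_stationary, of z y x] by (simp add: neg_dual_def inner_diff_right)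

text \<open>The negated dual function of the relaxed problem: minimising the penalty minus
  \<open>A y \<bullet> \<mu>'\<close> over \<open>\<mu>'\<close> gives
  \<open>\<mu>' = \<mu> + \<rho> A y\<close> and leaves the last two terms. Dual ascent thus becomes
  descent of \<open>Lag\<close>.\<close>

definition Lag :: "'b \<Rightarrow> 'c \<Rightarrow> 'a \<Rightarrow> real" where
  "Lag y \<mu> z = neg_dual y z + \<mu> \<bullet> A y + \<rho> / 2 * (norm (A y))\<^sup>2"

lemma weak_duality:
  assumes "B x - c = At \<mu>'"
  shows "- Lag y \<mu> z \<le> prox_obj z x + (norm (\<mu>' - \<mu>))\<^sup>2 / (2 * \<rho>)"
proof -
  have "y \<bullet> (B x - c) = A y \<bullet> \<mu>'" using assms A_adj[of y \<mu>'] by simp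
  then have "- Lag y \<mu> z \<le> prox_obj z x + A y \<bullet> (\<mu>' - \<mu>) - \<rho> / 2 * (norm (A y))\<^sup>2"
    using neg_dual_ge[of z x y] by (simp add: Lag_def inner_diff_right inner_commute)
  moreover have "0 \<le> (norm ((\<mu>' - \<mu>) - \<rho> *\<^sub>R A y))\<^sup>2 / (2 * \<rho>)" using rho by simp
  moreover have "(norm ((\<mu>' - \<mu>) - \<rho> *\<^sub>R A y))\<^sup>2 / (2 * \<rho>)
     = (norm (\<mu>' - \<mu>))\<^sup>2 / (2 * \<rho>) - A y \<bullet> (\<mu>' - \<mu>) + \<rho> / 2 * (norm (A y))\<^sup>2"
  proof -
    have "(norm ((\<mu>' - \<mu>) - \<rho> *\<^sub>R A y))\<^sup>2
      = (norm (\<mu>' - \<mu>))\<^sup>2 - 2 * \<rho> * (A y \<bullet> (\<mu>' - \<mu>)) + \<rho>\<^sup>2 * (norm (A y))\<^sup>2"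
      unfolding power2_norm_eq_inner by (simp add: inner_diff_left inner_diff_right inner_commute power2_eq_square algebra_simps)
    then show ?thesis using rho by (simp add: field_simps power2_eq_square)
  qed
  ultimately show ?thesis by linarith
qed

definition dual_solution :: "'a \<Rightarrow> 'c \<Rightarrow> 'b" where
  "dual_solution z \<mu> = (SOME y. B (prox_min y z) - c = At (\<mu> + \<rho> *\<^sub>R A y))"

definition feasible :: bool where
  "feasible \<longleftrightarrow> (\<exists>x \<mu>. B x - c = At \<mu>)"

text \<open>The constrained minimum is taken over pairs \<open>(x, \<mu>')\<close>, and its
  multiplier is the dual solution. The second block of the stationarity equation reads
  \<open>\<mu>' = \<mu> + \<rho> A v\<close>.\<close>

lemma dual_solution:
  assumes feasible
  shows "B (prox_min (dual_solution z \<mu>) z) - c = At (\<mu> + \<rho> *\<^sub>R A (dual_solution z \<mu>))"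
proof -
  obtain x0 \<mu>0 where x0: "B x0 - c = At \<mu>0" using assms feasible_def by blast
  define T where "T = (\<lambda>w. B (fst w) - At (snd w))"
  define Tt where "Tt = (\<lambda>v. (Bt v, - A v))"
  define \<phi> where "\<phi> = (\<lambda>w. prox_obj z (fst w) + (norm (snd w - \<mu>))\<^sup>2 / (2 * \<rho>))"
  define \<gamma> where "\<gamma> = (\<lambda>w. (g (fst w) + p *\<^sub>R (fst w - z), (1 / \<rho>) *\<^sub>R (snd w - \<mu>)))"
  have "\<exists>w v. T w = T (x0, \<mu>0) \<and> \<gamma> w + Tt v = 0"
  proof (rule strongly_convex_constrained_minimum[where \<phi> = \<phi> and m = "min (p + gm) (1 / \<rho>)"])
    show "continuous_on UNIV \<phi>"
      unfolding \<phi>_def prox_obj_def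
      by (intro continuous_intros continuous_on_compose2[OF f_cont]) (use rho in auto)
    show "continuous_on UNIV \<gamma>"
      unfolding \<gamma>_def by (intro continuous_intros continuous_on_compose2[OF g_cont]) auto
    show "min (p + gm) (1 / \<rho>) > 0" using curvature rho by simp
    show "linear T" unfolding T_def
      using lin by (intro linearI) (auto simp: linear_add linear_scale scaleR_diff_right)
    show "linear Tt" unfolding Tt_def
      using lin by (intro linearI) (auto simp: linear_add linear_scale)
    show "T u \<bullet> v = u \<bullet> Tt v" for u v
      using B_adj[of "fst u" v] A_adj[of v "snd u"]
      by (cases u) (simp add: T_def Tt_def inner_diff_left, metis inner_commute)
    show "\<phi> w + \<gamma> w \<bullet> (w' - w) + min (p + gm) (1 / \<rho>) / 2 * (norm (w' - w))\<^sup>2 \<le> \<phi> w'" for w w'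
    proof -
      obtain a b a' b' where w: "w = (a, b)" "w' = (a', b')" by fastforce
      let ?m = "min (p + gm) (1 / \<rho>)"
      have n: "(norm (w' - w))\<^sup>2 = (norm (a' - a))\<^sup>2 + (norm (b' - b))\<^sup>2"
        by (simp add: w power2_norm_eq_inner)
      have "?m / 2 * (norm (a' - a))\<^sup>2 \<le> (p + gm) / 2 * (norm (a' - a))\<^sup>2"
        "?m / 2 * (norm (b' - b))\<^sup>2 \<le> (1 / \<rho>) / 2 * (norm (b' - b))\<^sup>2"
        by (intro mult_right_mono; simp)+
      moreover have "(norm (b' - \<mu>))\<^sup>2 / (2 * \<rho>) = (norm (b - \<mu>))\<^sup>2 / (2 * \<rho>)
          + ((1 / \<rho>) *\<^sub>R (b - \<mu>)) \<bullet> (b' - b) + (1 / \<rho>) / 2 * (norm (b' - b))\<^sup>2"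
        unfolding norm_sq_expand[of b' \<mu> b] inner_scaleR_left using rho by (simp add: field_simps)
      moreover have "\<phi> w = prox_obj z a + (norm (b - \<mu>))\<^sup>2 / (2 * \<rho>)" "\<phi> w' = prox_obj z a' + (norm (b' - \<mu>))\<^sup>2 / (2 * \<rho>)"
        "\<gamma> w \<bullet> (w' - w) = (g a + p *\<^sub>R (a - z)) \<bullet> (a' - a) + ((1 / \<rho>) *\<^sub>R (b - \<mu>)) \<bullet> (b' - b)"
        by (simp_all add: \<phi>_def \<gamma>_def w)
      ultimately show ?thesis
        using prox_obj_lower[of z a a'] unfolding n distrib_left by linarith
    qed
  qed
  then obtain a b v where T: "T (a, b) = T (x0, \<mu>0)" and s: "\<gamma> (a, b) + Tt v = 0"
    by (metis surj_pair)
  have st: "g a + p *\<^sub>R (a - z) + Bt v = 0" and b: "(1 / \<rho>) *\<^sub>R (b - \<mu>) - A v = 0"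
    using s by (auto simp: \<gamma>_def Tt_def zero_prod_def)
  have "a = prox_min v z" by (rule stationary_unique[OF st prox_min_stationary])
  moreover have "b = \<mu> + \<rho> *\<^sub>R A v"
  proof -
    have "\<rho> *\<^sub>R A v = \<rho> *\<^sub>R ((1 / \<rho>) *\<^sub>R (b - \<mu>))" using b by (simp flip: eq_iff_diff_eq_0)
    then have "\<rho> *\<^sub>R A v = b - \<mu>" using rho by simp
    then show ?thesis by simp
  qed
  moreover have "B a - c = At b"
    using T x0 by (simp add: T_def algebra_simps)
  ultimately have "\<exists>y. B (prox_min y z) - c = At (\<mu> + \<rho> *\<^sub>R A y)" by blast
  then show ?thesis unfolding dual_solution_def by (rule someI_ex)
qed

definition prox_value :: "'a \<Rightarrow> 'c \<Rightarrow> real" where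
  "prox_value z \<mu> = - Lag (dual_solution z \<mu>) \<mu> z"

lemma strong_duality:
  assumes feasible
  defines "v \<equiv> (\<lambda>z \<mu>. dual_solution z \<mu>)"
  shows "prox_value z \<mu> = prox_obj z (prox_min (v z \<mu>) z) + \<rho> / 2 * (norm (A (v z \<mu>)))\<^sup>2"
proof -
  have "v z \<mu> \<bullet> (B (prox_min (v z \<mu>) z) - c) = A (v z \<mu>) \<bullet> (\<mu> + \<rho> *\<^sub>R A (v z \<mu>))"
    using dual_solution[OF assms(1), of z \<mu>] A_adj unfolding v_def by simp
  then show ?thesis
    unfolding prox_value_def Lag_def neg_dual_def v_def[symmetric]
    by (simp add: v_def inner_add_right inner_commute power2_norm_eq_inner)
qed

lemma prox_value_ge:
  assumes feasible
  shows "- Lag y \<mu> z \<le> prox_value z \<mu>"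
  using weak_duality[OF dual_solution[OF assms, of z \<mu>], of y \<mu> z] rho
  unfolding strong_duality[OF assms] by (simp add: power2_eq_square mult_ac)

text \<open>The dual solution for the new multiplier is a competitor in the dual problem for the old
  one. The estimate thus involves the dual solution at \<open>\<mu>'\<close>, to which
  \<open>dual_error_bound\<close> compares the next \<open>y\<close>.\<close>

lemma prox_value_change_multiplier:
  assumes feasible
  shows "prox_value z \<mu>' - prox_value z \<mu> \<le> - ((\<mu>' - \<mu>) \<bullet> A (dual_solution z \<mu>'))"
  using prox_value_ge[OF assms, of "dual_solution z \<mu>'" \<mu> z]
  unfolding prox_value_def[of z \<mu>'] Lag_def by (simp add: inner_diff_left)

text \<open>Here the competitor is primal: moving the centre leaves the constraint unchanged, so the
  old solution stays admissible.\<close>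

lemma prox_value_change_center:
  assumes feasible
  shows "prox_value z' \<mu> - prox_value z \<mu> \<le> prox_obj z' (prox_min (dual_solution z \<mu>) z) - prox_obj z (prox_min (dual_solution z \<mu>) z)"
proof -
  let ?v = "dual_solution z \<mu>"
  have "prox_value z' \<mu> \<le> prox_obj z' (prox_min ?v z) + (norm (\<mu> + \<rho> *\<^sub>R A ?v - \<mu>))\<^sup>2 / (2 * \<rho>)"
    unfolding prox_value_def[of z'] by (rule weak_duality[OF dual_solution[OF assms]])
  then show ?thesis unfolding strong_duality[OF assms] using rho by (simp add: power2_eq_square mult_ac)
qed

lemma prox_min_lipschitz_center:
  assumes "p > 0"
  shows "norm (prox_min y z' - prox_min y z) \<le> p / (p + gm) * norm (z' - z)"
proof -
  let ?x' = "prox_min y z'" and ?x = "prox_min y z"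
  have "g ?x' + p *\<^sub>R (?x' - z) - (g ?x + p *\<^sub>R (?x - z)) = p *\<^sub>R (z' - z)"
  proof -
    have e: "g ?x' = - Bt y - p *\<^sub>R (?x' - z')" "g ?x = - Bt y - p *\<^sub>R (?x - z)"
      using prox_min_stationary[of y z] prox_min_stationary[of y z'] by (simp_all add: eq_diff_eq eq_neg_iff_add_eq_0)
    show ?thesis unfolding e by (simp add: algebra_simps)
  qed
  then have "(p + gm) * (norm (?x' - ?x))\<^sup>2 \<le> p * ((z' - z) \<bullet> (?x' - ?x))"
    using grad_prox_obj_strongly_monotone[of ?x' ?x z] by simp
  also have "\<dots> \<le> p * (norm (z' - z) * norm (?x' - ?x))"
    using assms by (intro mult_left_mono norm_cauchy_schwarz) auto
  finally have "norm (?x' - ?x) * ((p + gm) * norm (?x' - ?x)) \<le> norm (?x' - ?x) * (p * norm (z' - z))"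
    by (simp add: power2_eq_square mult_ac)
  then have "(p + gm) * norm (?x' - ?x) \<le> p * norm (z' - z)"
    using assms by (cases "?x' = ?x") auto
  then show ?thesis using curvature by (simp add: field_simps)
qed

lemma prox_obj_change_center:
  "prox_obj z' x - prox_obj z x = - (p * ((x - z) \<bullet> (z' - z))) + p / 2 * (norm (z' - z))\<^sup>2"
  unfolding prox_obj_def power2_norm_eq_inner by (simp add: inner_simps inner_commute field_simps)

text \<open>The minimiser for the new centre is tested at the old one; replacing it by the old
  minimiser costs its Lipschitz constant \<open>p / (p + gm)\<close>, while the expansion of the
  square contributes -1/2.\<close>

lemma neg_dual_change_center:
  assumes "p > 0"
  shows "neg_dual y z' - neg_dual y z \<le> p * ((prox_min y z - z) \<bullet> (z' - z)) + p * (p / (p + gm) - 1 / 2) * (norm (z' - z))\<^sup>2"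
proof -
  let ?x' = "prox_min y z'" and ?x = "prox_min y z"
  have "neg_dual y z' - neg_dual y z \<le> - (prox_obj z' ?x' - prox_obj z ?x')"
    using neg_dual_ge[of z ?x' y] by (simp add: neg_dual_def[of y z'])
  also have "\<dots> = p * ((?x - z) \<bullet> (z' - z)) + p * ((?x' - ?x) \<bullet> (z' - z)) - p / 2 * (norm (z' - z))\<^sup>2"
    unfolding prox_obj_change_center by (simp add: inner_simps algebra_simps)
  also have "(?x' - ?x) \<bullet> (z' - z) \<le> p / (p + gm) * (norm (z' - z))\<^sup>2"
  proof -
    have "(?x' - ?x) \<bullet> (z' - z) \<le> norm (?x' - ?x) * norm (z' - z)" by (rule norm_cauchy_schwarz)
    also have "\<dots> \<le> (p / (p + gm) * norm (z' - z)) * norm (z' - z)"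
      by (intro mult_right_mono prox_min_lipschitz_center assms) simp
    finally show ?thesis by (simp add: power2_eq_square mult_ac)
  qed
  finally show ?thesis using assms by (simp add: algebra_simps)
qed

end

section \<open>The iteration and its Lyapunov functions\<close>

text \<open>\<open>y_step\<close> says that the gradient of \<open>Lag\<close> at the new
  \<open>y\<close> is \<open>- \<rho> Lp (y' - y)\<close>: an implicit step in the metric of
  \<open>\<rho> Lp\<close>. \<open>Lp_bound\<close> makes this metric positive semidefinite,
  possibly degenerate.\<close>

locale pdc_iteration = coupled_problem f g gm gp B Bt A At c p \<rho>
  for f :: "'a::euclidean_space \<Rightarrow> real" and g gm gp
    and B :: "'a \<Rightarrow> 'b::euclidean_space" and Bt and A :: "'b \<Rightarrow> 'c::euclidean_space" and At c p \<rho> +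
  fixes Lp :: "'b \<Rightarrow> 'b" and cl \<alpha> \<beta> :: real
    and x z :: "nat \<Rightarrow> 'a" and y :: "nat \<Rightarrow> 'b" and mu :: "nat \<Rightarrow> 'c"
  assumes Lp_lin: "linear Lp" and Lp_sym: "Lp u \<bullet> v = u \<bullet> Lp v"
    and Lp_bound: "(norm (Lp v))\<^sup>2 \<le> cl * (v \<bullet> Lp v)" and cl: "cl > 0"
    and steps: "0 < \<alpha>" "\<alpha> \<le> \<rho> / 5" "0 < \<beta>" "\<beta> < 1"
    and mu_step: "mu (Suc r) = mu r + \<alpha> *\<^sub>R A (y r)"
    and x_step: "g (x (Suc r)) + p *\<^sub>R (x (Suc r) - z r) + Bt (y (Suc r)) = 0"
    and y_step: "B (x (Suc r)) - c - At (mu (Suc r) + \<rho> *\<^sub>R A (y (Suc r))) = \<rho> *\<^sub>R Lp (y (Suc r) - y r)"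
    and z_step: "z (Suc r) = z r + \<beta> *\<^sub>R (x (Suc r) - z r)"
begin

definition step_energy :: "nat \<Rightarrow> real" where
  "step_energy r = (y (Suc r) - y r) \<bullet> Lp (y (Suc r) - y r)"

text \<open>The three defects of the KKT system: distance to the centre, perturbation of the
  coupling constraint, and disagreement of the dual blocks.\<close>

definition residual :: "nat \<Rightarrow> real" where
  "residual r = (norm (x (Suc r) - z r))\<^sup>2 + (norm (Lp (y (Suc r) - y r)))\<^sup>2 + (norm (A (y (Suc r))))\<^sup>2"

lemma residual_nonneg: "residual r \<ge> 0"
  by (simp add: residual_def)

lemma Lp_nonneg: "v \<bullet> Lp v \<ge> 0"
  using Lp_bound[of v] cl by (smt (verit) zero_le_mult_iff zero_le_power2)

lemma step_energy_nonneg: "step_energy r \<ge> 0"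
  by (simp add: step_energy_def Lp_nonneg)

lemma norm_Lp_step: "(norm (Lp (y (Suc r) - y r)))\<^sup>2 \<le> cl * step_energy r"
  unfolding step_energy_def by (rule Lp_bound)

lemma x_eq_prox_min: "x (Suc r) = prox_min (y (Suc r)) (z r)"
  by (rule stationary_unique[OF x_step prox_min_stationary])

text \<open>The iterate solves the proximal problem with the right-hand side of the constraint perturbed by
  \<open>\<rho> L\<^sup>+ (y\<^sup>r\<^sup>+\<^sup>1 - y\<^sup>r)\<close>. By cocoercivity the perturbation controls the error without any condition number of
  \<open>f\<close>, which is what the step size rule for \<open>\<alpha>\<close> requires.\<close>

lemma dual_error_bound:
  fixes r
  defines "v \<equiv> dual_solution (z r) (mu (Suc r))"
  assumes feasible and gp: "p + gp > 0"
    and \<theta>: "\<And>u e v. (v \<bullet> (B u - At e))\<^sup>2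
        \<le> \<theta>\<^sup>2 * (norm (B u - At e))\<^sup>2 * ((norm (Bt v))\<^sup>2 + (norm (A v))\<^sup>2)"
  shows "(p + gm) * (norm (x (Suc r) - prox_min v (z r)))\<^sup>2 \<le> \<theta>\<^sup>2 * cl * \<rho> * (\<rho> * (p + gp) + 1) * step_energy r"
    and "\<rho> * (norm (A (y (Suc r) - v)))\<^sup>2 \<le> \<theta>\<^sup>2 * cl * \<rho> * (\<rho> * (p + gp) + 1) * step_energy r"
proof -
  define x' y' where "x' = x (Suc r)" and "y' = y (Suc r)"
  define xh where "xh = prox_min v (z r)"
  define s where "s = \<rho> *\<^sub>R Lp (y' - y r)"
  \<comment> \<open>The duality pairing of the dual error with the perturbation; it is a sum of two
    nonnegative terms which dominate the two squared errors to be bounded.\<close>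
  define T where "T = - ((y' - v) \<bullet> s)"
  define d where "d = (g x' + p *\<^sub>R (x' - z r)) - (g xh + p *\<^sub>R (xh - z r))"
  have s: "s = B (x' - xh) - At (\<rho> *\<^sub>R A (y' - v))"
    using y_step[of r] dual_solution[OF assms(2), of "z r" "mu (Suc r)"] lin
    unfolding s_def x'_def y'_def xh_def v_def[symmetric]
    by (simp add: linear_diff linear_add linear_scale algebra_simps)
  have d_eq: "d = - Bt (y' - v)"
  proof -
    have "g x' + p *\<^sub>R (x' - z r) = - Bt y'" "g xh + p *\<^sub>R (xh - z r) = - Bt v"
      using x_step[of r] prox_min_stationary[of v "z r"] unfolding x'_def y'_def xh_def
      by (simp_all add: eq_neg_iff_add_eq_0)
    then show ?thesis unfolding d_def using lin by (simp add: linear_diff)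
  qed
  have T: "T = d \<bullet> (x' - xh) + \<rho> * (norm (A (y' - v)))\<^sup>2"
  proof -
    have "(y' - v) \<bullet> B (x' - xh) = - (d \<bullet> (x' - xh))"
      using B_adj[of "x' - xh" "y' - v"] by (simp add: d_eq inner_commute)
    moreover have "(y' - v) \<bullet> At (\<rho> *\<^sub>R A (y' - v)) = \<rho> * (norm (A (y' - v)))\<^sup>2"
      using A_adj[of "y' - v" "\<rho> *\<^sub>R A (y' - v)"] by (simp add: power2_norm_eq_inner)
    ultimately show ?thesis unfolding T_def s by (simp add: inner_diff_right)
  qed
  have mono: "d \<bullet> (x' - xh) \<ge> (p + gm) * (norm (x' - xh))\<^sup>2"
    unfolding d_def by (rule grad_prox_obj_strongly_monotone)
  have coc: "(norm (Bt (y' - v)))\<^sup>2 \<le> (p + gp) * (d \<bullet> (x' - xh))"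
    using grad_prox_obj_cocoercive[OF gp, of x' "z r" xh] d_eq unfolding d_def by simp
  have nn: "(p + gm) * (norm (x' - xh))\<^sup>2 \<ge> 0" "\<rho> * (norm (A (y' - v)))\<^sup>2 \<ge> 0"
    using curvature rho by simp_all
  have T0: "T \<ge> 0" using T mono nn by linarith
  have bt: "(norm (Bt (y' - v)))\<^sup>2 + (norm (A (y' - v)))\<^sup>2 \<le> (p + gp + 1 / \<rho>) * T"
  proof -
    have "(p + gp) * (d \<bullet> (x' - xh)) \<le> (p + gp) * T"
      using gp T nn by (intro mult_left_mono) auto
    moreover have "(norm (A (y' - v)))\<^sup>2 \<le> (1 / \<rho>) * T"
      using T mono nn rho by (simp add: field_simps)
    ultimately show ?thesis using coc by (simp add: distrib_right)
  qed
  \<comment> \<open>The hypothesis on \<open>\<theta>\<close> bounds \<open>T\<close> squared by a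
    quantity which \<open>bt\<close> bounds by a multiple of \<open>T\<close>, so one factor
    \<open>T\<close> cancels.\<close>
  have "T * T \<le> (\<theta>\<^sup>2 * (norm s)\<^sup>2 * (p + gp + 1 / \<rho>)) * T"
  proof -
    have "T * T = ((y' - v) \<bullet> s)\<^sup>2" by (simp add: T_def power2_eq_square)
    also have "\<dots> \<le> \<theta>\<^sup>2 * (norm s)\<^sup>2 * ((norm (Bt (y' - v)))\<^sup>2 + (norm (A (y' - v)))\<^sup>2)"
      unfolding s by (rule \<theta>)
    also have "\<dots> \<le> \<theta>\<^sup>2 * (norm s)\<^sup>2 * ((p + gp + 1 / \<rho>) * T)"
      by (intro mult_left_mono bt) auto
    finally show ?thesis by (simp add: mult_ac)
  qed
  then have "T \<le> \<theta>\<^sup>2 * (norm s)\<^sup>2 * (p + gp + 1 / \<rho>)"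
    using T0 gp rho by (cases "T = 0") auto
  also have "\<dots> \<le> \<theta>\<^sup>2 * (\<rho>\<^sup>2 * (cl * step_energy r)) * (p + gp + 1 / \<rho>)"
    using norm_Lp_step[of r] gp rho
    by (intro mult_right_mono mult_left_mono) (auto simp: s_def y'_def power_mult_distrib)
  also have "\<dots> = \<theta>\<^sup>2 * cl * \<rho> * (\<rho> * (p + gp) + 1) * step_energy r"
    using rho by (simp add: field_simps power2_eq_square)
  finally have "T \<le> \<theta>\<^sup>2 * cl * \<rho> * (\<rho> * (p + gp) + 1) * step_energy r" .
  then show "(p + gm) * (norm (x (Suc r) - prox_min v (z r)))\<^sup>2 \<le> \<theta>\<^sup>2 * cl * \<rho> * (\<rho> * (p + gp) + 1) * step_energy r"
    and "\<rho> * (norm (A (y (Suc r) - v)))\<^sup>2 \<le> \<theta>\<^sup>2 * cl * \<rho> * (\<rho> * (p + gp) + 1) * step_energy r"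
    using T mono nn unfolding x'_def y'_def xh_def by linarith+
qed

text \<open>This is the proximal value plus the duality gap \<open>prox_value + Lag\<close> of the current dual iterate.\<close>

definition potential :: "nat \<Rightarrow> real" where
  "potential r = 2 * prox_value (z r) (mu r) + Lag (y r) (mu r) (z r)"

lemma potential_ge: "feasible \<Longrightarrow> potential r \<ge> prox_value (z r) (mu r)"
  using prox_value_ge[of "y r" "mu r" "z r"] by (simp add: potential_def)

text \<open>Convexity of \<open>Lag\<close> from the new point towards the old one, with the
  subgradient read off from \<open>y_step\<close>, gives the full factor \<open>\<rho>\<close>; the
  quadratic part of \<open>Lag\<close> adds the last term.\<close>

lemma dual_step_descent:
  "Lag (y (Suc r)) (mu (Suc r)) (z r)
    \<le> Lag (y r) (mu (Suc r)) (z r) - \<rho> * step_energy r - \<rho> / 2 * (norm (A (y (Suc r) - y r)))\<^sup>2"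
proof -
  define x' y' m' d where "x' = x (Suc r)" and "y' = y (Suc r)" and "m' = mu (Suc r)" and "d = y' - y r"
  have "neg_dual (y r) (z r) \<ge> neg_dual y' (z r) + d \<bullet> (B x' - c)"
  proof -
    have "neg_dual y' (z r) = - (prox_obj (z r) x' + y' \<bullet> (B x' - c))"
      unfolding neg_dual_def x'_def y'_def x_eq_prox_min ..
    then show ?thesis
      using neg_dual_ge[of "z r" x' "y r"] by (simp add: d_def inner_diff_left)
  qed
  moreover have "d \<bullet> (B x' - c) = A d \<bullet> m' + \<rho> * (A d \<bullet> A y') + \<rho> * step_energy r"
  proof -
    have "B x' - c = At (m' + \<rho> *\<^sub>R A y') + \<rho> *\<^sub>R Lp d"
      using y_step[of r] by (simp add: x'_def m'_def y'_def d_def algebra_simps)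
    then show ?thesis
      using A_adj[of d "m' + \<rho> *\<^sub>R A y'"] by (simp add: inner_add_right step_energy_def d_def y'_def)
  qed
  moreover have "\<rho> / 2 * (norm (A (y r)))\<^sup>2
      = \<rho> / 2 * (norm (A y'))\<^sup>2 - \<rho> * (A d \<bullet> A y') + \<rho> / 2 * (norm (A d))\<^sup>2"
  proof -
    have e: "A (y r) = A y' - A d" using lin by (simp add: d_def linear_diff)
    show ?thesis
      unfolding e by (simp add: power2_norm_eq_inner inner_diff_left inner_diff_right inner_commute algebra_simps)
  qed
  moreover have "m' \<bullet> A (y r) = m' \<bullet> A y' - A d \<bullet> m'"
    using lin by (simp add: d_def linear_diff inner_diff_right inner_diff_left inner_commute)
  ultimately show ?thesis
    unfolding Lag_def x'_def[symmetric] y'_def[symmetric] m'_def[symmetric] d_def[symmetric]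
    by linarith
qed

text \<open>This explains the weight 2 in \<open>potential\<close>. In the multiplier step
  \<open>Lag\<close> rises by the square of \<open>A (y r)\<close> while the value falls with
  \<open>A (y r) \<bullet> A v\<close>; twice the latter completes the square. In the centre step
  twice the decrease of the value beats the equally large first-order increase of
  \<open>Lag\<close>.\<close>

lemma potential_step:
  fixes r
  defines "v \<equiv> dual_solution (z r) (mu (Suc r))"
  assumes feasible "p > 0"
  shows "potential (Suc r) \<le> potential r
      + \<alpha> * (norm (A (y r - v)))\<^sup>2 - \<alpha> * (norm (A v))\<^sup>2
      - \<rho> * step_energy r - \<rho> / 2 * (norm (A (y (Suc r) - y r)))\<^sup>2
      - p * \<beta> * (1 - \<beta> * (p / (p + gm) + 1 / 2)) * (norm (x (Suc r) - z r))\<^sup>2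
      + 2 * p * \<beta> * (norm (x (Suc r) - prox_min v (z r)) * norm (x (Suc r) - z r))"
proof -
  define x' y' z' m' where "x' = x (Suc r)" and "y' = y (Suc r)" and "z' = z (Suc r)" and "m' = mu (Suc r)"
  define xh u where "xh = prox_min v (z r)" and "u = x' - z r"
  have z': "z' - z r = \<beta> *\<^sub>R u" by (simp add: z'_def z_step u_def x'_def)
  have 1: "Lag (y r) m' (z r) - Lag (y r) (mu r) (z r) = \<alpha> * (norm (A (y r)))\<^sup>2"
    by (simp add: Lag_def m'_def mu_step inner_add_left power2_norm_eq_inner)
  have 2: "prox_value (z r) m' - prox_value (z r) (mu r) \<le> - (\<alpha> * (A (y r) \<bullet> A v))"
    using prox_value_change_multiplier[OF assms(2), of "z r" m' "mu r"]
    unfolding m'_def v_def by (simp add: mu_step)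
  have 12: "\<alpha> * (norm (A (y r)))\<^sup>2 - 2 * (\<alpha> * (A (y r) \<bullet> A v))
      = \<alpha> * (norm (A (y r - v)))\<^sup>2 - \<alpha> * (norm (A v))\<^sup>2"
    using lin by (simp add: linear_diff power2_norm_eq_inner inner_diff_left inner_diff_right inner_commute algebra_simps)
  have 3: "Lag y' m' (z r) \<le> Lag (y r) m' (z r) - \<rho> * step_energy r - \<rho> / 2 * (norm (A (y' - y r)))\<^sup>2"
    unfolding y'_def m'_def by (rule dual_step_descent)
  have 4: "Lag y' m' z' - Lag y' m' (z r)
      \<le> p * \<beta> * (norm u)\<^sup>2 + p * (p / (p + gm) - 1 / 2) * \<beta>\<^sup>2 * (norm u)\<^sup>2"
    using neg_dual_change_center[OF assms(3), of y' z' "z r"] x_eq_prox_min[of r]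
    unfolding Lag_def z' x'_def[symmetric] y'_def[symmetric] u_def
    by (simp add: power_mult_distrib power2_norm_eq_inner[symmetric] mult_ac)
  have 5: "prox_value z' m' - prox_value (z r) m' \<le> - (p * (\<beta> * ((xh - z r) \<bullet> u))) + p / 2 * (\<beta>\<^sup>2 * (norm u)\<^sup>2)"
    using prox_value_change_center[OF assms(2), of z' m' "z r"]
    unfolding prox_obj_change_center z' xh_def v_def m'_def[symmetric] by (simp add: power_mult_distrib)
  have "(xh - z r) \<bullet> u = (norm u)\<^sup>2 - (x' - xh) \<bullet> u"
    by (simp add: u_def power2_norm_eq_inner inner_diff_left inner_diff_right)
  moreover have "(x' - xh) \<bullet> u \<le> norm (x' - xh) * norm u" by (rule norm_cauchy_schwarz)
  ultimately have "p * \<beta> * ((xh - z r) \<bullet> u) \<ge> p * \<beta> * ((norm u)\<^sup>2 - norm (x' - xh) * norm u)"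
    using assms(3) steps by (intro mult_left_mono) auto
  then have 6: "prox_value z' m' - prox_value (z r) m' \<le> - (p * \<beta> * (norm u)\<^sup>2) + p * \<beta> * (norm (x' - xh) * norm u)
      + p / 2 * (\<beta>\<^sup>2 * (norm u)\<^sup>2)"
    using 5 by (simp add: algebra_simps)
  define W where "W = p * \<beta> * (1 - \<beta> * (p / (p + gm) + 1 / 2)) * (norm u)\<^sup>2"
  have 7: "p * \<beta> * (norm u)\<^sup>2 + p * (p / (p + gm) - 1 / 2) * \<beta>\<^sup>2 * (norm u)\<^sup>2
     + 2 * (- (p * \<beta> * (norm u)\<^sup>2) + p / 2 * (\<beta>\<^sup>2 * (norm u)\<^sup>2))
     = - W"
    unfolding W_def by (simp add: algebra_simps power2_eq_square)
  have 8: "(Lag y' m' z' - Lag y' m' (z r)) + 2 * (prox_value z' m' - prox_value (z r) m')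
      \<le> (p * \<beta> * (norm u)\<^sup>2 + p * (p / (p + gm) - 1 / 2) * \<beta>\<^sup>2 * (norm u)\<^sup>2
     + 2 * (- (p * \<beta> * (norm u)\<^sup>2) + p / 2 * (\<beta>\<^sup>2 * (norm u)\<^sup>2)))
     + 2 * p * \<beta> * (norm (x' - xh) * norm u)"
    using 4 6 by argo
  have "2 * prox_value z' m' + Lag y' m' z' \<le> 2 * prox_value (z r) (mu r) + Lag (y r) (mu r) (z r)
      + \<alpha> * (norm (A (y r - v)))\<^sup>2 - \<alpha> * (norm (A v))\<^sup>2
      - \<rho> * step_energy r - \<rho> / 2 * (norm (A (y' - y r)))\<^sup>2 - W + 2 * p * \<beta> * (norm (x' - xh) * norm u)"
    using 1 2 3 8 12 unfolding 7 by argo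
  then show ?thesis
    unfolding potential_def W_def u_def xh_def x'_def y'_def z'_def m'_def .
qed

text \<open>The budget: half of \<open>\<rho> * step_energy r\<close> pays in equal parts for the
  dual and primal errors, which fixes the factors 8 and 20. Of the share 3/10 of the centre term,
  1/5 pays for the cross term and 1/10 remains. The bound \<open>\<alpha> <= \<rho> / 5\<close> lets
  the \<open>A\<close>-term of the dual step absorb \<open>A (y (Suc r) - y r)\<close>.\<close>

lemma potential_descent:
  assumes feasible "p > 0" "p + gp > 0"
    and \<theta>: "\<And>u e v. (v \<bullet> (B u - At e))\<^sup>2
        \<le> \<theta>\<^sup>2 * (norm (B u - At e))\<^sup>2 * ((norm (Bt v))\<^sup>2 + (norm (A v))\<^sup>2)"
    and \<alpha>: "8 * \<theta>\<^sup>2 * cl * (\<rho> * (p + gp) + 1) * \<alpha> \<le> \<rho>"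
    and \<beta>: "20 * p * \<beta> * \<theta>\<^sup>2 * cl * (\<rho> * (p + gp) + 1) \<le> p + gm"
    and \<beta>': "1 - \<beta> * (p / (p + gm) + 1 / 2) \<ge> 3 / 10"
  shows "\<exists>\<kappa>>0. \<forall>r. potential (Suc r) \<le> potential r - \<kappa> * residual r"
proof -
  define D where "D = \<theta>\<^sup>2 * cl * \<rho> * (\<rho> * (p + gp) + 1)"
  have "D \<ge> 0" unfolding D_def using rho cl assms(3) by (intro mult_nonneg_nonneg) auto
  then have D: "8 * D * \<alpha> \<le> \<rho>\<^sup>2" "20 * p * \<beta> * D \<le> (p + gm) * \<rho>" "D \<ge> 0"
    using mult_right_mono[OF \<alpha>, of \<rho>] mult_right_mono[OF \<beta>, of \<rho>] rho
    by (simp_all add: D_def power2_eq_square mult_ac)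
  \<comment> \<open>\<open>2 * D / \<rho>\<close> stems from splitting \<open>A (y (Suc r))\<close>
    at \<open>A v\<close>, and \<open>cl\<close> from \<open>Lp_bound\<close>.\<close>
  define C where "C = 2 * D / \<rho> + cl"
  have C: "C > 0" using D(3) rho cl by (simp add: C_def add_nonneg_pos)
  have step: "potential (Suc r) \<le> potential r - \<alpha> * (norm (A v))\<^sup>2 - \<rho> / 2 * step_energy r
        - p * \<beta> / 10 * (norm (x (Suc r) - z r))\<^sup>2"
    and res: "residual r \<le> (norm (x (Suc r) - z r))\<^sup>2 + C * step_energy r + 2 * (norm (A v))\<^sup>2"
    if v: "v = dual_solution (z r) (mu (Suc r))" for r v
  proof -
    define a where "a = norm (x (Suc r) - prox_min v (z r))"
    define u where "u = norm (x (Suc r) - z r)"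
    define e where "e = norm (A (y (Suc r) - v))"
    have ea: "(p + gm) * a\<^sup>2 \<le> D * step_energy r" "\<rho> * e\<^sup>2 \<le> D * step_energy r"
      using dual_error_bound[OF assms(1,3) \<theta>, of r] unfolding D_def a_def e_def v by auto
    have "norm (A (y r - v)) \<le> norm (A (y (Suc r) - y r)) + e"
    proof -
      have "A (y r - v) = A (y (Suc r) - v) - A (y (Suc r) - y r)" using lin by (simp add: linear_diff)
      then show ?thesis unfolding e_def by (metis add.commute norm_triangle_ineq4)
    qed
    then have "(norm (A (y r - v)))\<^sup>2 \<le> (norm (A (y (Suc r) - y r)) + e)\<^sup>2"
      by (intro power_mono) auto
    also have "\<dots> \<le> 2 * (norm (A (y (Suc r) - y r)))\<^sup>2 + 2 * e\<^sup>2"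
      using zero_le_power2[of "norm (A (y (Suc r) - y r)) - e"] by (simp add: power2_eq_square algebra_simps)
    finally have "\<alpha> * (norm (A (y r - v)))\<^sup>2 \<le> \<alpha> * (2 * (norm (A (y (Suc r) - y r)))\<^sup>2 + 2 * e\<^sup>2)"
      using steps by (intro mult_left_mono) auto
    then have 1: "\<alpha> * (norm (A (y r - v)))\<^sup>2 \<le> 2 * \<alpha> * (norm (A (y (Suc r) - y r)))\<^sup>2 + 2 * \<alpha> * e\<^sup>2"
      by (simp add: algebra_simps)
    have 2: "2 * \<alpha> * (norm (A (y (Suc r) - y r)))\<^sup>2 \<le> \<rho> / 2 * (norm (A (y (Suc r) - y r)))\<^sup>2"
      using steps rho by (intro mult_right_mono) auto
    have 3: "2 * \<alpha> * e\<^sup>2 \<le> \<rho> / 4 * step_energy r"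
    proof -
      have "8 * \<alpha> * (\<rho> * e\<^sup>2) \<le> 8 * \<alpha> * (D * step_energy r)" using ea steps by (intro mult_left_mono) auto
      also have "\<dots> \<le> \<rho>\<^sup>2 * step_energy r" using mult_right_mono[OF D(1) step_energy_nonneg[of r]] by (simp add: mult_ac)
      finally have "\<rho> * (8 * \<alpha> * e\<^sup>2) \<le> \<rho> * (\<rho> * step_energy r)" by (simp add: power2_eq_square mult_ac)
      then show ?thesis using rho by simp
    qed
    have 4: "5 * p * \<beta> * a\<^sup>2 \<le> \<rho> / 4 * step_energy r"
    proof -
      have "20 * p * \<beta> * ((p + gm) * a\<^sup>2) \<le> 20 * p * \<beta> * (D * step_energy r)"
        using ea steps assms by (intro mult_left_mono) auto
      also have "\<dots> \<le> (p + gm) * \<rho> * step_energy r"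
        using mult_right_mono[OF D(2) step_energy_nonneg[of r]] by (simp add: mult_ac)
      finally have "(p + gm) * (20 * p * \<beta> * a\<^sup>2) \<le> (p + gm) * (\<rho> * step_energy r)" by (simp only: mult_ac)
      then show ?thesis using curvature by simp
    qed
    have 5: "2 * p * \<beta> * (a * u) \<le> 5 * p * \<beta> * a\<^sup>2 + p * \<beta> / 5 * u\<^sup>2"
    proof -
      have "2 * (a * u) \<le> 5 * a\<^sup>2 + u\<^sup>2 / 5"
        using zero_le_power2[of "5 * a - u"] by (simp add: power2_eq_square algebra_simps)
      then have "(p * \<beta>) * (2 * (a * u)) \<le> (p * \<beta>) * (5 * a\<^sup>2 + u\<^sup>2 / 5)"
        using steps assms by (intro mult_left_mono) auto
      then show ?thesis by (simp add: algebra_simps)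
    qed
    have 6: "p * \<beta> * (1 - \<beta> * (p / (p + gm) + 1 / 2)) * u\<^sup>2 \<ge> p * \<beta> * (3 / 10) * u\<^sup>2"
      using \<beta>' steps assms by (intro mult_right_mono mult_left_mono) auto
    show "potential (Suc r) \<le> potential r - \<alpha> * (norm (A v))\<^sup>2 - \<rho> / 2 * step_energy r
        - p * \<beta> / 10 * (norm (x (Suc r) - z r))\<^sup>2"
      using potential_step[OF assms(1,2), of r] 1 2 3 4 5 6
      unfolding v[symmetric] a_def[symmetric] u_def[symmetric] by (simp add: field_simps)
    have "norm (A (y (Suc r))) \<le> e + norm (A v)"
    proof -
      have "A (y (Suc r)) = A (y (Suc r) - v) + A v" using lin by (simp add: linear_diff)
      then show ?thesis unfolding e_def by (metis norm_triangle_ineq)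
    qed
    then have "(norm (A (y (Suc r))))\<^sup>2 \<le> (e + norm (A v))\<^sup>2" by (intro power_mono) auto
    also have "\<dots> \<le> 2 * e\<^sup>2 + 2 * (norm (A v))\<^sup>2"
      using zero_le_power2[of "e - norm (A v)"] by (simp add: power2_eq_square algebra_simps)
    finally have "(norm (A (y (Suc r))))\<^sup>2 \<le> 2 * e\<^sup>2 + 2 * (norm (A v))\<^sup>2" .
    moreover have "e\<^sup>2 \<le> D / \<rho> * step_energy r" using ea(2) rho by (simp add: field_simps)
    ultimately show "residual r \<le> (norm (x (Suc r) - z r))\<^sup>2 + C * step_energy r + 2 * (norm (A v))\<^sup>2"
      using norm_Lp_step[of r] unfolding residual_def C_def by (simp add: distrib_right)
  qed
  define \<kappa> where "\<kappa> = min (\<alpha> / 2) (min (\<rho> / (2 * C)) (p * \<beta> / 10))"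
  have \<kappa>: "\<kappa> > 0" using steps rho C assms by (simp add: \<kappa>_def)
  have "potential (Suc r) \<le> potential r - \<kappa> * residual r" for r
  proof -
    define v where "v = dual_solution (z r) (mu (Suc r))"
    have "\<kappa> * residual r \<le> \<kappa> * ((norm (x (Suc r) - z r))\<^sup>2 + C * step_energy r + 2 * (norm (A v))\<^sup>2)"
      using \<kappa> res[OF v_def] by (intro mult_left_mono) auto
    moreover have "\<kappa> * (norm (x (Suc r) - z r))\<^sup>2 \<le> p * \<beta> / 10 * (norm (x (Suc r) - z r))\<^sup>2"
      by (intro mult_right_mono) (auto simp: \<kappa>_def)
    moreover have "\<kappa> * (C * step_energy r) \<le> \<rho> / 2 * step_energy r"
    proof -
      have "\<kappa> * C \<le> \<rho> / (2 * C) * C" using C by (intro mult_right_mono) (auto simp: \<kappa>_def)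
      then show ?thesis using C mult_right_mono[OF _ step_energy_nonneg[of r], of "\<kappa> * C" "\<rho> / 2"] by (simp add: mult_ac)
    qed
    moreover have "\<kappa> * (2 * (norm (A v))\<^sup>2) \<le> \<alpha> / 2 * (2 * (norm (A v))\<^sup>2)"
      by (intro mult_right_mono) (auto simp: \<kappa>_def)
    ultimately show ?thesis using step[OF v_def] by (simp add: distrib_left)
  qed
  then show ?thesis using \<kappa> by blast
qed

end

section \<open>Real sequences with sufficient descent\<close>

lemma bounded_below_of_subsequence_descent:
  fixes \<Phi> res :: "nat \<Rightarrow> real" and s :: "nat \<Rightarrow> nat"
  assumes desc: "\<And>r. \<Phi> (Suc r) \<le> \<Phi> r - \<kappa> * res r" and \<kappa>: "\<kappa> > 0" and nn: "\<And>r. res r \<ge> 0"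
    and s: "strict_mono s" and b: "\<And>k. \<Phi> (s k) \<ge> b"
  shows "\<Phi> r \<ge> b"
proof -
  have "decseq \<Phi>" using desc \<kappa> nn by (intro decseq_SucI) (smt (verit) mult_nonneg_nonneg)
  then have "\<Phi> (s r) \<le> \<Phi> r" using seq_suble[OF s, of r] by (simp add: decseq_def)
  then show ?thesis using b[of r] by linarith
qed

lemma descent_sum_bound:
  fixes \<Phi> res :: "nat \<Rightarrow> real"
  assumes desc: "\<And>r. \<Phi> (Suc r) \<le> \<Phi> r - \<kappa> * res r" and \<kappa>: "\<kappa> > 0" and b: "\<And>r. \<Phi> r \<ge> b"
  shows "(\<Sum>r<n. res r) \<le> (\<Phi> 0 - b) / \<kappa>"
proof -
  have "\<kappa> * (\<Sum>r<n. res r) \<le> \<Phi> 0 - \<Phi> n"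
  proof (induction n)
    case (Suc n)
    then show ?case using desc[of n] by (simp add: distrib_left)
  qed simp
  then show ?thesis using b[of n] \<kappa> by (simp add: field_simps)
qed

lemma descent_tendsto_zero:
  fixes \<Phi> res :: "nat \<Rightarrow> real"
  assumes "\<And>r. \<Phi> (Suc r) \<le> \<Phi> r - \<kappa> * res r" "\<kappa> > 0" "\<And>r. \<Phi> r \<ge> b" "\<And>r. res r \<ge> 0"
  shows "res \<longlonglongrightarrow> 0"
  by (rule summable_LIMSEQ_zero[OF summableI_nonneg_bounded[OF assms(4) descent_sum_bound[where \<Phi> = \<Phi> and res = res, OF assms(1-3)]]])

lemma descent_best_iterate:
  fixes \<Phi> res :: "nat \<Rightarrow> real"
  assumes "\<And>r. \<Phi> (Suc r) \<le> \<Phi> r - \<kappa> * res r" "\<kappa> > 0" "\<And>r. \<Phi> r \<ge> b" "n \<ge> 1"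
  shows "\<exists>t<n. res t \<le> (\<Phi> 0 - b) / \<kappa> / real n"
proof (rule ccontr)
  let ?C = "(\<Phi> 0 - b) / \<kappa>"
  assume "\<not> ?thesis"
  then have "(\<Sum>r<n. ?C / real n) < (\<Sum>r<n. res r)"
    using assms(4) by (intro sum_strict_mono) (auto simp: not_le lessThan_empty_iff)
  then show False using descent_sum_bound[where \<Phi> = \<Phi> and res = res, OF assms(1-3), of n] assms(4) by simp
qed

lemma norm_add_sq_le: "(norm (u + v))\<^sup>2 \<le> 2 * (norm u)\<^sup>2 + 2 * (norm v)\<^sup>2"
  for u v :: "'a::real_inner"
proof -
  have "(norm (u + v))\<^sup>2 + (norm (u - v))\<^sup>2 = 2 * (norm u)\<^sup>2 + 2 * (norm v)\<^sup>2"
    by (simp add: power2_norm_eq_inner inner_simps)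
  then show ?thesis by (smt (verit) zero_le_power2)
qed

lemma tendsto_zero_of_norm_sq_le:
  fixes h :: "nat \<Rightarrow> 'a::real_normed_vector"
  assumes "\<And>k. (norm (h k))\<^sup>2 \<le> e k" "e \<longlonglongrightarrow> 0"
  shows "h \<longlonglongrightarrow> 0"
proof -
  have "(\<lambda>k. (norm (h k))\<^sup>2) \<longlonglongrightarrow> 0"
    by (rule tendsto_sandwich[OF _ _ tendsto_const assms(2)]) (use assms(1) in auto)
  then show ?thesis
    using tendsto_real_sqrt[of "\<lambda>k. (norm (h k))\<^sup>2" 0] by (simp add: tendsto_norm_zero_iff)
qed

section \<open>Negative \<open>p\<close>, and the passage from the residual to the KKT
  conditions\<close>

context pdc_iteration
begin

text \<open>For \<open>p < 0\<close> the proximal value increases along the \<open>z\<close>-update, so \<open>potential\<close> is of no use; but then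
  \<open>f\<close> is strongly convex, and the weighted distance to a saddle point decreases instead.\<close>

definition saddle_distance :: "'a \<Rightarrow> 'b \<Rightarrow> 'c \<Rightarrow> nat \<Rightarrow> real" where
  "saddle_distance xs ys ms r = - p / \<beta> * (norm (z r - xs))\<^sup>2
     + \<rho> / 2 * ((y r - ys) \<bullet> Lp (y r - ys)) + 1 / (2 * \<alpha>) * (norm (mu (Suc r) - ms))\<^sup>2"

lemma saddle_distance_nonneg: "p < 0 \<Longrightarrow> saddle_distance xs ys ms r \<ge> 0"
  using steps rho Lp_nonneg unfolding saddle_distance_def
  by (intro add_nonneg_nonneg mult_nonneg_nonneg) (auto intro: divide_nonpos_pos)

text \<open>The weight \<open>- p / \<beta>\<close> cancels the \<open>\<beta>\<close> of the
  z-update; the other two weights make the cross terms with \<open>Lp D\<close> and with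
  \<open>m\<close> cancel. The multiplier is shifted to \<open>Suc r\<close> since that one enters
  the update to \<open>y (Suc r)\<close>. With \<open>a = - p\<close>, the concave proximal term
  costs \<open>3 / 2 * a\<close> and the z-update another \<open>a\<close>, which
  \<open>gm >= 6 a\<close> covers with room to spare.\<close>

lemma saddle_distance_descent:
  assumes p: "p < 0" and gm: "gm \<ge> - 6 * p"
    and saddle: "g xs + Bt ys = 0" "A ys = 0" "B xs - c = At ms"
  shows "\<exists>\<kappa>>0. \<forall>r. saddle_distance xs ys ms (Suc r) \<le> saddle_distance xs ys ms r - \<kappa> * residual r"
proof -
  define a where "a = - p"
  have a: "a > 0" "gm \<ge> 6 * a" using p gm by (auto simp: a_def)
  have step: "saddle_distance xs ys ms (Suc r) \<le> saddle_distance xs ys ms r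
      - (gm - 5 / 2 * a) * (norm (x (Suc r) - xs))\<^sup>2 - a / 2 * (norm (z r - xs))\<^sup>2
      - \<rho> / 2 * step_energy r - \<rho> / 2 * (norm (A (y (Suc r))))\<^sup>2" for r
  proof -
    define X Z Y Y' m D where "X = x (Suc r) - xs" and "Z = z r - xs" and "Y = y r - ys"
      and "Y' = y (Suc r) - ys" and "m = mu (Suc r) - ms" and "D = y (Suc r) - y r"
    have AY': "A Y' = A (y (Suc r))" using lin saddle by (simp add: Y'_def linear_diff)
    have mono: "gm * (norm X)\<^sup>2 \<le> (g (x (Suc r)) - g xs) \<bullet> X"
    proof -
      have "(norm (xs - x (Suc r)))\<^sup>2 = (norm X)\<^sup>2" by (simp add: X_def norm_minus_commute)
      moreover have "g (x (Suc r)) \<bullet> (xs - x (Suc r)) = - (g (x (Suc r)) \<bullet> X)"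
        by (simp add: X_def inner_diff_right)
      ultimately show ?thesis
        using f_lower[of xs "x (Suc r)"] f_lower[of "x (Suc r)" xs]
        by (simp add: X_def[symmetric] inner_diff_left)
    qed
    have gx: "g (x (Suc r)) - g xs = a *\<^sub>R (X - Z) - Bt Y'"
      using x_step[of r] saddle(1) lin unfolding a_def X_def Z_def Y'_def
      by (simp add: linear_diff algebra_simps)
    have BX: "B X = At (m + \<rho> *\<^sub>R A (y (Suc r))) + \<rho> *\<^sub>R Lp D"
      using y_step[of r] saddle(3) lin unfolding X_def m_def D_def
      by (simp add: linear_diff linear_add linear_scale algebra_simps)
    have YBX: "Y' \<bullet> B X = A (y (Suc r)) \<bullet> m + \<rho> * (norm (A (y (Suc r))))\<^sup>2 + \<rho> * (Y' \<bullet> Lp D)"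
      using A_adj[of Y' "m + \<rho> *\<^sub>R A (y (Suc r))"] unfolding BX AY'
      by (simp add: inner_add_right power2_norm_eq_inner)
    have key: "gm * (norm X)\<^sup>2 \<le> a * ((X - Z) \<bullet> X) - A (y (Suc r)) \<bullet> m
        - \<rho> * (norm (A (y (Suc r))))\<^sup>2 - \<rho> * (Y' \<bullet> Lp D)"
    proof -
      have "(g (x (Suc r)) - g xs) \<bullet> X = a * ((X - Z) \<bullet> X) - Y' \<bullet> B X"
        using B_adj[of X Y'] inner_commute[of Y' "B X"] inner_commute[of X "Bt Y'"]
        unfolding gx by (simp add: inner_diff_left)
      then show ?thesis using mono YBX by linarith
    qed
    have zz: "- p / \<beta> * (norm (z (Suc r) - xs))\<^sup>2 \<le> - p / \<beta> * (norm Z)\<^sup>2 - a * (norm Z)\<^sup>2 + a * (norm X)\<^sup>2"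
    proof -
      have e: "z (Suc r) - xs = (1 - \<beta>) *\<^sub>R Z + \<beta> *\<^sub>R X"
        unfolding z_step X_def Z_def by (simp add: algebra_simps)
      have "(norm (z (Suc r) - xs))\<^sup>2
          = (1 - \<beta>) * (norm Z)\<^sup>2 + \<beta> * (norm X)\<^sup>2 - \<beta> * (1 - \<beta>) * (norm (X - Z))\<^sup>2"
        unfolding e power2_norm_eq_inner inner_simps by (simp add: inner_commute algebra_simps)
      also have "\<dots> \<le> (1 - \<beta>) * (norm Z)\<^sup>2 + \<beta> * (norm X)\<^sup>2"
        using steps by simp
      finally have "a / \<beta> * (norm (z (Suc r) - xs))\<^sup>2 \<le> a / \<beta> * ((1 - \<beta>) * (norm Z)\<^sup>2 + \<beta> * (norm X)\<^sup>2)"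
        using a steps by (intro mult_left_mono) auto
      also have "\<dots> = a / \<beta> * (norm Z)\<^sup>2 - a * (norm Z)\<^sup>2 + a * (norm X)\<^sup>2"
        using steps by (simp add: field_simps)
      finally show ?thesis by (simp add: a_def)
    qed
    have xz: "a * ((X - Z) \<bullet> X) \<le> 3 / 2 * a * (norm X)\<^sup>2 + a / 2 * (norm Z)\<^sup>2"
    proof -
      have "0 \<le> a / 2 * (norm (X + Z))\<^sup>2" using a by simp
      also have "\<dots> = 3 / 2 * a * (norm X)\<^sup>2 + a / 2 * (norm Z)\<^sup>2 - a * ((X - Z) \<bullet> X)"
        by (simp add: power2_norm_eq_inner inner_simps inner_commute algebra_simps)
      finally show ?thesis by simp
    qed
    have LL: "Y' \<bullet> Lp Y' = Y \<bullet> Lp Y - step_energy r + 2 * (Y' \<bullet> Lp D)"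
    proof -
      have e: "Lp D = Lp Y' - Lp Y" "D = Y' - Y"
        using Lp_lin by (simp_all add: D_def Y'_def Y_def linear_diff)
      show ?thesis
        unfolding step_energy_def D_def[symmetric] e(1) unfolding e(2)
        using Lp_sym[of Y Y'] by (simp add: inner_diff_left inner_diff_right inner_commute)
    qed
    have mm: "1 / (2 * \<alpha>) * (norm (mu (Suc (Suc r)) - ms))\<^sup>2
        = 1 / (2 * \<alpha>) * (norm m)\<^sup>2 + A (y (Suc r)) \<bullet> m + \<alpha> / 2 * (norm (A (y (Suc r))))\<^sup>2"
    proof -
      have e: "mu (Suc (Suc r)) - ms = m + \<alpha> *\<^sub>R A (y (Suc r))" by (simp add: m_def mu_step)
      have "(norm (mu (Suc (Suc r)) - ms))\<^sup>2
          = (norm m)\<^sup>2 + 2 * \<alpha> * (A (y (Suc r)) \<bullet> m) + \<alpha>\<^sup>2 * (norm (A (y (Suc r))))\<^sup>2"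
        unfolding e power2_norm_eq_inner inner_simps
        by (simp add: inner_commute algebra_simps power2_eq_square)
      then show ?thesis using steps by (simp add: field_simps power2_eq_square)
    qed
    have al: "\<alpha> / 2 * (norm (A (y (Suc r))))\<^sup>2 \<le> \<rho> / 2 * (norm (A (y (Suc r))))\<^sup>2"
      using steps rho by (intro mult_right_mono) auto
    have LL': "\<rho> / 2 * (Y' \<bullet> Lp Y') = \<rho> / 2 * (Y \<bullet> Lp Y) - \<rho> / 2 * step_energy r + \<rho> * (Y' \<bullet> Lp D)"
      unfolding LL by (simp add: algebra_simps)
    have "(gm - 5 / 2 * a) * (norm X)\<^sup>2 = gm * (norm X)\<^sup>2 - 3 / 2 * a * (norm X)\<^sup>2 - a * (norm X)\<^sup>2"
      by (simp add: algebra_simps)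
    then show ?thesis
      using key zz xz LL' mm al
      unfolding saddle_distance_def X_def[symmetric] Y_def[symmetric] Y'_def[symmetric]
        Z_def[symmetric] m_def[symmetric] by argo
  qed
  define \<kappa> where "\<kappa> = min (a / 4) (min (\<rho> / (2 * cl)) (\<rho> / 2))"
  have \<kappa>: "\<kappa> > 0" using a rho cl by (simp add: \<kappa>_def)
  have "saddle_distance xs ys ms (Suc r) \<le> saddle_distance xs ys ms r - \<kappa> * residual r" for r
  proof -
    have "(norm (x (Suc r) - z r))\<^sup>2 \<le> 2 * (norm (x (Suc r) - xs))\<^sup>2 + 2 * (norm (z r - xs))\<^sup>2"
      using norm_add_sq_le[of "x (Suc r) - xs" "xs - z r"] by (simp add: norm_minus_commute)
    then have "\<kappa> * (norm (x (Suc r) - z r))\<^sup>2 \<le> \<kappa> * (2 * (norm (x (Suc r) - xs))\<^sup>2 + 2 * (norm (z r - xs))\<^sup>2)"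
      using \<kappa> by (intro mult_left_mono) auto
    also have "\<dots> \<le> a / 4 * (2 * (norm (x (Suc r) - xs))\<^sup>2 + 2 * (norm (z r - xs))\<^sup>2)"
      by (intro mult_right_mono) (auto simp: \<kappa>_def)
    finally have 1: "\<kappa> * (norm (x (Suc r) - z r))\<^sup>2 \<le> a / 2 * (norm (x (Suc r) - xs))\<^sup>2 + a / 2 * (norm (z r - xs))\<^sup>2"
      by argo
    have 2: "a / 2 * (norm (x (Suc r) - xs))\<^sup>2 \<le> (gm - 5 / 2 * a) * (norm (x (Suc r) - xs))\<^sup>2"
      using a by (intro mult_right_mono) auto
    have "\<kappa> * (norm (Lp (y (Suc r) - y r)))\<^sup>2 \<le> \<kappa> * (cl * step_energy r)"
      using \<kappa> norm_Lp_step by (intro mult_left_mono) auto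
    also have "\<dots> \<le> \<rho> / (2 * cl) * (cl * step_energy r)"
      using cl step_energy_nonneg by (intro mult_right_mono) (auto simp: \<kappa>_def)
    also have "\<dots> = \<rho> / 2 * step_energy r" using cl by simp
    finally have 3: "\<kappa> * (norm (Lp (y (Suc r) - y r)))\<^sup>2 \<le> \<rho> / 2 * step_energy r" .
    have 4: "\<kappa> * (norm (A (y (Suc r))))\<^sup>2 \<le> \<rho> / 2 * (norm (A (y (Suc r))))\<^sup>2"
      by (intro mult_right_mono) (auto simp: \<kappa>_def)
    have "\<kappa> * residual r = \<kappa> * (norm (x (Suc r) - z r))\<^sup>2 + \<kappa> * (norm (Lp (y (Suc r) - y r)))\<^sup>2
        + \<kappa> * (norm (A (y (Suc r))))\<^sup>2"
      by (simp add: residual_def distrib_left)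
    then show ?thesis using step[of r] 1 2 3 4 by linarith
  qed
  then show ?thesis using \<kappa> by blast
qed

text \<open>Testing against the kernel of \<open>A\<close> removes the multiplier; in the
  application this sums the constraint over the agents.\<close>

lemma constraint_defect:
  assumes "A e = 0"
  shows "e \<bullet> (B (x (Suc r)) - c) = \<rho> * (e \<bullet> Lp (y (Suc r) - y r))"
proof -
  have "B (x (Suc r)) - c = At (mu (Suc r) + \<rho> *\<^sub>R A (y (Suc r))) + \<rho> *\<^sub>R Lp (y (Suc r) - y r)"
    using y_step[of r] by (simp add: algebra_simps)
  then show ?thesis
    using A_adj[of e "mu (Suc r) + \<rho> *\<^sub>R A (y (Suc r))"] assms by (simp add: inner_add_right)
qed

lemma limit_point_stationary:
  assumes res: "residual \<longlonglongrightarrow> 0" and s: "strict_mono s"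
    and zs: "(\<lambda>k. z (s k)) \<longlonglongrightarrow> zs" and ys: "(\<lambda>k. y (s k)) \<longlonglongrightarrow> ys"
  shows "g zs + Bt ys = 0" and "A ys = 0" and "\<And>e. A e = 0 \<Longrightarrow> e \<bullet> (B zs - c) = 0"
proof -
  \<comment> \<open>\<open>residual r\<close> concerns the iterates with index \<open>Suc r\<close>,
    so the subsequence is shifted back by one; starting at \<open>s (Suc k)\<close> keeps the index
    positive.\<close>
  define t where "t = (\<lambda>k. s (Suc k) - 1)"
  have st: "s (Suc k) = Suc (t k)" for k
    using strict_mono_less[OF s, of k "Suc k"] unfolding t_def by simp
  have "strict_mono t"
    unfolding strict_mono_Suc_iff using st s by (metis Suc_less_SucD lessI strict_mono_less)
  then have res': "(\<lambda>k. residual (t k)) \<longlonglongrightarrow> 0"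
    using LIMSEQ_subseq_LIMSEQ[OF res] by (simp add: o_def)
  have u: "(\<lambda>k. x (Suc (t k)) - z (t k)) \<longlonglongrightarrow> 0"
    by (rule tendsto_zero_of_norm_sq_le[OF _ res']) (simp add: residual_def)
  have l: "(\<lambda>k. Lp (y (Suc (t k)) - y (t k))) \<longlonglongrightarrow> 0"
    by (rule tendsto_zero_of_norm_sq_le[OF _ res']) (simp add: residual_def)
  have a: "(\<lambda>k. A (y (Suc (t k)))) \<longlonglongrightarrow> 0"
    by (rule tendsto_zero_of_norm_sq_le[OF _ res']) (simp add: residual_def)
  have z': "(\<lambda>k. z (Suc (t k))) \<longlonglongrightarrow> zs" and y': "(\<lambda>k. y (Suc (t k))) \<longlonglongrightarrow> ys"
    using LIMSEQ_Suc[OF zs] LIMSEQ_Suc[OF ys] by (simp_all add: st)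
  \<comment> \<open>By the z-update this combination is \<open>x (Suc (t k))\<close>, so
    \<open>x\<close> inherits the limit of \<open>z\<close>.\<close>
  have "(\<lambda>k. z (Suc (t k)) + (1 - \<beta>) *\<^sub>R (x (Suc (t k)) - z (t k))) \<longlonglongrightarrow> zs + (1 - \<beta>) *\<^sub>R 0"
    by (intro tendsto_intros z' u)
  then have x': "(\<lambda>k. x (Suc (t k))) \<longlonglongrightarrow> zs"
    by (simp add: z_step algebra_simps)
  note bl = lin[unfolded linear_conv_bounded_linear]
  have "(\<lambda>k. g (x (Suc (t k))) + p *\<^sub>R (x (Suc (t k)) - z (t k)) + Bt (y (Suc (t k)))) \<longlonglongrightarrow> g zs + p *\<^sub>R 0 + Bt ys"
    by (intro tendsto_intros u bounded_linear.tendsto[OF bl(2)] y' continuous_on_tendsto_compose[OF g_cont x']) auto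
  then show "g zs + Bt ys = 0" by (simp add: x_step LIMSEQ_const_iff)
  show "A ys = 0"
    using LIMSEQ_unique[OF a bounded_linear.tendsto[OF bl(3) y']] by simp
  show "e \<bullet> (B zs - c) = 0" if e: "A e = 0" for e
  proof -
    have "(\<lambda>k. e \<bullet> (B (x (Suc (t k))) - c)) \<longlonglongrightarrow> e \<bullet> (B zs - c)"
      by (intro tendsto_intros bounded_linear.tendsto[OF bl(1)] x')
    moreover have "(\<lambda>k. \<rho> * (e \<bullet> Lp (y (Suc (t k)) - y (t k)))) \<longlonglongrightarrow> \<rho> * (e \<bullet> 0)"
      by (intro tendsto_intros l)
    ultimately show ?thesis
      unfolding constraint_defect[OF e] using LIMSEQ_unique by fastforce
  qed
qed

text \<open>The dual blocks of an iterate need not agree, so \<open>y (Suc r)\<close> is moved into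
  the kernel of \<open>A\<close> by a correction of size proportional to
  \<open>norm (A (y (Suc r)))\<close>; replacing \<open>x (Suc r)\<close> by \<open>z r\<close>
  costs Lipschitz constants.\<close>

lemma residual_controls_KKT:
  obtains C where "C > 0"
    "\<And>r. \<exists>e. A e = 0 \<and> (norm (g (z r) + Bt e))\<^sup>2 \<le> C * residual r"
    "\<And>r e. A e = 0 \<Longrightarrow> (e \<bullet> (B (z r) - c))\<^sup>2 \<le> (norm e)\<^sup>2 * (C * residual r)"
proof -
  obtain h \<theta> where h: "linear h" "\<theta> > 0" "\<And>u. A (h (A u)) = A u" "\<And>s. norm (h s) \<le> \<theta> * norm s"
    using linear_bounded_right_inverse_on_range[OF lin(3)] by blast
  obtain b where b: "b > 0" "\<And>u. norm (B u) \<le> b * norm u" using linear_bounded_pos[OF lin(1)] by blast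
  obtain b' where b': "b' > 0" "\<And>u. norm (Bt u) \<le> b' * norm u" using linear_bounded_pos[OF lin(2)] by blast
  define k where "k = gp + \<bar>p\<bar>"
  define C where "C = 2 * k\<^sup>2 + 2 * (b' * \<theta>)\<^sup>2 + 2 * b\<^sup>2 + 2 * \<rho>\<^sup>2"
  have C: "C > 0" unfolding C_def using b(1) by (simp add: add_nonneg_pos add_pos_nonneg)
  have sq: "(norm v)\<^sup>2 \<le> c1\<^sup>2 * (norm w)\<^sup>2" if "norm v \<le> c1 * norm w"
    for c1 and v :: "'d::real_normed_vector" and w :: "'e::real_normed_vector"
    using power_mono[OF that, of 2] by (simp add: power_mult_distrib)
  have 1: "\<exists>e. A e = 0 \<and> (norm (g (z r) + Bt e))\<^sup>2 \<le> C * residual r" for r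
  proof (intro exI conjI)
    define n where "n = h (A (y (Suc r)))"
    define e where "e = y (Suc r) - n"
    define u where "u = x (Suc r) - z r"
    show "A e = 0" using h(3) lin by (simp add: e_def n_def linear_diff)
    have eq: "g (z r) + Bt e = (g (z r) - g (x (Suc r)) - p *\<^sub>R u) + - Bt n"
      using x_step[of r] lin unfolding e_def u_def
      by (simp add: linear_diff algebra_simps)
    have "(norm (g (z r) + Bt e))\<^sup>2 \<le> 2 * (norm (g (z r) - g (x (Suc r)) - p *\<^sub>R u))\<^sup>2 + 2 * (norm (Bt n))\<^sup>2"
      using norm_add_sq_le[of "g (z r) - g (x (Suc r)) - p *\<^sub>R u" "- Bt n"]
      unfolding eq norm_minus_cancel .
    moreover have "norm (g (z r) - g (x (Suc r)) - p *\<^sub>R u) \<le> k * norm u"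
    proof -
      have "norm (g (z r) - g (x (Suc r)) - p *\<^sub>R u) \<le> norm (g (z r) - g (x (Suc r))) + norm (p *\<^sub>R u)"
        by (rule norm_triangle_ineq4)
      also have "\<dots> \<le> gp * norm u + \<bar>p\<bar> * norm u"
        using g_lip[of "z r" "x (Suc r)"] by (simp add: u_def norm_minus_commute)
      finally show ?thesis by (simp add: k_def distrib_right)
    qed
    then have "(norm (g (z r) - g (x (Suc r)) - p *\<^sub>R u))\<^sup>2 \<le> k\<^sup>2 * (norm u)\<^sup>2" by (rule sq)
    moreover have "norm (Bt n) \<le> (b' * \<theta>) * norm (A (y (Suc r)))"
    proof -
      have "b' * norm n \<le> b' * (\<theta> * norm (A (y (Suc r))))"
        unfolding n_def using h(4) b'(1) by (intro mult_left_mono) auto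
      then show ?thesis using b'(2)[of n] by (simp add: mult_ac)
    qed
    then have "(norm (Bt n))\<^sup>2 \<le> (b' * \<theta>)\<^sup>2 * (norm (A (y (Suc r))))\<^sup>2" by (rule sq)
    moreover have "(2 * k\<^sup>2) * (norm u)\<^sup>2 \<le> (2 * k\<^sup>2) * residual r"
      "(2 * (b' * \<theta>)\<^sup>2) * (norm (A (y (Suc r))))\<^sup>2 \<le> (2 * (b' * \<theta>)\<^sup>2) * residual r"
      by (intro mult_left_mono; simp add: residual_def u_def)+
    moreover have "0 \<le> (2 * b\<^sup>2 + 2 * \<rho>\<^sup>2) * residual r" using residual_nonneg by simp
    ultimately show "(norm (g (z r) + Bt e))\<^sup>2 \<le> C * residual r"
      unfolding C_def distrib_right by linarith
  qed
  have 2: "(e \<bullet> (B (z r) - c))\<^sup>2 \<le> (norm e)\<^sup>2 * (C * residual r)" if e: "A e = 0" for e r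
  proof -
    define u where "u = x (Suc r) - z r"
    define d where "d = Lp (y (Suc r) - y r)"
    have "e \<bullet> (B (z r) - c) = e \<bullet> (\<rho> *\<^sub>R d + - B u)"
      using constraint_defect[OF e, of r] lin by (simp add: u_def d_def linear_diff inner_diff_right inner_add_right)
    then have "(e \<bullet> (B (z r) - c))\<^sup>2 \<le> (norm e)\<^sup>2 * (norm (\<rho> *\<^sub>R d + - B u))\<^sup>2"
      using Cauchy_Schwarz_ineq[of e "\<rho> *\<^sub>R d + - B u"] by (simp add: power2_norm_eq_inner)
    also have "\<dots> \<le> (norm e)\<^sup>2 * (C * residual r)"
    proof (intro mult_left_mono)
      have "(norm (\<rho> *\<^sub>R d + - B u))\<^sup>2 \<le> 2 * (\<rho>\<^sup>2 * (norm d)\<^sup>2) + 2 * (norm (B u))\<^sup>2"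
        using norm_add_sq_le[of "\<rho> *\<^sub>R d" "- B u"] by (simp add: power_mult_distrib)
      moreover have "(norm (B u))\<^sup>2 \<le> b\<^sup>2 * (norm u)\<^sup>2" by (rule sq) (rule b)
      moreover have "(2 * \<rho>\<^sup>2) * (norm d)\<^sup>2 \<le> (2 * \<rho>\<^sup>2) * residual r"
        "(2 * b\<^sup>2) * (norm u)\<^sup>2 \<le> (2 * b\<^sup>2) * residual r"
        by (intro mult_left_mono; simp add: residual_def u_def d_def)+
      moreover have "0 \<le> (2 * k\<^sup>2 + 2 * (b' * \<theta>)\<^sup>2) * residual r" using residual_nonneg by simp
      ultimately show "(norm (\<rho> *\<^sub>R d + - B u))\<^sup>2 \<le> C * residual r"
        unfolding C_def distrib_right by linarith
    qed simp
    finally show ?thesis .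
  qed
  show ?thesis by (rule that[OF C 1 2])
qed

lemma limit_point_of_descent:
  assumes desc: "\<exists>\<kappa>>0. \<forall>r. \<Phi> (Suc r) \<le> \<Phi> r - \<kappa> * residual r"
    and s: "strict_mono s" and b: "\<And>k. \<Phi> (s k) \<ge> b"
    and zs: "(\<lambda>k. z (s k)) \<longlonglongrightarrow> zs" and ys: "(\<lambda>k. y (s k)) \<longlonglongrightarrow> ys"
  shows "g zs + Bt ys = 0 \<and> A ys = 0 \<and> (\<forall>e. A e = 0 \<longrightarrow> e \<bullet> (B zs - c) = 0)"
proof -
  obtain \<kappa> where \<kappa>: "\<kappa> > 0" "\<And>r. \<Phi> (Suc r) \<le> \<Phi> r - \<kappa> * residual r" using desc by blast
  have "residual \<longlonglongrightarrow> 0"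
    using descent_tendsto_zero[where \<Phi> = \<Phi> and b = b, OF \<kappa>(2,1) _ residual_nonneg]
      bounded_below_of_subsequence_descent[where \<Phi> = \<Phi>, OF \<kappa>(2,1) residual_nonneg s b] by blast
  then show ?thesis using limit_point_stationary[OF _ s zs ys] by blast
qed

lemma rate_of_descent:
  assumes desc: "\<exists>\<kappa>>0. \<forall>r. \<Phi> (Suc r) \<le> \<Phi> r - \<kappa> * residual r" and b: "\<And>r. \<Phi> r \<ge> b"
  shows "\<exists>C>0. \<forall>n\<ge>1. \<exists>t<n. (\<exists>e. A e = 0 \<and> (norm (g (z t) + Bt e))\<^sup>2 \<le> C / real n) \<and>
    (\<forall>e. A e = 0 \<longrightarrow> (e \<bullet> (B (z t) - c))\<^sup>2 \<le> (norm e)\<^sup>2 * (C / real n))"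
proof -
  obtain \<kappa> where \<kappa>: "\<kappa> > 0" "\<And>r. \<Phi> (Suc r) \<le> \<Phi> r - \<kappa> * residual r" using desc by blast
  obtain C where C: "C > 0" "\<And>r. \<exists>e. A e = 0 \<and> (norm (g (z r) + Bt e))\<^sup>2 \<le> C * residual r"
    "\<And>r e. A e = 0 \<Longrightarrow> (e \<bullet> (B (z r) - c))\<^sup>2 \<le> (norm e)\<^sup>2 * (C * residual r)"
    using residual_controls_KKT by blast
  \<comment> \<open>The added 1 keeps the constant positive when
    \<open>\<Phi> 0 = b\<close>.\<close>
  define C' where "C' = C * ((\<Phi> 0 - b) / \<kappa> + 1)"
  have "C' > 0" using C(1) \<kappa>(1) b[of 0] by (simp add: C'_def add_nonneg_pos)
  moreover have "\<exists>t<n. (\<exists>e. A e = 0 \<and> (norm (g (z t) + Bt e))\<^sup>2 \<le> C' / real n) \<and>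
    (\<forall>e. A e = 0 \<longrightarrow> (e \<bullet> (B (z t) - c))\<^sup>2 \<le> (norm e)\<^sup>2 * (C' / real n))" if n: "n \<ge> 1" for n
  proof -
    obtain t where t: "t < n" "residual t \<le> (\<Phi> 0 - b) / \<kappa> / real n"
      using descent_best_iterate[where \<Phi> = \<Phi>, OF \<kappa>(2,1) b n] by blast
    have "residual t \<le> ((\<Phi> 0 - b) / \<kappa> + 1) / real n"
      using t(2) by (simp add: add_divide_distrib add_increasing2)
    then have le: "C * residual t \<le> C' / real n"
      using mult_left_mono[of "residual t" "((\<Phi> 0 - b) / \<kappa> + 1) / real n" C] C(1) by (simp add: C'_def)
    show ?thesis
      using t(1) C(2)[of t] C(3)[of _ t] le
      by (meson order_trans mult_left_mono zero_le_power2)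
  qed
  ultimately show ?thesis by blast
qed

lemma potential_bounded_below_along_convergent:
  assumes feasible and zs: "(\<lambda>k. z (s k)) \<longlonglongrightarrow> zs"
  shows "\<exists>b. \<forall>k. potential (s k) \<ge> b"
proof -
  define l where "l = (\<lambda>k. f (z (s k)) - (norm (g (z (s k))))\<^sup>2 / (2 * (p + gm)))"
  have "l \<longlonglongrightarrow> f zs - (norm (g zs))\<^sup>2 / (2 * (p + gm))"
    unfolding l_def using curvature
    by (intro tendsto_intros continuous_on_tendsto_compose[OF f_cont zs]
        continuous_on_tendsto_compose[OF g_cont zs]) auto
  then have "Bseq l" by (rule convergent_imp_Bseq[OF convergentI])
  then obtain K where K: "\<And>k. norm (l k) \<le> K" by (auto simp: Bseq_def)
  have "potential (s k) \<ge> - K" for k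
  proof -
    have "l k \<le> prox_obj (z (s k)) (prox_min (dual_solution (z (s k)) (mu (s k))) (z (s k)))"
      unfolding l_def by (rule prox_obj_bounded_below)
    also have "\<dots> \<le> prox_value (z (s k)) (mu (s k))"
      unfolding strong_duality[OF assms(1)] using rho by simp
    also have "\<dots> \<le> potential (s k)" by (rule potential_ge[OF assms(1)])
    finally show ?thesis using K[of k] by (simp add: abs_le_iff)
  qed
  then show ?thesis by blast
qed

lemma potential_bounded_below:
  assumes feasible "p > 0" and b: "\<And>u e. B u - c = At e \<Longrightarrow> f u \<ge> b"
  shows "potential r \<ge> b"
proof -
  have "b \<le> f (prox_min (dual_solution (z r) (mu r)) (z r))"
    by (rule b[OF dual_solution[OF assms(1)]])
  also have "\<dots> \<le> prox_value (z r) (mu r)"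
    unfolding strong_duality[OF assms(1)] prox_obj_def using rho assms(2) by simp
  also have "\<dots> \<le> potential r" by (rule potential_ge[OF assms(1)])
  finally show ?thesis .
qed

text \<open>An infeasible problem has a certificate \<open>e\<close> along which \<open>\<rho> \<langle>e, L\<^sup>+ y\<^sup>r\<rangle>\<close> changes by the constant \<open>-\<langle>e, c\<rangle>\<close> in
  every step, so that no subsequence of \<open>y\<close> converges.\<close>

lemma feasible_if_convergent_subsequence:
  assumes s: "strict_mono s" and ys: "(\<lambda>k. y (s k)) \<longlonglongrightarrow> ys"
  shows feasible
proof (rule ccontr)
  assume infeasible: "\<not> feasible"
  define T where "T = (\<lambda>w. B (fst w) - At (snd w))"
  have T: "linear T" unfolding T_def
    using lin by (intro linearI) (auto simp: linear_add linear_scale scaleR_diff_right)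
  have "\<not> (\<exists>w. T w = c)"
  proof
    assume "\<exists>w. T w = c"
    then obtain u e where "B u - At e = c" by (auto simp: T_def)
    then have "B u - c = At e" by (simp add: algebra_simps)
    then show False using infeasible by (auto simp: feasible_def)
  qed
  moreover have "T u \<bullet> v = u \<bullet> (Bt v, - A v)" for u v
    using B_adj[of "fst u" v] A_adj[of v "snd u"]
    by (cases u) (simp add: T_def inner_diff_left, metis inner_commute)
  \<comment> \<open>Since \<open>c\<close> lies outside the range of \<open>T\<close>, the kernel of
    the adjoint contains a vector not orthogonal to \<open>c\<close>.\<close>
  ultimately obtain e where e: "Bt e = 0" "A e = 0" "e \<bullet> c \<noteq> 0"
    using range_eq_kernel_adjoint_orthogonal[OF T, of "\<lambda>v. (Bt v, - A v)" c]
    by (auto simp: zero_prod_def)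
  have drift: "\<rho> * (e \<bullet> Lp (y r)) = \<rho> * (e \<bullet> Lp (y 0)) - real r * (e \<bullet> c)" for r
  proof (induction r)
    case (Suc r)
    have "e \<bullet> B (x (Suc r)) = 0" using B_adj[of "x (Suc r)" e] e by (simp add: inner_commute)
    then have "\<rho> * (e \<bullet> Lp (y (Suc r))) = \<rho> * (e \<bullet> Lp (y r)) - e \<bullet> c"
      using constraint_defect[OF e(2), of r] Lp_lin
      by (simp add: linear_diff inner_diff_right algebra_simps)
    then show ?case using Suc by (simp add: algebra_simps)
  qed simp
  \<comment> \<open>The linear drift expresses \<open>s k\<close> through a convergent sequence,
    contradicting \<open>k <= s k\<close>.\<close>
  have "real (s k) = (\<rho> * (e \<bullet> Lp (y 0)) - \<rho> * (e \<bullet> Lp (y (s k)))) / (e \<bullet> c)" for k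
    unfolding eq_divide_eq using e(3) drift[of "s k"] by simp
  moreover have "(\<lambda>k. (\<rho> * (e \<bullet> Lp (y 0)) - \<rho> * (e \<bullet> Lp (y (s k)))) / (e \<bullet> c))
      \<longlonglongrightarrow> (\<rho> * (e \<bullet> Lp (y 0)) - \<rho> * (e \<bullet> Lp ys)) / (e \<bullet> c)"
    using Lp_lin e(3) by (intro tendsto_intros bounded_linear.tendsto[OF _ ys]) (simp_all add: linear_conv_bounded_linear)
  ultimately have "Bseq (\<lambda>k. real (s k))"
    by (simp add: convergentI convergent_imp_Bseq)
  then obtain K where K: "\<And>k. real (s k) \<le> K" by (auto simp: Bseq_def)
  obtain k :: nat where "real k > K" using reals_Archimedean2 by blast
  moreover have "real k \<le> real (s k)" using seq_suble[OF s] by simp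
  ultimately show False using K[of k] by linarith
qed

end

text \<open>For \<open>s\<close> in the range of \<open>T\<close> with bounded preimage
  \<open>h s\<close>, the product \<open>v \<bullet> s\<close> equals
  \<open>(Bt v, - A v) \<bullet> h s\<close>. Components of \<open>v\<close> in the kernel of the
  adjoint, which the algorithm cannot control, thus drop out.\<close>

lemma dual_inner_bound:
  fixes B :: "'a::euclidean_space \<Rightarrow> 'b::euclidean_space" and At :: "'c::euclidean_space \<Rightarrow> 'b"
  assumes lin: "linear B" "linear At"
    and adj: "\<And>u v. B u \<bullet> v = u \<bullet> Bt v" "\<And>v e. A v \<bullet> e = v \<bullet> At e"
  obtains \<theta> where "\<theta> > 0" "\<And>u e v. (v \<bullet> (B u - At e))\<^sup>2
        \<le> \<theta>\<^sup>2 * (norm (B u - At e))\<^sup>2 * ((norm (Bt v))\<^sup>2 + (norm (A v))\<^sup>2)"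
proof -
  define T where "T = (\<lambda>w. B (fst w) - At (snd w))"
  have T: "linear T" unfolding T_def
    using lin by (intro linearI) (auto simp: linear_add linear_scale scaleR_diff_right)
  obtain h \<theta> where h: "\<theta> > 0" "\<And>u. T (h (T u)) = T u" "\<And>s. norm (h s) \<le> \<theta> * norm s"
    using linear_bounded_right_inverse_on_range[OF T] by metis
  have T_adj: "v \<bullet> T u = (Bt v, - A v) \<bullet> u" for u v
    using adj(1)[of "fst u" v] adj(2)[of v "snd u"]
    by (cases u) (simp add: T_def inner_diff_right inner_commute)
  have "(v \<bullet> (B u - At e))\<^sup>2 \<le> \<theta>\<^sup>2 * (norm (B u - At e))\<^sup>2 * ((norm (Bt v))\<^sup>2 + (norm (A v))\<^sup>2)" for u e v
  proof -
    define s where "s = B u - At e"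
    have s: "T (h s) = s" using h(2)[of "(u, e)"] by (simp add: T_def s_def)
    have "(v \<bullet> s)\<^sup>2 = ((Bt v, - A v) \<bullet> h s)\<^sup>2" using T_adj[of v "h s"] s by simp
    also have "\<dots> \<le> (norm (Bt v, - A v))\<^sup>2 * (norm (h s))\<^sup>2"
      unfolding power2_norm_eq_inner by (rule Cauchy_Schwarz_ineq)
    also have "\<dots> \<le> (norm (Bt v, - A v))\<^sup>2 * (\<theta> * norm s)\<^sup>2"
      by (intro mult_left_mono power_mono h) auto
    also have "(norm (Bt v, - A v))\<^sup>2 = (norm (Bt v))\<^sup>2 + (norm (A v))\<^sup>2"
      by (simp add: power2_norm_eq_inner)
    finally show ?thesis by (simp add: s_def power_mult_distrib mult_ac)
  qed
  then show ?thesis using that h(1) by blast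
qed

section \<open>Step sizes\<close>

lemma a2_nonneg: "a2 \<theta>\<^sub>1 p \<rho> gm gp \<ge> 0"
  by (simp add: a2_def)

lemma a3_nonneg: "a3 \<theta>\<^sub>2 b p \<rho> gm gp \<ge> 0"
  by (simp add: a3_def)

text \<open>\<open>k\<close> stands for \<open>\<theta>\<^sup>2 * cl\<close>, so this is the
  condition on \<open>\<alpha>\<close> in \<open>potential_descent\<close>; of \<open>a1\<close> the
  summand quadratic in \<open>\<theta>\<^sub>1\<close> is used.\<close>

lemma alpha_small_imp:
  assumes m: "p + gm > 0" "gm \<le> gp" and \<rho>: "\<rho> > 0" and lam: "lam \<noteq> 0" and k: "k \<ge> 0"
    and \<theta>: "3 * k \<le> lam\<^sup>2 * \<theta>\<^sub>1\<^sup>2" and \<alpha>: "\<alpha> > 0" "alpha_small \<theta>\<^sub>1 lam p \<rho> gm gp \<alpha>"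
  shows "8 * k * (\<rho> * (p + gp) + 1) * \<alpha> \<le> \<rho>"
proof -
  define K where "K = K_const p \<rho> gm gp"
  define t where "t = \<rho> * (p + gp)"
  have t: "t > 0" using m \<rho> by (simp add: t_def)
  have K: "K > 0" unfolding K_def K_const_def using m \<rho> by (intro add_pos_nonneg) auto
  \<comment> \<open>\<open>K / \<rho>\<close> is at least \<open>1 / t + t\<close> because
    \<open>gm <= gp\<close>. The factor 3/2 lost here, with the 2 in the denominator of
    \<open>a1\<close>, produces the \<open>3 * k\<close> of the hypothesis.\<close>
  have Kt: "2 * (t + 1) \<le> 3 * (K / \<rho>)"
  proof -
    define U where "U = 1 / (\<rho> * (p + gm))"
    have "1 / t \<le> U"
      unfolding U_def t_def using m \<rho> by (intro divide_left_mono mult_left_mono) auto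
    moreover have "K / \<rho> = U + t"
      by (simp add: U_def K_def K_const_def t_def add_divide_distrib power2_eq_square mult_ac)
    moreover have "2 * (t + 1) \<le> 3 * (1 / t + t)"
    proof -
      have "0 \<le> (t - 1)\<^sup>2 + 2" by simp
      then have "2 * (t + 1) * t \<le> 3 * (1 + t * t)" by (simp add: power2_eq_square algebra_simps)
      then show ?thesis using t by (simp add: field_simps)
    qed
    ultimately show ?thesis by argo
  qed
  have a1: "a1 \<theta>\<^sub>1 p \<rho> gm gp \<ge> \<theta>\<^sub>1\<^sup>2 * K / (2 * \<rho>)" "a1 \<theta>\<^sub>1 p \<rho> gm gp > 0"
  proof -
    have e: "a1 \<theta>\<^sub>1 p \<rho> gm gp = \<theta>\<^sub>1\<^sup>2 * K / (2 * \<rho>) + \<rho> / K"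
      using K by (simp add: a1_def K_def[symmetric] add_divide_distrib power2_eq_square)
    show "a1 \<theta>\<^sub>1 p \<rho> gm gp \<ge> \<theta>\<^sub>1\<^sup>2 * K / (2 * \<rho>)" using e K \<rho> by simp
    show "a1 \<theta>\<^sub>1 p \<rho> gm gp > 0" unfolding e using K \<rho> by (intro add_nonneg_pos) auto
  qed
  have "k * (t + 1) \<le> k * (3 * (K / \<rho>) / 2)" using Kt k by (intro mult_left_mono) auto
  also have "\<dots> = 3 * k * (K / (2 * \<rho>))" by simp
  also have "\<dots> \<le> (lam\<^sup>2 * \<theta>\<^sub>1\<^sup>2) * (K / (2 * \<rho>))" using \<theta> K \<rho> by (intro mult_right_mono) auto
  also have "\<dots> = lam\<^sup>2 * (\<theta>\<^sub>1\<^sup>2 * K / (2 * \<rho>))" by simp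
  also have "\<dots> \<le> lam\<^sup>2 * a1 \<theta>\<^sub>1 p \<rho> gm gp" using a1 by (intro mult_left_mono) auto
  finally have 1: "k * (t + 1) \<le> lam\<^sup>2 * a1 \<theta>\<^sub>1 p \<rho> gm gp" .
  have "8 * (k * (t + 1)) * \<alpha> \<le> 8 * (lam\<^sup>2 * a1 \<theta>\<^sub>1 p \<rho> gm gp) * \<alpha>"
    using 1 \<alpha> by (intro mult_right_mono mult_left_mono) auto
  also have "\<dots> \<le> \<rho>"
  proof -
    have "\<alpha> \<le> \<rho> / (8 * a1 \<theta>\<^sub>1 p \<rho> gm gp * lam\<^sup>2)" using \<alpha> by (simp add: alpha_small_def)
    then show ?thesis using a1 lam by (simp add: field_simps)
  qed
  finally show ?thesis by (simp add: t_def mult_ac)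
qed

text \<open>The two fractions in the bound on \<open>\<beta>\<close> have the product \<open>2 (\<sigma>\<^sub>1\<^sup>2 + 2 \<sigma>\<^sub>2\<^sup>2 a\<^sub>3)\<close>, so by AM-GM their sum
  dominates \<open>\<sigma>\<^sub>1\<close>.\<close>

lemma fraction_sum_square:
  fixes X p \<rho> s :: real
  assumes "X > 0" "p \<noteq> 0" "\<rho> > 0"
  shows "(20 * p * X / \<rho> + \<rho> * s / (10 * p * X))\<^sup>2 \<ge> 8 * s"
proof -
  let ?u = "20 * p * X / \<rho>" and ?v = "\<rho> * s / (10 * p * X)"
  have "?u * ?v = 2 * s" using assms by (simp add: field_simps)
  moreover have "(?u + ?v)\<^sup>2 = (?u - ?v)\<^sup>2 + 4 * (?u * ?v)"
    by (simp add: power2_eq_square algebra_simps)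
  ultimately show ?thesis by simp
qed

lemma beta_small_pos_imp:
  assumes p: "p > 0" and m: "p + gm > 0" "gm \<le> gp" and \<rho>: "\<rho> > 0" and k: "k \<ge> 0"
    and \<theta>: "2 * k \<le> b\<^sup>2 * lam\<^sup>2 * \<theta>\<^sub>1\<^sup>2" "\<theta>\<^sub>1 \<ge> 1"
    and \<beta>: "0 < \<beta>" "\<beta> < 1" "beta_small \<theta>\<^sub>1 \<theta>\<^sub>2 b lam p \<rho> gm gp \<beta>"
  shows "20 * p * \<beta> * k * (\<rho> * (p + gp) + 1) \<le> p + gm"
    and "1 - \<beta> * (p / (p + gm) + 1 / 2) \<ge> 3 / 10"
proof -
  define L where "L = p + gp"
  define mm where "mm = p + gm"
  define X where "X = (sigma2 b p gm gp)\<^sup>2 * a2 \<theta>\<^sub>1 p \<rho> gm gp * lam\<^sup>2"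
  define s where "s = (sigma1 p gm gp)\<^sup>2 + 2 * (sigma2 b p gm gp)\<^sup>2 * a3 \<theta>\<^sub>2 b p \<rho> gm gp"
  define Q1 where "Q1 = 20 * p * X / \<rho>"
  define Q2 where "Q2 = \<rho> * s / (10 * p * X)"
  have L: "0 < mm" "mm \<le> L" "L > 0" using m by (auto simp: L_def mm_def)
  have bs: "10 * p * X \<noteq> 0" "\<beta> < inverse (1 / 2 + Q1 + Q2)"
    using \<beta>(3) unfolding beta_small_def X_def s_def Q1_def Q2_def by (simp_all add: mult.assoc)
  have "X \<ge> 0" unfolding X_def using a2_nonneg by simp
  then have X: "X > 0" using bs(1) by (cases "X = 0") auto
  have s0: "s \<ge> (sigma1 p gm gp)\<^sup>2" unfolding s_def using a3_nonneg by simp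
  then have "s \<ge> 0" by (smt (verit) zero_le_power2)
  then have Q: "Q1 \<ge> 0" "Q2 \<ge> 0" using X p \<rho> by (simp_all add: Q1_def Q2_def)
  have \<beta>Q: "\<beta> * (1 / 2 + Q1 + Q2) < 1"
    using bs(2) Q by (simp add: inverse_eq_divide pos_less_divide_eq)
  have \<sigma>: "sigma1 p gm gp \<ge> p / mm"
  proof -
    have "p / mm * 1 \<le> p / mm * (L + 1)" using p L by (intro mult_left_mono) auto
    then show ?thesis by (simp add: sigma1_def L_def mm_def)
  qed
  \<comment> \<open>14/5 is a rational number below the square root of 8 from AM-GM; together with
    \<open>\<beta> < 1\<close> it leaves 9/28, which exceeds 3/10.\<close>
  have "Q1 + Q2 \<ge> 14 / 5 * (p / mm)"
  proof (rule power2_le_imp_le)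
    have "(p / mm)\<^sup>2 \<le> (sigma1 p gm gp)\<^sup>2" using \<sigma> p L by (intro power_mono) auto
    then have "(14 / 5 * (p / mm))\<^sup>2 \<le> 8 * (sigma1 p gm gp)\<^sup>2"
      using zero_le_power2[of "sigma1 p gm gp"]
      unfolding power_mult_distrib power2_eq_square[of "14 / 5 :: real"] by linarith
    also have "\<dots> \<le> 8 * s" using s0 by simp
    also have "\<dots> \<le> (Q1 + Q2)\<^sup>2" unfolding Q1_def Q2_def using X p \<rho> by (intro fraction_sum_square) auto
    finally show "(14 / 5 * (p / mm))\<^sup>2 \<le> (Q1 + Q2)\<^sup>2" .
  qed (use Q in simp)
  then have "\<beta> * (14 / 5 * (p / mm)) \<le> \<beta> * (Q1 + Q2)" using \<beta> by (intro mult_left_mono) auto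
  then have "\<beta> / 2 + 14 / 5 * (\<beta> * (p / mm)) < 1" using \<beta>Q by (simp add: algebra_simps)
  moreover have "1 - \<beta> * (p / mm + 1 / 2) = 1 - \<beta> * (p / mm) - \<beta> / 2" by (simp add: algebra_simps)
  ultimately show "1 - \<beta> * (p / (p + gm) + 1 / 2) \<ge> 3 / 10"
    using \<beta> unfolding mm_def[symmetric] by linarith
  have a2: "a2 \<theta>\<^sub>1 p \<rho> gm gp \<ge> \<theta>\<^sub>1\<^sup>2 * ((\<rho> * L)\<^sup>2 + 1)"
  proof -
    let ?K = "K_const p \<rho> gm gp"
    have "\<rho>\<^sup>2 * L \<le> ?K" using m by (simp add: K_const_def L_def)
    then have "\<rho> * L \<le> ?K / \<rho>" using \<rho> by (simp add: field_simps power2_eq_square)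
    then have "(\<rho> * L)\<^sup>2 \<le> (?K / \<rho>)\<^sup>2" using \<rho> L by (intro power_mono) auto
    moreover have "\<theta>\<^sub>1\<^sup>2 \<le> \<theta>\<^sub>1 ^ 4" using \<theta>(2) by (intro power_increasing) auto
    ultimately have "\<theta>\<^sub>1\<^sup>2 * (\<rho> * L)\<^sup>2 \<le> \<theta>\<^sub>1 ^ 4 * (?K / \<rho>)\<^sup>2" by (intro mult_mono) auto
    moreover have "a2 \<theta>\<^sub>1 p \<rho> gm gp = \<theta>\<^sub>1 ^ 4 * (?K / \<rho>)\<^sup>2 + 2 * \<theta>\<^sub>1\<^sup>2"
      by (simp add: a2_def power_divide)
    moreover have "\<theta>\<^sub>1\<^sup>2 \<ge> 0" by simp
    ultimately show ?thesis unfolding distrib_left by linarith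
  qed
  \<comment> \<open>The required lower bound on \<open>Q1\<close>, cleared of the denominator of
    \<open>sigma2\<close>. \<open>mm <= L\<close> reduces it to \<open>t = \<rho> * L\<close>, and
    \<open>t * (t + 1) <= 2 * (t\<^sup>2 + 1)\<close> is the origin of \<open>2 * k\<close> in the
    hypothesis.\<close>
  have "mm * (\<rho> * (\<rho> * L + 1)) * k \<le> X * mm\<^sup>2"
  proof -
    define t where "t = \<rho> * L"
    have t: "t > 0" using L \<rho> by (simp add: t_def)
    have "mm * (\<rho> * (t + 1)) \<le> L * (\<rho> * (t + 1))" using L \<rho> t by (intro mult_right_mono) auto
    also have "\<dots> = t * (t + 1)" by (simp add: t_def mult_ac)
    also have "\<dots> \<le> 2 * (t\<^sup>2 + 1)"
    proof -
      have "0 \<le> (t - 1)\<^sup>2 + t\<^sup>2 + 3" by simp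
      then show ?thesis by (simp add: power2_eq_square algebra_simps)
    qed
    also have "\<dots> \<le> (L + 1)\<^sup>2 * (2 * (t\<^sup>2 + 1))"
    proof -
      have "1 \<le> (L + 1)\<^sup>2" using L by (intro one_le_power) auto
      then show ?thesis using mult_right_mono[of 1 "(L + 1)\<^sup>2" "2 * (t\<^sup>2 + 1)"] by simp
    qed
    finally have "mm * (\<rho> * (t + 1)) * k \<le> (L + 1)\<^sup>2 * (2 * (t\<^sup>2 + 1)) * k"
      using k by (intro mult_right_mono) auto
    also have "\<dots> = (L + 1)\<^sup>2 * (t\<^sup>2 + 1) * (2 * k)" by simp
    also have "\<dots> \<le> (L + 1)\<^sup>2 * (t\<^sup>2 + 1) * (b\<^sup>2 * lam\<^sup>2 * \<theta>\<^sub>1\<^sup>2)"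
      using \<theta> by (intro mult_left_mono) auto
    also have "\<dots> = (b * (L + 1))\<^sup>2 * lam\<^sup>2 * (\<theta>\<^sub>1\<^sup>2 * (t\<^sup>2 + 1))" by (simp add: power_mult_distrib)
    also have "\<dots> \<le> (b * (L + 1))\<^sup>2 * lam\<^sup>2 * a2 \<theta>\<^sub>1 p \<rho> gm gp"
      using a2 unfolding t_def by (intro mult_left_mono) auto
    also have "\<dots> = X * mm\<^sup>2"
      using L by (simp add: X_def sigma2_def L_def mm_def power_divide)
    finally show ?thesis unfolding t_def .
  qed
  then have "mm * (\<rho> * ((\<rho> * L + 1) * k)) \<le> mm * (X * mm)" by (simp add: power2_eq_square mult_ac)
  then have "\<rho> * ((\<rho> * L + 1) * k) \<le> X * mm" using L by simp
  then have "(\<rho> * L + 1) * k \<le> X * mm / \<rho>" using \<rho> by (simp add: field_simps)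
  then have "20 * p * ((\<rho> * L + 1) * k) \<le> 20 * p * (X * mm / \<rho>)" using p by (intro mult_left_mono) auto
  then have "20 * p * ((\<rho> * L + 1) * k) \<le> Q1 * mm" by (simp add: Q1_def)
  then have "\<beta> * (20 * p * ((\<rho> * L + 1) * k)) \<le> \<beta> * (Q1 * mm)" using \<beta> by (intro mult_left_mono) auto
  also have "\<dots> \<le> 1 * mm"
  proof -
    have "\<beta> * (1 / 2 + Q1 + Q2) = \<beta> / 2 + \<beta> * Q1 + \<beta> * Q2" "\<beta> * Q2 \<ge> 0"
      using Q \<beta> by (simp_all add: distrib_left)
    then have "\<beta> * Q1 \<le> 1" using \<beta>Q \<beta> by linarith
    then have "(\<beta> * Q1) * mm \<le> 1 * mm" using L by (intro mult_right_mono) auto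
    then show ?thesis by (simp add: mult_ac)
  qed
  finally show "20 * p * \<beta> * k * (\<rho> * (p + gp) + 1) \<le> p + gm"
    unfolding L_def mm_def by (simp add: mult_ac)
qed

text \<open>Both fractions are nonpositive, yet the bracket must be positive to admit some
  \<open>\<beta> > 0\<close>; hence their sum is at most 1/2 in modulus. AM-GM then gives
  \<open>\<bar>sigma1\<bar> <= 1/5\<close>, that is, \<open>- p <= (p + gm) / 5\<close>.\<close>

lemma beta_small_neg_imp:
  assumes p: "p < 0" and m: "p + gm > 0" "gm \<le> gp" and \<rho>: "\<rho> > 0"
    and \<beta>: "0 < \<beta>" "beta_small \<theta>\<^sub>1 \<theta>\<^sub>2 b lam p \<rho> gm gp \<beta>"
  shows "gm \<ge> - 6 * p"
proof -
  define X where "X = (sigma2 b p gm gp)\<^sup>2 * a2 \<theta>\<^sub>1 p \<rho> gm gp * lam\<^sup>2"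
  define s where "s = (sigma1 p gm gp)\<^sup>2 + 2 * (sigma2 b p gm gp)\<^sup>2 * a3 \<theta>\<^sub>2 b p \<rho> gm gp"
  define S where "S = 20 * p * X / \<rho> + \<rho> * s / (10 * p * X)"
  have bs: "10 * p * X \<noteq> 0" "\<beta> < inverse (1 / 2 + S)"
    using \<beta>(2) unfolding beta_small_def X_def s_def S_def by (simp_all add: mult.assoc add.assoc)
  have "X \<ge> 0" unfolding X_def using a2_nonneg by simp
  then have X: "X > 0" using bs(1) by (cases "X = 0") auto
  have s0: "s \<ge> (sigma1 p gm gp)\<^sup>2" unfolding s_def using a3_nonneg by simp
  then have "s \<ge> 0" by (smt (verit) zero_le_power2)
  then have "S \<le> 0" unfolding S_def using p X \<rho>
    by (intro add_nonpos_nonpos divide_nonpos_pos divide_nonneg_neg) (auto simp: mult_le_0_iff mult_less_0_iff)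
  moreover have "1 / 2 + S > 0"
    using bs(2) \<beta>(1) by (metis less_trans inverse_positive_iff_positive)
  ultimately have "\<bar>S\<bar> \<le> 1 / 2" by simp
  then have "S\<^sup>2 \<le> (1 / 2)\<^sup>2" using power_mono[of "\<bar>S\<bar>" "1 / 2" 2] by simp
  moreover have "S\<^sup>2 \<ge> 8 * s" unfolding S_def using X p \<rho> by (intro fraction_sum_square) simp_all
  moreover have "(1 / 2)\<^sup>2 = (1 / 4 :: real)" "(1 / 5)\<^sup>2 = (1 / 25 :: real)"
    by (simp_all add: power2_eq_square)
  ultimately have "(- sigma1 p gm gp)\<^sup>2 \<le> (1 / 5)\<^sup>2" using s0 unfolding power2_minus by linarith
  then have "- sigma1 p gm gp \<le> 1 / 5" by (rule power2_le_imp_le) simp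
  then have "- sigma1 p gm gp * (p + gm) \<le> 1 / 5 * (p + gm)" using m by (intro mult_right_mono) simp_all
  moreover have "sigma1 p gm gp * (p + gm) = p * (p + gp + 1)" using m by (simp add: sigma1_def)
  moreover have "- p * 1 \<le> - p * (p + gp + 1)" using p m by (intro mult_left_mono) simp_all
  ultimately show ?thesis by simp
qed

section \<open>The graph operators\<close>

text \<open>The factor \<open>1 / sqrt 2\<close> compensates that each undirected edge occurs twice in \<open>E\<close>.\<close>

definition edge_diff :: "('v::finite \<times> 'v) set \<Rightarrow> real^'m^'v \<Rightarrow> real^'m^('v \<times> 'v)" where
  "edge_diff E y = (\<chi> e. if e \<in> E then (1 / sqrt 2) *\<^sub>R (y $ fst e - y $ snd e) else 0)"

lemma sum_edges: "(\<Sum>e\<in>E. h (fst e) (snd e)) = (\<Sum>i\<in>UNIV. \<Sum>j\<in>nbrs E i. h i j)"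
  for E :: "('v::finite \<times> 'v) set"
proof -
  have "E = Sigma UNIV (nbrs E)" by (auto simp: nbrs_def)
  then have "(\<Sum>e\<in>E. h (fst e) (snd e)) = (\<Sum>e\<in>Sigma UNIV (nbrs E). h (fst e) (snd e))" by simp
  also have "\<dots> = (\<Sum>i\<in>UNIV. \<Sum>j\<in>nbrs E i. h i j)"
    by (subst sum.Sigma) (auto simp: case_prod_unfold)
  finally show ?thesis .
qed

lemma sum_edges_swap:
  fixes E :: "('v::finite \<times> 'v) set"
  assumes "sym E"
  shows "(\<Sum>e\<in>E. h (fst e) (snd e)) = (\<Sum>e\<in>E. h (snd e) (fst e))"
  by (rule sum.reindex_bij_witness[of _ prod.swap prod.swap]) (use assms in \<open>auto simp: sym_def\<close>)

text \<open>The signs -1 and 1 give the forms of L- and L+. Each edge term splits into two halves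
  exchanged by reversing the edge.\<close>

lemma edge_quadratic_form:
  fixes E :: "('v::finite \<times> 'v) set" and u v :: "real^'m^'v"
  assumes "sym E" and \<epsilon>: "\<epsilon> * \<epsilon> = 1"
  shows "(\<Sum>e\<in>E. (u $ fst e + \<epsilon> *\<^sub>R u $ snd e) \<bullet> (v $ fst e + \<epsilon> *\<^sub>R v $ snd e))
    = 2 * (\<Sum>i\<in>UNIV. u $ i \<bullet> (\<Sum>j\<in>nbrs E i. v $ i + \<epsilon> *\<^sub>R v $ j))"
proof -
  let ?h = "\<lambda>i j. u $ i \<bullet> (v $ i + \<epsilon> *\<^sub>R v $ j)"
  have "(u $ i + \<epsilon> *\<^sub>R u $ j) \<bullet> (v $ i + \<epsilon> *\<^sub>R v $ j) = ?h i j + ?h j i" for i j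
  proof -
    have "\<epsilon> * (\<epsilon> * r) = r" for r using \<epsilon> by (simp flip: mult.assoc)
    then show ?thesis by (simp add: inner_add_left inner_add_right algebra_simps)
  qed
  then have "(\<Sum>e\<in>E. (u $ fst e + \<epsilon> *\<^sub>R u $ snd e) \<bullet> (v $ fst e + \<epsilon> *\<^sub>R v $ snd e))
      = (\<Sum>e\<in>E. ?h (fst e) (snd e)) + (\<Sum>e\<in>E. ?h (snd e) (fst e))"
    by (simp add: sum.distrib)
  also have "\<dots> = 2 * (\<Sum>e\<in>E. ?h (fst e) (snd e))"
    using sum_edges_swap[OF assms(1), of ?h] by simp
  also have "(\<Sum>e\<in>E. ?h (fst e) (snd e)) = (\<Sum>i\<in>UNIV. u $ i \<bullet> (\<Sum>j\<in>nbrs E i. v $ i + \<epsilon> *\<^sub>R v $ j))"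
    unfolding sum_edges[of ?h] by (simp add: inner_sum_right)
  finally show ?thesis .
qed

lemma linear_edge_diff: "linear (edge_diff E)"
  by (intro linearI) (auto simp: edge_diff_def vec_eq_iff algebra_simps)

lemma edge_diff_inner:
  fixes E :: "('v::finite \<times> 'v) set" and u v :: "real^'m^'v"
  assumes "sym E"
  shows "edge_diff E u \<bullet> edge_diff E v = (\<Sum>i\<in>UNIV. u $ i \<bullet> (\<Sum>j\<in>nbrs E i. v $ i - v $ j))"
proof -
  have "edge_diff E u \<bullet> edge_diff E v
      = (\<Sum>e\<in>UNIV. if e \<in> E then (u $ fst e - u $ snd e) \<bullet> (v $ fst e - v $ snd e) / 2 else 0)"
    unfolding inner_vec_def[of "edge_diff E u"] by (rule sum.cong) (auto simp: edge_diff_def)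
  also have "\<dots> = (\<Sum>e\<in>E. (u $ fst e - u $ snd e) \<bullet> (v $ fst e - v $ snd e)) / 2"
    by (simp add: sum.If_cases sum_divide_distrib)
  finally show ?thesis
    using edge_quadratic_form[OF assms, of "-1" u v] by simp
qed

lemma adjoint_edge_diff:
  fixes v :: "real^'b^'a::finite"
  assumes "sym E"
  shows "adjoint (edge_diff E) (edge_diff E v) $ i = (\<Sum>j\<in>nbrs E i. v $ i - v $ j)"
proof -
  have "adjoint (edge_diff E) (edge_diff E v) = (\<chi> i. \<Sum>j\<in>nbrs E i. v $ i - v $ j)"
  proof (rule vector_eq_ldot[THEN iffD1], rule allI)
    fix u :: "real^'b^'a"
    have "u \<bullet> adjoint (edge_diff E) (edge_diff E v) = edge_diff E u \<bullet> edge_diff E v"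
      by (rule adjoint_works[OF linear_edge_diff])
    also have "\<dots> = u \<bullet> (\<chi> i. \<Sum>j\<in>nbrs E i. v $ i - v $ j)"
      unfolding edge_diff_inner[OF assms] by (subst (2) inner_vec_def) simp
    finally show "u \<bullet> adjoint (edge_diff E) (edge_diff E v) = u \<bullet> (\<chi> i. \<Sum>j\<in>nbrs E i. v $ i - v $ j)" .
  qed
  then show ?thesis by simp
qed

lemma Lplus_act_inner:
  fixes E :: "('v::finite \<times> 'v) set" and u v :: "real^'m^'v"
  assumes "sym E"
  shows "u \<bullet> Lplus_act E v = (\<Sum>e\<in>E. (u $ fst e + u $ snd e) \<bullet> (v $ fst e + v $ snd e)) / 2"
  using edge_quadratic_form[OF assms, of 1 u v] by (simp add: inner_vec_def[of u] Lplus_act_def)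

lemma linear_Lplus_act: "linear (Lplus_act E)"
  by (intro linearI)
     (auto simp: Lplus_act_def vec_eq_iff sum.distrib[symmetric] sum_distrib_left algebra_simps)

lemma Lplus_act_symmetric:
  assumes "sym E"
  shows "Lplus_act E u \<bullet> v = u \<bullet> Lplus_act E v"
  using Lplus_act_inner[OF assms, of u v] Lplus_act_inner[OF assms, of v u] by (simp add: inner_commute)

text \<open>Cauchy-Schwarz over the neighbours with degree at most N, each edge being counted
  twice.\<close>

lemma norm_Lplus_act_le:
  fixes v :: "real^'m^'v::finite"
  assumes "sym E"
  shows "(norm (Lplus_act E v))\<^sup>2 \<le> 2 * real CARD('v) * (v \<bullet> Lplus_act E v)"
proof -
  have "(norm (\<Sum>j\<in>nbrs E i. v $ i + v $ j))\<^sup>2 \<le> real CARD('v) * (\<Sum>j\<in>nbrs E i. (norm (v $ i + v $ j))\<^sup>2)" for i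
  proof -
    have "(norm (\<Sum>j\<in>nbrs E i. v $ i + v $ j))\<^sup>2 \<le> (\<Sum>j\<in>nbrs E i. norm (v $ i + v $ j))\<^sup>2"
      by (intro power_mono norm_sum) auto
    also have "\<dots> \<le> (\<Sum>j\<in>nbrs E i. (norm (v $ i + v $ j))\<^sup>2) * real (card (nbrs E i))"
      by (rule sum_squared_le_sum_of_squares)
    also have "\<dots> \<le> (\<Sum>j\<in>nbrs E i. (norm (v $ i + v $ j))\<^sup>2) * real CARD('v)"
      by (intro mult_left_mono sum_nonneg) (auto simp: card_mono)
    finally show ?thesis by (simp add: mult.commute)
  qed
  then have "(norm (Lplus_act E v))\<^sup>2 \<le> (\<Sum>i\<in>UNIV. real CARD('v) * (\<Sum>j\<in>nbrs E i. (norm (v $ i + v $ j))\<^sup>2))"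
    unfolding power2_norm_eq_inner[of "Lplus_act E v"] inner_vec_def[of "Lplus_act E v"]
    by (intro sum_mono) (simp add: Lplus_act_def flip: power2_norm_eq_inner)
  also have "\<dots> = real CARD('v) * (\<Sum>e\<in>E. (norm (v $ fst e + v $ snd e))\<^sup>2)"
    unfolding sum_edges[of "\<lambda>i j. (norm (v $ i + v $ j))\<^sup>2"] by (simp add: sum_distrib_left)
  also have "\<dots> = 2 * real CARD('v) * (v \<bullet> Lplus_act E v)"
    unfolding Lplus_act_inner[OF assms] by (simp add: power2_norm_eq_inner)
  finally show ?thesis .
qed

lemma edge_diff_eq_0_iff:
  fixes e :: "real^'m^'v::finite"
  assumes E: "connected_graph E"
  shows "edge_diff E e = 0 \<longleftrightarrow> (\<exists>v. e = (\<chi> i. v))"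
proof
  assume "edge_diff E e = 0"
  then have zero: "edge_diff E e $ (i, j) = 0" for i j by simp
  have eq: "e $ i = e $ j" if "(i, j) \<in> E" for i j
    using zero[of i j] that by (simp add: edge_diff_def)
  have "e $ i = e $ j" for i j
  proof -
    have "(i, j) \<in> E\<^sup>*" using E by (simp add: connected_graph_def)
    then show ?thesis by (induction rule: rtrancl_induct) (auto dest: eq)
  qed
  then have "e = (\<chi> i. e $ undefined)" by (simp add: vec_eq_iff)
  then show "\<exists>v. e = (\<chi> i. v)" ..
qed (auto simp: edge_diff_def vec_eq_iff)

text \<open>The range is the orthogonal complement of the constant vectors. With \<open>c\<close>
  equal to \<open>q / N\<close> in each block, solvability of \<open>B x - c = At \<mu>\<close> thus
  becomes the coupling constraint.\<close>

lemma range_adjoint_edge_diff: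
  fixes w :: "real^'m^'v::finite"
  assumes E: "connected_graph E"
  shows "(\<exists>\<mu>. w = adjoint (edge_diff E) \<mu>) \<longleftrightarrow> (\<Sum>i\<in>UNIV. w $ i) = 0"
proof
  note adj = adjoint_works[OF linear_edge_diff[of E]]
  assume "\<exists>\<mu>. w = adjoint (edge_diff E) \<mu>"
  then obtain \<mu> where w: "w = adjoint (edge_diff E) \<mu>" ..
  have "(\<chi> i. v) \<bullet> w = 0" for v :: "real^'m"
    unfolding w adj using edge_diff_eq_0_iff[OF E] by (metis inner_zero_left)
  then have "v \<bullet> (\<Sum>i\<in>UNIV. w $ i) = 0" for v
    by (simp add: inner_vec_def[of "\<chi> i. _"] inner_sum_right)
  then show "(\<Sum>i\<in>UNIV. w $ i) = 0" using inner_eq_zero_iff by blast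
next
  assume s: "(\<Sum>i\<in>UNIV. w $ i) = 0"
  have "\<exists>\<mu>. adjoint (edge_diff E) \<mu> = w"
  proof (rule range_eq_kernel_adjoint_orthogonal)
    show "linear (adjoint (edge_diff E))" by (rule adjoint_linear[OF linear_edge_diff])
    show "adjoint (edge_diff E) u \<bullet> v = u \<bullet> edge_diff E v" for u v
      by (rule adjoint_clauses(2)[OF linear_edge_diff])
    show "v \<bullet> w = 0" if v: "edge_diff E v = 0" for v
    proof -
      obtain a where "v = (\<chi> i. a)" using v unfolding edge_diff_eq_0_iff[OF E] ..
      then have "v \<bullet> w = a \<bullet> (\<Sum>i\<in>UNIV. w $ i)"
        by (subst inner_vec_def) (simp add: inner_sum_right)
      then show ?thesis using s by simp
    qed
  qed
  then obtain \<mu> where "adjoint (edge_diff E) \<mu> = w" ..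
  then show "\<exists>\<mu>. w = adjoint (edge_diff E) \<mu>" by (intro exI[of _ \<mu>]) (rule sym)
qed

text \<open>In a connected graph an isolated node is the only node, and then L+ is zero. This
  justifies the divisions by the degree in the algorithm.\<close>

lemma nbrs_nonempty_if_lambda_max:
  fixes E :: "('v::{finite,linorder} \<times> 'v) set"
  assumes E: "connected_graph E" and lam: "lambda_max TYPE('m::finite) E \<noteq> 0"
  shows "card (nbrs E i) > 0"
proof (rule ccontr)
  assume "\<not> card (nbrs E i) > 0"
  then have "nbrs E i = {}" by simp
  then have "j = i" for j
    using E unfolding connected_graph_def nbrs_def
    by (metis (mono_tags, lifting) converse_rtranclE empty_iff mem_Collect_eq)
  then have "E = {}" using E unfolding connected_graph_def irrefl_def by (metis equals0I surj_pair)
  then have "Lplus TYPE('m) E = 0"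
    by (simp add: Lplus_def kron_def Lplus0_def degree_matrix_def Lminus0_def edge_rows_def nbrs_def vec_eq_iff)
  moreover have "eigenvalues (0 :: real^('v \<times> 'm)^('v \<times> 'm)) = {0}"
    unfolding eigenvalues_def using nonzero_Basis[OF SOME_Basis] by auto
  ultimately show False using lam by (simp add: lambda_max_def)
qed

section \<open>The stacked problem\<close>

definition stacked_fun :: "('v::finite \<Rightarrow> real^'n \<Rightarrow> real) \<Rightarrow> real^'n^'v \<Rightarrow> real" where
  "stacked_fun f x = (\<Sum>i\<in>UNIV. f i (x $ i))"

definition stacked_grad :: "('v::finite \<Rightarrow> real^'n \<Rightarrow> real^'n) \<Rightarrow> real^'n^'v \<Rightarrow> real^'n^'v" where
  "stacked_grad g x = (\<chi> i. g i (x $ i))"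

definition stacked_map :: "('v::finite \<Rightarrow> real^'n^'m) \<Rightarrow> real^'n^'v \<Rightarrow> real^'m^'v" where
  "stacked_map B x = (\<chi> i. B i *v x $ i)"

definition coupling :: "('v::finite \<Rightarrow> real^'n^'m) \<Rightarrow> real^'n^'v \<Rightarrow> real^'m" where
  "coupling B x = (\<Sum>i\<in>UNIV. B i *v x $ i)"

definition stacked_transpose :: "('v::finite \<Rightarrow> real^'n^'m) \<Rightarrow> real^'m^'v \<Rightarrow> real^'n^'v" where
  "stacked_transpose B = stacked_map (\<lambda>i. transpose (B i))"

lemma linear_stacked_map: "linear (stacked_map B)"
  by (intro linearI)
     (simp_all add: stacked_map_def vec_eq_iff matrix_vector_right_distrib matrix_vector_mult_scaleR)

lemma linear_coupling: "linear (coupling B)"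
  by (intro linearI)
     (auto simp: coupling_def matrix_vector_right_distrib matrix_vector_mult_scaleR sum.distrib scaleR_sum_right)

lemma stacked_map_adjoint: "stacked_map B u \<bullet> v = u \<bullet> stacked_transpose B v"
proof -
  have "stacked_map B u \<bullet> v = (\<Sum>i\<in>UNIV. (B i *v u $ i) \<bullet> v $ i)"
    by (subst inner_vec_def) (simp add: stacked_map_def)
  also have "\<dots> = (\<Sum>i\<in>UNIV. u $ i \<bullet> (transpose (B i) *v v $ i))"
    by (rule sum.cong) (simp_all add: inner_commute[of "_ *v _"] dot_lmul_matrix[symmetric] inner_commute[of "_ v* _"])
  also have "\<dots> = u \<bullet> stacked_transpose B v"
    by (subst inner_vec_def) (simp add: stacked_map_def stacked_transpose_def)
  finally show ?thesis .
qed

lemma coupling_adjoint: "coupling B u \<bullet> v = u \<bullet> stacked_transpose B (\<chi> i. v)"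
proof -
  have "coupling B u \<bullet> v = stacked_map B u \<bullet> (\<chi> i. v)"
    by (subst inner_vec_def) (simp add: coupling_def stacked_map_def inner_sum_left)
  then show ?thesis by (simp add: stacked_map_adjoint)
qed

lemma stacked_norm_sq: "(norm (x :: 'a::real_inner^'v::finite))\<^sup>2 = (\<Sum>i\<in>UNIV. (norm (x $ i))\<^sup>2)"
  by (simp add: power2_norm_eq_inner inner_vec_def)

lemma stacked_gradient:
  fixes f :: "'v::finite \<Rightarrow> real^'n \<Rightarrow> real"
  assumes "\<And>i x. GDERIV (f i) x :> g i x"
  shows "GDERIV (stacked_fun f) x :> stacked_grad g x"
proof -
  have "((\<lambda>x. f i (x $ i)) has_derivative (\<lambda>h. h $ i \<bullet> g i (x $ i))) (at x)" for i
  proof (rule has_derivative_compose[where g = "f i"])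
    show "((\<lambda>x. x $ i) has_derivative (\<lambda>h. h $ i)) (at x)"
      by (rule bounded_linear_imp_has_derivative[OF bounded_linear_vec_nth])
    show "(f i has_derivative (\<lambda>v. v \<bullet> g i (x $ i))) (at (x $ i))"
      using assms unfolding gderiv_def by blast
  qed
  then have "((\<lambda>x. \<Sum>i\<in>UNIV. f i (x $ i)) has_derivative (\<lambda>h. \<Sum>i\<in>UNIV. h $ i \<bullet> g i (x $ i))) (at x)"
    by (rule has_derivative_sum)
  then show ?thesis
    unfolding gderiv_def stacked_fun_def[abs_def] stacked_grad_def by (simp add: inner_vec_def)
qed

lemma stacked_grad_lipschitz:
  fixes g :: "'v::finite \<Rightarrow> real^'n \<Rightarrow> real^'n"
  assumes "\<And>i x x'. norm (g i x - g i x') \<le> k * norm (x - x')" and k: "k \<ge> 0"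
  shows "norm (stacked_grad g x - stacked_grad g x') \<le> k * norm (x - x')"
proof (rule power2_le_imp_le)
  have "(norm (g i (x $ i) - g i (x' $ i)))\<^sup>2 \<le> k\<^sup>2 * (norm (x $ i - x' $ i))\<^sup>2" for i
    using power_mono[OF assms(1)[of i "x $ i" "x' $ i"], of 2] by (simp add: power_mult_distrib)
  then show "(norm (stacked_grad g x - stacked_grad g x'))\<^sup>2 \<le> (k * norm (x - x'))\<^sup>2"
    unfolding power_mult_distrib stacked_norm_sq[of "x - x'"] sum_distrib_left
      stacked_norm_sq[of "stacked_grad g x - stacked_grad g x'"]
    by (intro sum_mono) (simp add: stacked_grad_def)
qed (use k in simp)

lemma stacked_grad_monotone:
  fixes g :: "'v::finite \<Rightarrow> real^'n \<Rightarrow> real^'n"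
  assumes "\<And>i x x'. (g i x - g i x') \<bullet> (x - x') \<ge> k * (norm (x - x'))\<^sup>2"
  shows "(stacked_grad g x - stacked_grad g x') \<bullet> (x - x') \<ge> k * (norm (x - x'))\<^sup>2"
  unfolding stacked_norm_sq[of "x - x'"] sum_distrib_left inner_vec_def[of "stacked_grad g x - stacked_grad g x'"]
  using assms by (intro sum_mono) (simp add: stacked_grad_def)

text \<open>For the penalty weight of the algorithm, \<open>2 * k\<close> times the residual is
  exactly the new dual block, so the x-update yields \<open>x_step\<close>.\<close>

lemma penalized_argmin_stationary:
  fixes f :: "'a::euclidean_space \<Rightarrow> real" and R :: "'a \<Rightarrow> 'b::euclidean_space"
  assumes f: "GDERIV f x :> g" and R: "\<And>u. R u = B u + d" and B: "linear B" "\<And>u v. B u \<bullet> v = u \<bullet> Bt v"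
    and min: "is_arg_min (\<lambda>u. f u + p / 2 * (norm (u - z))\<^sup>2 + k * (norm (R u))\<^sup>2) (\<lambda>_. True) x"
  shows "g + p *\<^sub>R (x - z) + (2 * k) *\<^sub>R Bt (R x) = 0"
proof -
  let ?\<phi> = "\<lambda>u. f u + p / 2 * ((u - z) \<bullet> (u - z)) + k * ((B u + d) \<bullet> (B u + d))"
  have fd: "(f has_derivative (\<lambda>h. h \<bullet> g)) (at x)" using f by (simp add: gderiv_def)
  have Bd: "(B has_derivative B) (at x)"
    using B(1) by (simp add: bounded_linear_imp_has_derivative linear_conv_bounded_linear)
  have der: "(?\<phi> has_derivative (\<lambda>h. h \<bullet> (g + p *\<^sub>R (x - z) + (2 * k) *\<^sub>R Bt (R x)))) (at x)"
    by (rule derivative_eq_intros fd Bd refl)+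
       (auto simp: fun_eq_iff R B(2)[symmetric] inner_add_right inner_diff_right inner_commute algebra_simps)
  have "(\<lambda>h. h \<bullet> (g + p *\<^sub>R (x - z) + (2 * k) *\<^sub>R Bt (R x))) = (\<lambda>h. 0)"
  proof (rule has_derivative_local_min[OF der])
    have "?\<phi> x \<le> ?\<phi> y" for y
      using min unfolding is_arg_min_def by (simp add: not_less R power2_norm_eq_inner)
    then show "\<forall>\<^sub>F y in at x. ?\<phi> x \<le> ?\<phi> y" by simp
  qed
  then show ?thesis by (metis inner_eq_zero_iff)
qed

text \<open>The dual iterates \<open>w\<close> are \<open>A\<^sup>T \<mu>\<close> for the accumulated edge differences \<open>\<mu>\<close>.\<close>

lemma PDC_iteration:
  fixes E :: "('v::finite \<times> 'v) set" and B :: "'v \<Rightarrow> real^'n^'m"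
  assumes E: "connected_graph E" and deg: "\<And>i. card (nbrs E i) > 0"
    and d: "\<And>i x. GDERIV (f i) x :> g i x" and gp: "gp > 0"
    and lip: "\<And>i x x'. norm (g i x - g i x') \<le> gp * norm (x - x')"
    and mono: "\<And>i x x'. (g i x - g i x') \<bullet> (x - x') \<ge> gm * (norm (x - x'))\<^sup>2"
    and par: "p + gm > 0" "\<rho> > 0" "0 < \<alpha>" "\<alpha> \<le> \<rho> / 5" "0 < \<beta>" "\<beta> < 1"
    and PDC: "PDC E f B q p \<rho> \<alpha> \<beta> x y z w"
  shows "pdc_iteration (stacked_fun f) (stacked_grad g) gm gp (stacked_map B) (stacked_transpose B)
    (edge_diff E) (adjoint (edge_diff E)) (\<chi> i. (1 / real CARD('v)) *\<^sub>R q) p \<rho> (Lplus_act E)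
    (2 * real CARD('v)) \<alpha> \<beta> x z y (\<lambda>r. \<alpha> *\<^sub>R (\<Sum>s<r. edge_diff E (y s)))"
proof (intro pdc_iteration.intro coupled_problem.intro pdc_iteration_axioms.intro)
  have sym: "sym E" using E by (simp add: connected_graph_def)
  have At_lin: "linear (adjoint (edge_diff E :: real^'m^'v \<Rightarrow> _))"
    by (rule adjoint_linear[OF linear_edge_diff])
  define mu where "mu = (\<lambda>r. \<alpha> *\<^sub>R (\<Sum>s<r. edge_diff E (y s)))"
  have mu_Suc: "mu (Suc r) = mu r + \<alpha> *\<^sub>R edge_diff E (y r)" for r
    by (simp add: mu_def scaleR_add_right)
  have w: "w r = adjoint (edge_diff E) (mu r)" for r
  proof (induction r)
    case 0
    then show ?case using PDC by (simp add: PDC_def mu_def linear_0[OF At_lin])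
  next
    case (Suc r)
    have "w (Suc r) $ i = adjoint (edge_diff E) (mu (Suc r)) $ i" for i
      using PDC Suc unfolding mu_Suc linear_add[OF At_lin] linear_scale[OF At_lin]
      by (simp add: PDC_def adjoint_edge_diff[OF sym])
    then show ?case by (simp add: vec_eq_iff)
  qed
  have x_min: "is_arg_min (\<lambda>\<xi>. f i \<xi> + p / 2 * (norm (\<xi> - z r $ i))\<^sup>2
            + 1 / (4 * \<rho> * real (card (nbrs E i)))
              * (norm (PDC_residual E B q \<rho> (w (Suc r)) (y r) i \<xi>))\<^sup>2) (\<lambda>_. True) (x (Suc r) $ i)"
    and y_Suc: "y (Suc r) $ i = (1 / (2 * \<rho> * real (card (nbrs E i)))) *\<^sub>R
            PDC_residual E B q \<rho> (w (Suc r)) (y r) i (x (Suc r) $ i)"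
    and z_Suc: "z (Suc r) $ i = z r $ i + \<beta> *\<^sub>R (x (Suc r) $ i - z r $ i)" for r i
    using PDC unfolding PDC_def by blast+
  have sd: "GDERIV (stacked_fun f) x :> stacked_grad g x" for x by (intro stacked_gradient d)
  show "continuous_on UNIV (stacked_fun f)"
    using sd unfolding gderiv_def
    by (intro differentiable_imp_continuous_on) (auto simp: differentiable_on_def differentiable_def)
  show "norm (stacked_grad g x - stacked_grad g x') \<le> gp * norm (x - x')" for x x'
    using gp by (intro stacked_grad_lipschitz lip) auto
  then show "stacked_fun f x' \<le> stacked_fun f x + stacked_grad g x \<bullet> (x' - x) + gp / 2 * (norm (x' - x))\<^sup>2" for x x'
    by (intro gradient_quadratic_upper_bound sd)
  show "stacked_fun f x + stacked_grad g x \<bullet> (x' - x) + gm / 2 * (norm (x' - x))\<^sup>2 \<le> stacked_fun f x'" for x x'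
    by (intro gradient_quadratic_lower_bound sd stacked_grad_monotone mono)
  show "linear (stacked_map B)" by (rule linear_stacked_map)
  show "linear (edge_diff E :: real^'m^'v \<Rightarrow> _)" by (rule linear_edge_diff)
  show "linear (Lplus_act E :: real^'m^'v \<Rightarrow> _)" by (rule linear_Lplus_act)
  show "linear (adjoint (edge_diff E :: real^'m^'v \<Rightarrow> _))" by (rule At_lin)
  show "linear (stacked_transpose B)" unfolding stacked_transpose_def by (rule linear_stacked_map)
  show "stacked_map B u \<bullet> v = u \<bullet> stacked_transpose B v" for u v by (rule stacked_map_adjoint)
  show "edge_diff E v \<bullet> e = v \<bullet> adjoint (edge_diff E) e" for v e
    by (simp add: adjoint_works[OF linear_edge_diff])
  show "Lplus_act E u \<bullet> v = u \<bullet> Lplus_act E v" for u v :: "real^'m^'v" by (rule Lplus_act_symmetric[OF sym])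
  show "(norm (Lplus_act E v))\<^sup>2 \<le> 2 * real CARD('v) * (v \<bullet> Lplus_act E v)" for v :: "real^'m^'v"
    by (rule norm_Lplus_act_le[OF sym])
  show "\<alpha> *\<^sub>R (\<Sum>s<Suc r. edge_diff E (y s)) = \<alpha> *\<^sub>R (\<Sum>s<r. edge_diff E (y s)) + \<alpha> *\<^sub>R edge_diff E (y r)" for r
    using mu_Suc[of r] by (simp add: mu_def)
  show "z (Suc r) = z r + \<beta> *\<^sub>R (x (Suc r) - z r)" for r
    by (simp add: vec_eq_iff[of "z (Suc r)"] z_Suc)
  show "stacked_grad g (x (Suc r)) + p *\<^sub>R (x (Suc r) - z r) + stacked_transpose B (y (Suc r)) = 0" for r
  proof -
    have "g i (x (Suc r) $ i) + p *\<^sub>R (x (Suc r) $ i - z r $ i) + transpose (B i) *v (y (Suc r) $ i) = 0" for i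
    proof -
      let ?k = "1 / (4 * \<rho> * real (card (nbrs E i)))"
      have "g i (x (Suc r) $ i) + p *\<^sub>R (x (Suc r) $ i - z r $ i)
          + (2 * ?k) *\<^sub>R (transpose (B i) *v PDC_residual E B q \<rho> (w (Suc r)) (y r) i (x (Suc r) $ i)) = 0"
      proof (rule penalized_argmin_stationary[OF d _ _ _ x_min, where B = "(*v) (B i)" and Bt = "(*v) (transpose (B i))"])
        show "PDC_residual E B q \<rho> (w (Suc r)) (y r) i u = B i *v u
            + (- (1 / real CARD('v)) *\<^sub>R q - w (Suc r) $ i + \<rho> *\<^sub>R (Lplus_act E (y r) $ i))" for u
          by (simp add: PDC_residual_def)
        show "(B i *v u) \<bullet> v = u \<bullet> (transpose (B i) *v v)" for u v
          by (simp add: inner_commute[of "_ *v _"] dot_lmul_matrix[symmetric] inner_commute[of "_ v* _"])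
      qed simp
      then show ?thesis by (simp add: y_Suc matrix_vector_mult_scaleR mult.assoc)
    qed
    then show ?thesis
      by (subst vec_eq_iff) (simp add: stacked_grad_def stacked_transpose_def stacked_map_def)
  qed
  show "stacked_map B (x (Suc r)) - (\<chi> i. (1 / real CARD('v)) *\<^sub>R q)
      - adjoint (edge_diff E) (\<alpha> *\<^sub>R (\<Sum>s<Suc r. edge_diff E (y s)) + \<rho> *\<^sub>R edge_diff E (y (Suc r)))
      = \<rho> *\<^sub>R Lplus_act E (y (Suc r) - y r)" for r
  proof -
    have "(stacked_map B (x (Suc r)) - (\<chi> i. (1 / real CARD('v)) *\<^sub>R q)
        - adjoint (edge_diff E) (mu (Suc r) + \<rho> *\<^sub>R edge_diff E (y (Suc r)))) $ i
      = (\<rho> *\<^sub>R Lplus_act E (y (Suc r) - y r)) $ i" for i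
    proof -
      let ?Y = "y (Suc r)" and ?k = "real (card (nbrs E i))"
      have "(2 * \<rho> * ?k) *\<^sub>R (?Y $ i) = PDC_residual E B q \<rho> (w (Suc r)) (y r) i (x (Suc r) $ i)"
        using deg[of i] par by (subst y_Suc) (auto simp: card_gt_0_iff)
      then have "B i *v x (Suc r) $ i - (1 / real CARD('v)) *\<^sub>R q - w (Suc r) $ i
          = (2 * \<rho> * ?k) *\<^sub>R (?Y $ i) - \<rho> *\<^sub>R (Lplus_act E (y r) $ i)"
        by (simp add: PDC_residual_def)
      \<comment> \<open>The splitting 2 D = L+ + L- applied to the new \<open>y\<close>: the L+ part
        joins the old one in \<open>Lp (y' - y)\<close>, the L- part is
        \<open>At (A y')\<close>.\<close>
      moreover have "(2 * \<rho> * ?k) *\<^sub>R (?Y $ i)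
          = \<rho> *\<^sub>R (Lplus_act E ?Y $ i) + \<rho> *\<^sub>R (\<Sum>j\<in>nbrs E i. ?Y $ i - ?Y $ j)"
      proof -
        have "(\<Sum>j\<in>nbrs E i. ?Y $ i + ?Y $ j) + (\<Sum>j\<in>nbrs E i. ?Y $ i - ?Y $ j) = (2 * ?k) *\<^sub>R (?Y $ i)"
        proof -
          have "(?Y $ i + u) + (?Y $ i - u) = 2 *\<^sub>R (?Y $ i)" for u by (simp only: scaleR_2) simp
          then show ?thesis
            unfolding sum.distrib[symmetric] by (simp only: sum_constant_scaleR scaleR_scaleR mult.commute[of ?k])
        qed
        then have "\<rho> *\<^sub>R ((\<Sum>j\<in>nbrs E i. ?Y $ i + ?Y $ j) + (\<Sum>j\<in>nbrs E i. ?Y $ i - ?Y $ j))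
            = \<rho> *\<^sub>R ((2 * ?k) *\<^sub>R (?Y $ i))" by simp
        then show ?thesis by (simp add: Lplus_act_def scaleR_add_right mult_ac)
      qed
      ultimately show ?thesis
        unfolding linear_add[OF At_lin] linear_scale[OF At_lin] w[symmetric] linear_diff[OF linear_Lplus_act]
        by (simp add: stacked_map_def adjoint_edge_diff[OF sym] algebra_simps)
    qed
    then show ?thesis unfolding mu_def vec_eq_iff by blast
  qed
qed (use par gp in auto)

section \<open>Back from the stacked system to the original KKT conditions\<close>

lemma coupling_eq_iff:
  fixes B :: "'v::finite \<Rightarrow> real^'n^'m"
  assumes E: "connected_graph E"
  shows "(\<exists>\<mu>. stacked_map B x - (\<chi> i. (1 / real CARD('v)) *\<^sub>R q) = adjoint (edge_diff E) \<mu>) \<longleftrightarrow> coupling B x = q"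
proof -
  have "(\<Sum>i\<in>UNIV. (stacked_map B x - (\<chi> i. (1 / real CARD('v)) *\<^sub>R q)) $ i) = coupling B x - q"
    by (simp add: stacked_map_def coupling_def sum_subtractf sum_constant_scaleR del: sum_constant)
  then show ?thesis unfolding range_adjoint_edge_diff[OF E] by simp
qed

lemma constant_inner_defect:
  fixes B :: "'v::finite \<Rightarrow> real^'n^'m"
  shows "(\<chi> i. v) \<bullet> (stacked_map B x - (\<chi> i. (1 / real CARD('v)) *\<^sub>R q)) = v \<bullet> (coupling B x - q)"
proof -
  have "(\<Sum>i\<in>UNIV. (stacked_map B x - (\<chi> i. (1 / real CARD('v)) *\<^sub>R q)) $ i) = coupling B x - q"
    by (simp add: stacked_map_def coupling_def sum_subtractf sum_constant_scaleR del: sum_constant)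
  then show ?thesis by (subst inner_vec_def) (simp add: inner_sum_right[symmetric])
qed

lemma KKT_if_stationary:
  fixes B :: "'v::finite \<Rightarrow> real^'n^'m"
  assumes E: "connected_graph E"
    and st: "stacked_grad g zs + stacked_transpose B ys = 0" and cons: "edge_diff E ys = 0"
    and feas: "\<And>e. edge_diff E e = 0 \<Longrightarrow> e \<bullet> (stacked_map B zs - (\<chi> i. (1 / real CARD('v)) *\<^sub>R q)) = 0"
  shows "KKT g B q zs ys"
proof -
  obtain y0 where y0: "ys = (\<chi> i. y0)" using cons edge_diff_eq_0_iff[OF E] by blast
  have "g i (zs $ i) + transpose (B i) *v y0 = 0" for i
    using arg_cong[OF st, of "\<lambda>v. v $ i"]
    by (simp add: y0 stacked_grad_def stacked_transpose_def stacked_map_def)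
  moreover have "coupling B zs = q"
  proof -
    have "edge_diff E (\<chi> i. coupling B zs - q) = 0" using edge_diff_eq_0_iff[OF E] by blast
    then show ?thesis using feas constant_inner_defect by (metis inner_eq_zero_iff right_minus_eq)
  qed
  ultimately show ?thesis unfolding KKT_def coupling_def using y0 by auto
qed

text \<open>\<open>feas\<close> is tested with the constraint defect repeated at every agent; the
  squared norm of that vector is N times that of the defect, hence the factor
  \<open>CARD('v)\<close>.\<close>

lemma eps_KKT_if_nearly_stationary:
  fixes B :: "'v::finite \<Rightarrow> real^'n^'m"
  assumes E: "connected_graph E" and \<epsilon>: "\<epsilon> \<ge> 0"
    and st: "\<exists>e. edge_diff E e = 0 \<and> (norm (stacked_grad g x + stacked_transpose B e))\<^sup>2 \<le> \<epsilon>"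
    and feas: "\<And>e. edge_diff E e = 0 \<Longrightarrow>
      (e \<bullet> (stacked_map B x - (\<chi> i. (1 / real CARD('v)) *\<^sub>R q)))\<^sup>2 \<le> (norm e)\<^sup>2 * \<epsilon>"
  shows "eps_KKT g B q (real CARD('v) * \<epsilon>) x"
proof -
  have "1 * \<epsilon> \<le> real CARD('v) * \<epsilon>" using \<epsilon> by (intro mult_right_mono) (simp_all add: Suc_leI)
  then have le: "\<epsilon> \<le> real CARD('v) * \<epsilon>" by simp
  obtain e where e: "edge_diff E e = 0" "(norm (stacked_grad g x + stacked_transpose B e))\<^sup>2 \<le> \<epsilon>"
    using st by blast
  obtain y0 where "e = (\<chi> i. y0)" using e(1) edge_diff_eq_0_iff[OF E, of e] by blast
  then have "(norm (stacked_grad g x + stacked_transpose B (\<chi> i. y0)))\<^sup>2 \<le> \<epsilon>" using e(2) by simp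
  then have "(\<Sum>i\<in>UNIV. (norm (g i (x $ i) + transpose (B i) *v y0))\<^sup>2) \<le> \<epsilon>"
    unfolding stacked_norm_sq[of "stacked_grad g x + _"]
    by (simp add: stacked_grad_def stacked_transpose_def stacked_map_def)
  then have 1: "(\<Sum>i\<in>UNIV. (norm (g i (x $ i) + transpose (B i) *v y0))\<^sup>2) \<le> real CARD('v) * \<epsilon>"
    using le by linarith
  define v where "v = coupling B x - q"
  have "edge_diff E (\<chi> i. v) = 0" using edge_diff_eq_0_iff[OF E] by blast
  from feas[OF this] have "(v \<bullet> v)\<^sup>2 \<le> (norm (\<chi> i::'v. v))\<^sup>2 * \<epsilon>" unfolding constant_inner_defect v_def[symmetric] .
  then have v: "(norm v)\<^sup>2 * (norm v)\<^sup>2 \<le> (norm v)\<^sup>2 * (real CARD('v) * \<epsilon>)"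
    unfolding stacked_norm_sq[of "\<chi> i::'v. v"] by (simp add: dot_square_norm power2_eq_square mult_ac)
  have "(norm v)\<^sup>2 \<le> real CARD('v) * \<epsilon>"
  proof (cases "v = 0")
    case False
    then show ?thesis using v by (intro mult_left_le_imp_le[OF v]) simp
  qed (use \<epsilon> in simp)
  then show ?thesis using 1 unfolding eps_KKT_def v_def coupling_def by blast
qed

text \<open>The multiplier of the coupling constraint, repeated at every agent, is the consensual
  dual part of the saddle point.\<close>

lemma strongly_convex_saddle_point:
  fixes B :: "'v::finite \<Rightarrow> real^'n^'m"
  assumes E: "connected_graph E" and gm: "gm > 0" and x0: "coupling B x0 = q"
    and cont: "continuous_on UNIV F" "continuous_on UNIV G"
    and sc: "\<And>x x'. F x' \<ge> F x + G x \<bullet> (x' - x) + gm / 2 * (norm (x' - x))\<^sup>2"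
  obtains xs ys \<mu> where "G xs + stacked_transpose B ys = 0" "edge_diff E ys = 0"
    "stacked_map B xs - (\<chi> i. (1 / real CARD('v)) *\<^sub>R q) = adjoint (edge_diff E) \<mu>"
proof -
  have "\<exists>x v. coupling B x = coupling B x0 \<and> G x + stacked_transpose B (\<chi> i. v) = 0"
  proof (rule strongly_convex_constrained_minimum[where \<phi> = F, OF cont sc gm linear_coupling _ coupling_adjoint])
    show "linear (\<lambda>v. stacked_transpose B (\<chi> i. v))"
      unfolding stacked_transpose_def
      by (intro linearI) (simp_all add: stacked_map_def vec_eq_iff matrix_vector_right_distrib matrix_vector_mult_scaleR)
  qed
  then obtain xs v where 1: "coupling B xs = q" "G xs + stacked_transpose B (\<chi> i. v) = 0" using x0 by auto
  moreover have "edge_diff E (\<chi> i. v) = 0" using edge_diff_eq_0_iff[OF E] by blast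
  moreover obtain \<mu> where "stacked_map B xs - (\<chi> i. (1 / real CARD('v)) *\<^sub>R q) = adjoint (edge_diff E) \<mu>"
    using 1(1) coupling_eq_iff[OF E] by blast
  ultimately show ?thesis using that by blast
qed

lemma monotone_le_lipschitz:
  fixes g :: "real^'n \<Rightarrow> real^'n"
  assumes "\<And>x x'. norm (g x - g x') \<le> gp * norm (x - x')"
    and "\<And>x x'. (g x - g x') \<bullet> (x - x') \<ge> gm * (norm (x - x'))\<^sup>2"
  shows "gm \<le> gp"
proof -
  obtain u :: "real^'n" where u: "norm u = 1" using vector_choose_size[of 1] by auto
  have "gm \<le> (g u - g 0) \<bullet> u" using assms(2)[of u 0] u by simp
  also have "\<dots> \<le> norm (g u - g 0) * norm u" by (rule norm_cauchy_schwarz)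
  also have "\<dots> \<le> gp" using assms(1)[of u 0] u by simp
  finally show ?thesis .
qed

text \<open>The disjunctions on \<open>\<theta>\<^sub>1\<close> allow for a vanishing
  \<open>lam\<close> or \<open>b\<close>; the nonzero denominator in \<open>beta_small\<close> then
  excludes these cases.\<close>

lemma PDC_convergence:
  fixes E :: "('v::{finite,linorder} \<times> 'v) set" and B :: "'v \<Rightarrow> real^'n^'m"
  assumes E: "connected_graph E"
    and d: "\<And>i x. GDERIV (f i) x :> g i x" and gp: "gp > 0"
    and lip: "\<And>i x x'. norm (g i x - g i x') \<le> gp * norm (x - x')"
    and mono: "\<And>i x x'. (g i x - g i x') \<bullet> (x - x') \<ge> gm * (norm (x - x'))\<^sup>2"
    and \<theta>: "\<And>u e v. (v \<bullet> (stacked_map B u - adjoint (edge_diff E) e))\<^sup>2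
        \<le> \<theta>\<^sup>2 * (norm (stacked_map B u - adjoint (edge_diff E) e))\<^sup>2
          * ((norm (stacked_transpose B v))\<^sup>2 + (norm (edge_diff E v))\<^sup>2)"
    and lam: "lam = lambda_max TYPE('m) E" and k: "k = \<theta>\<^sup>2 * (2 * real CARD('v))"
    and \<theta>\<^sub>1: "\<theta>\<^sub>1 \<ge> 1" "lam = 0 \<or> 3 * k \<le> lam\<^sup>2 * \<theta>\<^sub>1\<^sup>2"
      "lam = 0 \<or> b = 0 \<or> 2 * k \<le> b\<^sup>2 * lam\<^sup>2 * \<theta>\<^sub>1\<^sup>2"
    and par: "p > - gm" "\<rho> > 0" "0 < \<alpha>" "0 < \<beta>" "\<beta> < 1"
    and \<alpha>: "alpha_small \<theta>\<^sub>1 lam p \<rho> gm gp \<alpha>" and \<beta>: "beta_small \<theta>\<^sub>1 \<theta>\<^sub>2 b lam p \<rho> gm gp \<beta>"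
    and PDC: "PDC E f B q p \<rho> \<alpha> \<beta> x y z w"
  shows "limit_point (\<lambda>r. (z r, y r)) (zs, ys) \<Longrightarrow> KKT g B q zs ys"
    and "finite_optimal_value f B q \<Longrightarrow> \<exists>C > 0. \<forall>r \<ge> 1. \<exists>t < r. eps_KKT g B q (C / real r) (z t)"
proof -
  have nz: "p \<noteq> 0" "b \<noteq> 0" "lam \<noteq> 0"
    using \<beta> by (auto simp: beta_small_def sigma2_def)
  then have k': "3 * k \<le> lam\<^sup>2 * \<theta>\<^sub>1\<^sup>2" "2 * k \<le> b\<^sup>2 * lam\<^sup>2 * \<theta>\<^sub>1\<^sup>2"
    using \<theta>\<^sub>1 by auto
  have m: "p + gm > 0" "gm \<le> gp"
    using par monotone_le_lipschitz[OF lip mono] by auto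
  have \<alpha>': "\<alpha> \<le> \<rho> / 5" using \<alpha> by (simp add: alpha_small_def)
  have k0: "k \<ge> 0" by (simp add: k)
  interpret pdc_iteration "stacked_fun f" "stacked_grad g" gm gp "stacked_map B" "stacked_transpose B"
    "edge_diff E" "adjoint (edge_diff E)" "\<chi> i. (1 / real CARD('v)) *\<^sub>R q" p \<rho> "Lplus_act E"
    "2 * real CARD('v)" \<alpha> \<beta> x z y "\<lambda>r. \<alpha> *\<^sub>R (\<Sum>s<r. edge_diff E (y s))"
    by (rule PDC_iteration[OF E nbrs_nonempty_if_lambda_max[OF E] d gp lip mono m(1) par(2,3) \<alpha>' par(4,5) PDC])
       (use nz lam in auto)
  have feasible_iff: "feasible \<longleftrightarrow> (\<exists>x. coupling B x = q)"
    unfolding feasible_def using coupling_eq_iff[OF E] by blast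
  \<comment> \<open>Two lower bounds are kept apart: one along subsequences with convergent
    \<open>z\<close>, for the limit points, and a uniform one under a finite optimal value, for the
    rate.\<close>
  have descent: "\<exists>\<Phi>. (\<exists>\<kappa>>0. \<forall>r. \<Phi> (Suc r) \<le> \<Phi> r - \<kappa> * residual r)
      \<and> (\<forall>s zs. (\<lambda>k. z (s k)) \<longlonglongrightarrow> zs \<longrightarrow> (\<exists>b. \<forall>k. \<Phi> (s k) \<ge> b))
      \<and> (finite_optimal_value f B q \<longrightarrow> (\<exists>b. \<forall>r. \<Phi> r \<ge> b))"
    if feas: feasible
  proof (cases "p > 0")
    case True
    have "\<exists>\<kappa>>0. \<forall>r. potential (Suc r) \<le> potential r - \<kappa> * residual r"
    proof (rule potential_descent[OF feas True _ \<theta>])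
      show "p + gp > 0" using m by simp
      show "8 * \<theta>\<^sup>2 * (2 * real CARD('v)) * (\<rho> * (p + gp) + 1) * \<alpha> \<le> \<rho>"
        using alpha_small_imp[OF m par(2) nz(3) k0 k'(1) par(3) \<alpha>] by (simp add: k mult_ac)
      note bs = beta_small_pos_imp[OF True m par(2) k0 k'(2) \<theta>\<^sub>1(1) par(4,5) \<beta>]
      show "20 * p * \<beta> * \<theta>\<^sup>2 * (2 * real CARD('v)) * (\<rho> * (p + gp) + 1) \<le> p + gm"
        using bs(1) by (simp add: k mult_ac)
      show "3 / 10 \<le> 1 - \<beta> * (p / (p + gm) + 1 / 2)" by (rule bs(2))
    qed
    moreover have "\<exists>b. \<forall>r. potential r \<ge> b" if fin: "finite_optimal_value f B q"
    proof -
      obtain b where b: "\<And>x. coupling B x = q \<Longrightarrow> b \<le> stacked_fun f x"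
        using fin unfolding finite_optimal_value_def bdd_below_def feasible_set_def coupling_def stacked_fun_def
        by auto
      have "potential r \<ge> b" for r
        by (rule potential_bounded_below[OF feas True]) (use b coupling_eq_iff[OF E] in blast)
      then show ?thesis by blast
    qed
    ultimately show ?thesis
      using potential_bounded_below_along_convergent[OF feas] by (intro exI[of _ potential]) blast
  next
    case False
    then have p: "p < 0" using nz by simp
    then have gm: "gm \<ge> - 6 * p" by (rule beta_small_neg_imp[OF _ m par(2,4) \<beta>])
    then have "gm > 0" using p by linarith
    moreover obtain x0 where "coupling B x0 = q" using feas feasible_iff by blast
    ultimately obtain xs ys \<mu> where "stacked_grad g xs + stacked_transpose B ys = 0" "edge_diff E ys = 0"
      "stacked_map B xs - (\<chi> i. (1 / real CARD('v)) *\<^sub>R q) = adjoint (edge_diff E) \<mu>"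
      using strongly_convex_saddle_point[OF E _ _ f_cont g_cont f_lower] by blast
    then have "\<exists>\<kappa>>0. \<forall>r. saddle_distance xs ys \<mu> (Suc r) \<le> saddle_distance xs ys \<mu> r - \<kappa> * residual r"
      by (rule saddle_distance_descent[OF p gm])
    then show ?thesis
      using saddle_distance_nonneg[OF p] by (intro exI[of _ "saddle_distance xs ys \<mu>"]) blast
  qed
  show "KKT g B q zs ys" if lp: "limit_point (\<lambda>r. (z r, y r)) (zs, ys)"
  proof -
    obtain s where s: "strict_mono s" and l: "(\<lambda>k. (z (s k), y (s k))) \<longlonglongrightarrow> (zs, ys)"
      using lp unfolding limit_point_def o_def by blast
    have l1: "(\<lambda>k. z (s k)) \<longlonglongrightarrow> zs" and l2: "(\<lambda>k. y (s k)) \<longlonglongrightarrow> ys"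
      using tendsto_fst[OF l] tendsto_snd[OF l] by simp_all
    obtain \<Phi> b where "\<exists>\<kappa>>0. \<forall>r. \<Phi> (Suc r) \<le> \<Phi> r - \<kappa> * residual r" "\<And>k. \<Phi> (s k) \<ge> b"
      using descent[OF feasible_if_convergent_subsequence[OF s l2]] l1 by blast
    from limit_point_of_descent[where \<Phi> = \<Phi>, OF this(1) s this(2) l1 l2]
    show ?thesis by (intro KKT_if_stationary[OF E]) auto
  qed
  show "\<exists>C > 0. \<forall>r \<ge> 1. \<exists>t < r. eps_KKT g B q (C / real r) (z t)" if fin: "finite_optimal_value f B q"
  proof -
    have feasible
      using fin unfolding finite_optimal_value_def feasible_set_def feasible_iff coupling_def by blast
    then obtain \<Phi> b where desc: "\<exists>\<kappa>>0. \<forall>r. \<Phi> (Suc r) \<le> \<Phi> r - \<kappa> * residual r" and b: "\<And>r. \<Phi> r \<ge> b"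
      using descent fin by blast
    obtain C where C: "C > 0"
      "\<And>n. n \<ge> 1 \<Longrightarrow> \<exists>t<n. (\<exists>e. edge_diff E e = 0 \<and> (norm (stacked_grad g (z t) + stacked_transpose B e))\<^sup>2 \<le> C / real n) \<and>
        (\<forall>e. edge_diff E e = 0 \<longrightarrow> (e \<bullet> (stacked_map B (z t) - (\<chi> i. (1 / real CARD('v)) *\<^sub>R q)))\<^sup>2 \<le> (norm e)\<^sup>2 * (C / real n))"
      using rate_of_descent[where \<Phi> = \<Phi>, OF desc b] by blast
    have "\<exists>t<r. eps_KKT g B q (real CARD('v) * C / real r) (z t)" if r: "r \<ge> 1" for r
    proof -
      obtain t where t: "t < r" "\<exists>e. edge_diff E e = 0 \<and> (norm (stacked_grad g (z t) + stacked_transpose B e))\<^sup>2 \<le> C / real r"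
        "\<And>e. edge_diff E e = 0 \<Longrightarrow> (e \<bullet> (stacked_map B (z t) - (\<chi> i. (1 / real CARD('v)) *\<^sub>R q)))\<^sup>2 \<le> (norm e)\<^sup>2 * (C / real r)"
        using C(2)[OF r] by blast
      then show ?thesis
        using eps_KKT_if_nearly_stationary[OF E _ t(2,3)] C(1) by auto
    qed
    then show ?thesis using C(1) by (intro exI[of _ "real CARD('v) * C"]) simp
  qed
qed

theorem theorem1:
  fixes f :: "'v::{finite,linorder} \<Rightarrow> real^'n \<Rightarrow> real"
    and g :: "'v \<Rightarrow> real^'n \<Rightarrow> real^'n"
    and B :: "'v \<Rightarrow> real^'n^'m"
    and q :: "real^'m"
    and E :: "('v \<times> 'v) set"
    and gm gp :: real
  assumes "connected_graph E"
    and "\<And>i x. GDERIV (f i) x :> g i x"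
    and "\<And>i. continuous_on UNIV (g i)"
    and "gp > 0"
    and "\<And>i. gp-lipschitz_on UNIV (g i)"
    and "\<And>i x x'. (g i x - g i x') \<bullet> (x - x') \<ge> gm * (norm (x - x'))\<^sup>2"
  shows "\<exists>\<theta>\<^sub>1 > 0. \<exists>\<theta>\<^sub>2 > 0. \<forall>p \<rho> \<alpha> \<beta> :: real.
    p > - gm \<longrightarrow> \<rho> > 0 \<longrightarrow> 0 < \<alpha> \<longrightarrow> \<alpha> < \<rho> \<longrightarrow> 0 < \<beta> \<longrightarrow> \<beta> < 1 \<longrightarrow>
    alpha_small \<theta>\<^sub>1 (lambda_max TYPE('m) E) p \<rho> gm gp \<alpha> \<longrightarrow>
    beta_small \<theta>\<^sub>1 \<theta>\<^sub>2 (B_max B) (lambda_max TYPE('m) E) p \<rho> gm gp \<beta> \<longrightarrow>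
    (\<forall>x y z w. PDC E f B q p \<rho> \<alpha> \<beta> x y z w \<longrightarrow>
      (\<forall>zs ys. limit_point (\<lambda>r. (z r, y r)) (zs, ys) \<longrightarrow> KKT g B q zs ys) \<and>
      (finite_optimal_value f B q \<longrightarrow>
        (\<exists>C > 0. \<forall>r \<ge> 1. \<exists>t < r. eps_KKT g B q (C / real r) (z t))))"
proof -
  have lip: "norm (g i x - g i x') \<le> gp * norm (x - x')" for i x x'
    using lipschitz_onD[OF assms(5)] by (simp add: dist_norm)
  obtain \<theta> where \<theta>: "\<And>u e v. (v \<bullet> (stacked_map B u - adjoint (edge_diff E) e))\<^sup>2
        \<le> \<theta>\<^sup>2 * (norm (stacked_map B u - adjoint (edge_diff E) e))\<^sup>2
          * ((norm (stacked_transpose B v))\<^sup>2 + (norm (edge_diff E v))\<^sup>2)"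
    by (rule dual_inner_bound[OF linear_stacked_map adjoint_linear[OF linear_edge_diff] stacked_map_adjoint
        adjoint_works[OF linear_edge_diff, symmetric]]) (rule that)
  define lam b k where "lam = lambda_max TYPE('m) E" and "b = B_max B" and "k = \<theta>\<^sup>2 * (2 * real CARD('v))"
  \<comment> \<open>The sum dominates each required quotient, and being at least 1 it is dominated
    by its own square. If \<open>lam\<close> or \<open>b\<close> is zero, division by zero gives a
    harmless summand 0.\<close>
  define \<theta>\<^sub>1 where "\<theta>\<^sub>1 = 1 + 3 * k / lam\<^sup>2 + 2 * k / (b\<^sup>2 * lam\<^sup>2)"
  have k: "k \<ge> 0" by (simp add: k_def)
  have ge: "\<theta>\<^sub>1 \<ge> 1" "\<theta>\<^sub>1 \<ge> 3 * k / lam\<^sup>2" "\<theta>\<^sub>1 \<ge> 2 * k / (b\<^sup>2 * lam\<^sup>2)"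
    using k by (simp_all add: \<theta>\<^sub>1_def)
  have sq: "\<theta>\<^sub>1 \<le> \<theta>\<^sub>1\<^sup>2" using ge(1) by (simp add: power2_eq_square)
  have 1: "lam = 0 \<or> 3 * k \<le> lam\<^sup>2 * \<theta>\<^sub>1\<^sup>2"
  proof -
    have "3 * k / lam\<^sup>2 \<le> \<theta>\<^sub>1\<^sup>2" using ge(2) sq by linarith
    then show ?thesis by (cases "lam = 0") (simp_all add: field_simps)
  qed
  have 2: "lam = 0 \<or> b = 0 \<or> 2 * k \<le> b\<^sup>2 * lam\<^sup>2 * \<theta>\<^sub>1\<^sup>2"
  proof -
    have "2 * k / (b\<^sup>2 * lam\<^sup>2) \<le> \<theta>\<^sub>1\<^sup>2" using ge(3) sq by linarith
    then show ?thesis by (cases "lam = 0 \<or> b = 0") (auto simp: field_simps)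
  qed
  show ?thesis
    unfolding lam_def[symmetric] b_def[symmetric]
  proof (rule exI[of _ \<theta>\<^sub>1], rule conjI)
    show "\<theta>\<^sub>1 > 0" using ge(1) by simp
    show "\<exists>\<theta>\<^sub>2 > 0. \<forall>p \<rho> \<alpha> \<beta> :: real.
      p > - gm \<longrightarrow> \<rho> > 0 \<longrightarrow> 0 < \<alpha> \<longrightarrow> \<alpha> < \<rho> \<longrightarrow> 0 < \<beta> \<longrightarrow> \<beta> < 1 \<longrightarrow>
      alpha_small \<theta>\<^sub>1 lam p \<rho> gm gp \<alpha> \<longrightarrow> beta_small \<theta>\<^sub>1 \<theta>\<^sub>2 b lam p \<rho> gm gp \<beta> \<longrightarrow>
      (\<forall>x y z w. PDC E f B q p \<rho> \<alpha> \<beta> x y z w \<longrightarrow>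
        (\<forall>zs ys. limit_point (\<lambda>r. (z r, y r)) (zs, ys) \<longrightarrow> KKT g B q zs ys) \<and>
        (finite_optimal_value f B q \<longrightarrow>
          (\<exists>C > 0. \<forall>r \<ge> 1. \<exists>t < r. eps_KKT g B q (C / real r) (z t))))"
    proof (rule exI[of _ 1], intro conjI allI impI)
      fix p \<rho> \<alpha> \<beta> x y z w
      assume par: "p > - gm" "\<rho> > 0" "0 < \<alpha>" "0 < \<beta>" "\<beta> < 1" "alpha_small \<theta>\<^sub>1 lam p \<rho> gm gp \<alpha>"
        "beta_small \<theta>\<^sub>1 1 b lam p \<rho> gm gp \<beta>" and pdc: "PDC E f B q p \<rho> \<alpha> \<beta> x y z w"
      note conv = PDC_convergence[OF assms(1,2,4) lip assms(6) \<theta> lam_def k_def ge(1) 1 2 par pdc]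
      show "KKT g B q zs ys" if "limit_point (\<lambda>r. (z r, y r)) (zs, ys)" for zs ys
        using that by (rule conv(1))
      show "\<exists>C > 0. \<forall>r \<ge> 1. \<exists>t < r. eps_KKT g B q (C / real r) (z t)"
        if "finite_optimal_value f B q"
        using that by (rule conv(2))
    qed simp
  qed
qed

end
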